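(* Let $n\ge 2$ and $d\ge 1$ be integers. Then $$\boldsymbol{\lambda}\big(\mathcal{H}_d(\mathbb{S}^{n-1})\big)=N_{n,d}\int_{\mathbb{S}^{n-1}}\big|L^{\diamond}_{n,d}(\eta_1)\big|\,d\sigma_n(\eta),$$ $$\boldsymbol{\lambda}\big(\mathcal{P}_d(\mathbb{S}^{n-1})\big)=\int_{\mathbb{S}^{n-1}}\Big|\sum_{j=0}^{\lfloor d/2\rfloor}N_{n,d-2j}\,L^{\diamond}_{n,d-2j}(\eta_1)\Big|\,d\sigma_n(\eta),$$ $$\boldsymbol{\lambda}\big(\mathcal{P}_{\le d}(\mathbb{S}^{n-1})\big)=\int_{\mathbb{S}^{n-1}}\Big|\sum_{j=0}^{d}N_{n,j}\,L^{\diamond}_{n,j}(\eta_1)\Big|\,d\sigma_n(\eta).$$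
   Context: $\mathbb{S}^{n-1}$ is the Euclidean unit sphere of $\mathbb{R}^n$, $\sigma_n$ its normalized rotation-invariant surface measure, and $\eta_1$ is the first coordinate of $\eta\in\mathbb{S}^{n-1}$. All polynomials on $\mathbb{R}^n$ have complex coefficients. $\mathcal{P}_d(\mathbb{S}^{n-1})$, $\mathcal{P}_{\le d}(\mathbb{S}^{n-1})$ and $\mathcal{H}_d(\mathbb{S}^{n-1})$ are the spaces of restrictions to $\mathbb{S}^{n-1}$ of, respectively, $d$-homogeneous polynomials, polynomials of degree at most $d$, and $d$-homogeneous harmonic polynomials ($\Delta f=0$) on $\mathbb{R}^n$; all are complex Banach spaces under the supremum norm on $\mathbb{S}^{n-1}$. $N_{n,k}=\dim\mathcal{H}_k(\mathbb{S}^{n-1})$, which equals $\frac{(n+2k-2)(n+k-3)!}{k!\,(n-2)!}$ for $k\ge1$, and $1$ for $k=0$. $L^{\diamond}_{n,k}\colon[-1,1]\to\mathbb{R}$ is the Legendre polynomial of degree $k$ in $n$ dimensions: $$L^{\diamond}_{n,k}(t)=\sum_{j=0}^{\lfloor k/2\rfloor}b_j(n,k)\,t^{k-2j}(1-t^2)^j,\qquad b_j(n,k)=\frac{(-1)^j\,k!\,\Gamma\big(\frac{n-1}{2}\big)}{4^j\,j!\,(k-2j)!\,\Gamma\big(j+\frac{n-1}{2}\big)}.$$ For a subspace $X$ of a Banach space $Y$, $\boldsymbol{\lambda}(X,Y)=\inf\{\|P\|: P\in\mathcal{L}(Y,X),\ P|_X=\mathrm{id}_X\}$ (with $\inf\varnothing=\infty$).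 The (absolute) projection constant of $X$ is $\boldsymbol{\lambda}(X)=\sup\boldsymbol{\lambda}(I(X),Y)$, the supremum over all complex Banach spaces $Y$ and all linear isometric embeddings $I\colon X\to Y$. *)

theory Defs
  imports
    "HOL-Analysis.Analysis"
    "HOL-Algebra.Module"
    "HOL-Library.Function_Algebras"
begin

section \<open>Complex Banach spaces with explicit carrier\<close>

text \<open>
  The absolute projection constant quantifies over all complex Banach spaces, so Banach spaces
  are objects here (carrier, operations, norm) and not types.
\<close>

definition complex_ring :: "complex ring" where
  "complex_ring = \<lparr>carrier = UNIV, mult = (*), one = 1, zero = 0, add = (+)\<rparr>"

record 'v nspace = "(complex, 'v) module" +
  vnorm :: "'v \<Rightarrow> real"

locale complex_banach = Module.module complex_ring Y for Y :: "'v nspace" (structure) +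
  assumes vnorm_eq_0_iff: "x \<in> carrier Y \<Longrightarrow> vnorm Y x = 0 \<longleftrightarrow> x = \<zero>"
    and vnorm_smult: "x \<in> carrier Y \<Longrightarrow> vnorm Y (c \<odot>\<^bsub>Y\<^esub> x) = cmod c * vnorm Y x"
    and vnorm_triangle:
      "x \<in> carrier Y \<Longrightarrow> y \<in> carrier Y \<Longrightarrow> vnorm Y (x \<oplus> y) \<le> vnorm Y x + vnorm Y y"
    and complete: "Metric_space.mcomplete (carrier Y) (\<lambda>x y. vnorm Y (x \<ominus> y))"

definition linear_op :: "'v nspace \<Rightarrow> 'w nspace \<Rightarrow> ('v \<Rightarrow> 'w) \<Rightarrow> bool" where
  "linear_op X Y T \<longleftrightarrow>
     T \<in> carrier X \<rightarrow> carrier Y \<and>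
     (\<forall>x\<in>carrier X. \<forall>y\<in>carrier X. T (x \<oplus>\<^bsub>X\<^esub> y) = T x \<oplus>\<^bsub>Y\<^esub> T y) \<and>
     (\<forall>c. \<forall>x\<in>carrier X. T (c \<odot>\<^bsub>X\<^esub> x) = c \<odot>\<^bsub>Y\<^esub> T x)"

definition linear_isometry :: "'v nspace \<Rightarrow> 'w nspace \<Rightarrow> ('v \<Rightarrow> 'w) \<Rightarrow> bool" where
  "linear_isometry X Y I \<longleftrightarrow>
     linear_op X Y I \<and> (\<forall>x\<in>carrier X. vnorm Y (I x) = vnorm X x)"

definition op_norm :: "'v nspace \<Rightarrow> 'w nspace \<Rightarrow> ('v \<Rightarrow> 'w) \<Rightarrow> ereal" where
  "op_norm X Y T = (SUP x\<in>{x \<in> carrier X. vnorm X x \<le> 1}. ereal (vnorm Y (T x)))"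


section \<open>Projection constants\<close>

text \<open>The infimum is taken in the extended reals, so it is \<open>\<infinity>\<close> if there is no projection.\<close>

definition rel_projection_const :: "'v set \<Rightarrow> 'v nspace \<Rightarrow> ereal" where
  "rel_projection_const X Y =
     Inf {op_norm Y Y P | P.
       linear_op Y Y P \<and> op_norm Y Y P < \<infinity> \<and>
       P ` carrier Y \<subseteq> X \<and> (\<forall>x\<in>X. P x = x)}"

text \<open>
  HOL cannot quantify over all Banach spaces of all types inside a formula. The supremum is over
  the Banach spaces whose carrier is a subset of a given type \<open>'u\<close>, which plays the role of a
  universe and is an explicit parameter. A statement that is polymorphic in \<open>'u\<close> reaches every
  Banach space. A nonzero complex Banach space has at least the cardinality of the continuum, so a
  type \<open>'u\<close> into which the reals do not inject carries no nonzero Banach space at all, and the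
  hypothesis that they do inject is needed in every statement about a nonzero \<open>X\<close>.
\<close>

definition projection_const :: "'u itself \<Rightarrow> 'v nspace \<Rightarrow> ereal" where
  "projection_const U X =
     Sup {rel_projection_const (I ` carrier X) Y | (Y :: 'u nspace) I.
       complex_banach Y \<and> linear_isometry X Y I}"


section \<open>Spaces of polynomials on the sphere\<close>

text \<open>A multi-index is a function \<open>\<alpha> :: 'n \<Rightarrow> nat\<close>; its degree is \<open>sum \<alpha> UNIV\<close>.\<close>

definition monomial_fun :: "('n::finite \<Rightarrow> nat) \<Rightarrow> real^'n \<Rightarrow> complex" where
  "monomial_fun \<alpha> x = (\<Prod>i\<in>UNIV. complex_of_real (x $ i) ^ \<alpha> i)"

definition hom_polys :: "nat \<Rightarrow> (real^'n::finite \<Rightarrow> complex) set" where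
  "hom_polys d = {\<lambda>x. \<Sum>\<alpha> | sum \<alpha> UNIV = d. c \<alpha> * monomial_fun \<alpha> x | c. True}"

definition polys_le :: "nat \<Rightarrow> (real^'n::finite \<Rightarrow> complex) set" where
  "polys_le d = {\<lambda>x. \<Sum>\<alpha> | sum \<alpha> UNIV \<le> d. c \<alpha> * monomial_fun \<alpha> x | c. True}"

definition partial_deriv :: "'n::finite \<Rightarrow> (real^'n \<Rightarrow> complex) \<Rightarrow> real^'n \<Rightarrow> complex" where
  "partial_deriv i f x = vector_derivative (\<lambda>t. f (x + t *\<^sub>R axis i 1)) (at 0)"

definition laplacian :: "(real^'n::finite \<Rightarrow> complex) \<Rightarrow> real^'n \<Rightarrow> complex" where
  "laplacian f x = (\<Sum>i\<in>UNIV. partial_deriv i (partial_deriv i f) x)"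

definition harmonic_hom_polys :: "nat \<Rightarrow> (real^'n::finite \<Rightarrow> complex) set" where
  "harmonic_hom_polys d = {f \<in> hom_polys d. \<forall>x. laplacian f x = 0}"

text \<open>
  A function on the sphere is represented by its extension by zero. The functions on the sphere
  then form a linear subspace of \<open>real^'n \<Rightarrow> complex\<close> with its pointwise operations.
\<close>

definition sphere_restr :: "(real^'n::finite \<Rightarrow> complex) \<Rightarrow> real^'n \<Rightarrow> complex" where
  "sphere_restr f = (\<lambda>x. if x \<in> sphere 0 1 then f x else 0)"

definition Pd_sphere :: "nat \<Rightarrow> (real^'n::finite \<Rightarrow> complex) set" where
  "Pd_sphere d = sphere_restr ` hom_polys d"

definition Ple_sphere :: "nat \<Rightarrow> (real^'n::finite \<Rightarrow> complex) set" where
  "Ple_sphere d = sphere_restr ` polys_le d"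

definition Hd_sphere :: "nat \<Rightarrow> (real^'n::finite \<Rightarrow> complex) set" where
  "Hd_sphere d = sphere_restr ` harmonic_hom_polys d"

text \<open>The record fields \<open>mult\<close> and \<open>one\<close>, inherited from rings, play no role in a module.\<close>

definition sup_normed :: "(real^'n::finite \<Rightarrow> complex) set \<Rightarrow> (real^'n \<Rightarrow> complex) nspace" where
  "sup_normed F =
     \<lparr>carrier = F, mult = undefined, one = undefined, zero = 0, add = (+),
      smult = (\<lambda>c f x. c * f x), vnorm = (\<lambda>f. SUP x\<in>sphere 0 1. cmod (f x))\<rparr>"


section \<open>Dimension and Legendre polynomials\<close>

interpretation cfun: vector_space "\<lambda>c (f :: 'a \<Rightarrow> complex) x. c * f x"
  by standard (simp_all add: fun_eq_iff algebra_simps)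

definition N_dim :: "'n::finite itself \<Rightarrow> nat \<Rightarrow> nat" where
  "N_dim n k = cfun.dim (Hd_sphere k :: (real^'n \<Rightarrow> complex) set)"

definition legendre_coeff :: "nat \<Rightarrow> nat \<Rightarrow> nat \<Rightarrow> real" where
  "legendre_coeff n k j =
     ((-1) ^ j * fact k * Gamma ((real n - 1) / 2)) /
     (4 ^ j * fact j * fact (k - 2 * j) * Gamma (real j + (real n - 1) / 2))"

definition legendre :: "nat \<Rightarrow> nat \<Rightarrow> real \<Rightarrow> real" where
  "legendre n k t = (\<Sum>j\<le>k div 2. legendre_coeff n k j * t ^ (k - 2 * j) * (1 - t\<^sup>2) ^ j)"


section \<open>The normalized surface measure of the sphere\<close>

text \<open>
  The image of the uniform distribution on the unit ball under the radial projection
  \<open>sgn x = x / \<parallel>x\<parallel>\<close>. The lemmas below show that it is a rotation-invariant Borel probability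
  measure on the sphere; these properties determine it uniquely.
\<close>

definition sphere_measure :: "(real^'n::finite) measure" where
  "sphere_measure =
     restrict_space (distr (uniform_measure lborel (ball 0 1)) borel sgn) (sphere 0 1)"

lemma space_sphere_measure: "space (sphere_measure :: (real^'n::finite) measure) = sphere 0 1"
  by (simp add: sphere_measure_def space_restrict_space)

lemma sets_sphere_measure:
  "sets (sphere_measure :: (real^'n::finite) measure) = sets (restrict_space borel (sphere 0 1))"
  by (simp add: sphere_measure_def sets_restrict_space)

lemma sgn_borel_measurable: "(sgn :: real^'n::finite \<Rightarrow> _) \<in> borel_measurable borel"
  unfolding sgn_div_norm[abs_def] by measurable

lemma emeasure_sphere_measure:
  fixes A :: "(real^'n::finite) set"
  assumes "A \<in> sets sphere_measure"
  shows "emeasure sphere_measure A =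
    emeasure lborel (ball 0 1 \<inter> sgn -` A) / emeasure lborel (ball 0 1 :: (real^'n) set)"
proof -
  have A: "A \<in> sets borel" "A \<subseteq> sphere 0 1"
    using assms by (auto simp: sets_sphere_measure sets_restrict_space)
  have [measurable]: "sgn -` A \<in> sets borel"
    using measurable_sets[OF sgn_borel_measurable A(1)] by simp
  have m: "sgn \<in> measurable (uniform_measure lborel (ball 0 1 :: (real^'n) set)) borel"
    by (rule measurable_cong_sets[THEN equalityD1, THEN subsetD, OF _ _ sgn_borel_measurable]) simp_all
  have "emeasure sphere_measure A =
      emeasure (distr (uniform_measure lborel (ball 0 1)) borel sgn) A"
    unfolding sphere_measure_def using A by (subst emeasure_restrict_space) auto
  also have "\<dots> = emeasure (uniform_measure lborel (ball 0 1)) (sgn -` A)"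
    using A by (subst emeasure_distr[OF m]) auto
  also have "\<dots> = emeasure lborel (ball 0 1 \<inter> sgn -` A) / emeasure lborel (ball 0 1 :: (real^'n) set)"
    by (subst emeasure_uniform_measure) auto
  finally show ?thesis .
qed

lemma emeasure_sphere_measure_space:
  "emeasure (sphere_measure :: (real^'n::finite) measure) (sphere 0 1) = 1"
proof -
  let ?B = "ball 0 1 :: (real^'n) set"
  have s: "(sphere 0 1 :: (real^'n) set) \<in> sets sphere_measure"
    using sets.top[of "sphere_measure :: (real^'n) measure"] by (simp only: space_sphere_measure)
  have eq: "?B \<inter> sgn -` sphere 0 1 = ?B - {0}"
    by (auto simp: norm_sgn split: if_splits)
  have diff: "emeasure lborel (?B - {0}) = emeasure lborel ?B"
    by (rule emeasure_Diff_null_set) auto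
  have pos: "emeasure lborel ?B \<noteq> 0"
  proof
    assume "emeasure lborel ?B = 0"
    then have "?B \<in> null_sets lborel"
      by (simp add: null_sets_def)
    then have "negligible ?B"
      by (simp add: negligible_iff_null_sets null_sets_completionI)
    then show False
      using open_not_negligible[of ?B] by simp
  qed
  have fin: "emeasure lborel ?B < Orderings.top"
    using emeasure_bounded_finite[OF bounded_ball] by simp
  show ?thesis
    unfolding emeasure_sphere_measure[OF s] eq diff
    by (rule ennreal_divide_self[OF pos fin])
qed

lemma emeasure_le_orthogonal_image:
  fixes T :: "'a::euclidean_space \<Rightarrow> 'a"
  assumes T: "orthogonal_transformation T" and U: "open U"
  shows "emeasure lborel U \<le> emeasure lborel (T ` U)"
proof -
  define K where "K = {(x, r). 0 < r \<and> cball x r \<subseteq> U}"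
  have fine: "\<exists>i. i \<in> K \<and> x \<in> cball (fst i) (snd i) \<and> snd i < e" if "x \<in> U" "0 < e" for x e
  proof -
    obtain r where r: "r > 0" "cball x r \<subseteq> U"
      using U \<open>x \<in> U\<close> unfolding open_contains_cball by auto
    have "(x, min r (e / 2)) \<in> K" "x \<in> cball x (min r (e / 2))" "min r (e / 2) < e"
      using r that by (auto simp: K_def)
    then show ?thesis
      by (intro exI[of _ "(x, min r (e / 2))"]) simp
  qed
  have pos: "0 < snd i" if "i \<in> K" for i
    using that by (auto simp: K_def)
  obtain C where C: "countable C" "C \<subseteq> K"
    and disj: "pairwise (\<lambda>i j. disjnt (cball (fst i) (snd i)) (cball (fst j) (snd j))) C"
    and neg: "negligible (U - (\<Union>i\<in>C. cball (fst i) (snd i)))"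
    by (rule Vitali_covering_theorem_cballs[of K snd U fst, OF pos fine])
  have df: "disjoint_family_on (\<lambda>i. cball (fst i) (snd i)) C"
    using disj by (auto simp: disjoint_family_on_def pairwise_def disjnt_def)
  have injT: "inj T"
    using T by (rule orthogonal_transformation_inj)
  have Tball: "T ` cball (fst i) (snd i) = cball (T (fst i)) (snd i)" for i
    using T by (rule image_orthogonal_transformation_cball)
  have df': "disjoint_family_on (\<lambda>i. cball (T (fst i)) (snd i)) C"
    using df by (simp add: disjoint_family_on_def Tball[symmetric] image_Int[OF injT, symmetric])
  have TU: "open (T ` U)"
    by (rule open_surjective_linear_image[OF U orthogonal_transformation_linear[OF T]
        orthogonal_transformation_surj[OF T]])
  have Cb: "(\<Union>i\<in>C. cball (fst i) (snd i)) \<in> sets borel"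
    using C(1) by (intro sets.countable_UN') auto
  have null: "U - (\<Union>i\<in>C. cball (fst i) (snd i)) \<in> null_sets lborel"
    using neg null_sets_completion_iff[of "U - (\<Union>i\<in>C. cball (fst i) (snd i))" lborel]
      sets.Diff[OF borel_open[OF U] Cb]
    by (simp add: negligible_iff_null_sets)
  have "emeasure lborel U \<le> emeasure lborel
      ((\<Union>i\<in>C. cball (fst i) (snd i)) \<union> (U - (\<Union>i\<in>C. cball (fst i) (snd i))))"
    using U Cb by (intro emeasure_mono) auto
  also have "\<dots> = emeasure lborel (\<Union>i\<in>C. cball (fst i) (snd i))"
    using null Cb by (intro emeasure_Un_null_set) auto
  also have "\<dots> = (\<integral>\<^sup>+i. emeasure lborel (cball (fst i) (snd i)) \<partial>count_space C)"
    using C df by (intro emeasure_UN_countable) auto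
  also have "\<dots> = (\<integral>\<^sup>+i. emeasure lborel (cball (T (fst i)) (snd i)) \<partial>count_space C)"
    using C by (intro nn_integral_cong) (auto simp: emeasure_cball K_def)
  also have "\<dots> = emeasure lborel (\<Union>i\<in>C. cball (T (fst i)) (snd i))"
    using C df' by (intro emeasure_UN_countable[symmetric]) auto
  also have "\<dots> \<le> emeasure lborel (T ` U)"
  proof (rule emeasure_mono)
    have "cball (fst i) (snd i) \<subseteq> U" if "i \<in> C" for i
      using subsetD[OF C(2) that] unfolding K_def by (simp only: mem_Collect_eq case_prod_beta)
    then show "(\<Union>i\<in>C. cball (T (fst i)) (snd i)) \<subseteq> T ` U"
      unfolding Tball[symmetric] by blast
    show "T ` U \<in> sets lborel"
      using TU by simp
  qed
  finally show ?thesis .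
qed

lemma distr_lborel_orthogonal:
  fixes T :: "'a::euclidean_space \<Rightarrow> 'a"
  assumes T: "orthogonal_transformation T"
  shows "distr lborel borel T = lborel"
proof (rule lborel_eqI[symmetric])
  fix l u :: 'a assume lu: "\<And>b. b \<in> Basis \<Longrightarrow> l \<bullet> b \<le> u \<bullet> b"
  have contT: "continuous_on UNIV T"
    using T by (simp add: linear_continuous_on linear_conv_bounded_linear[symmetric]
        orthogonal_transformation_linear)
  then have m: "T \<in> measurable lborel borel"
    by (simp add: borel_measurable_continuous_onI)
  have op: "open (T -` box l u)"
    by (rule open_vimage[OF open_box contT])
  have surj: "T ` (T -` box l u) = box l u"
    using orthogonal_transformation_surj[OF T] by (simp add: surj_image_vimage_eq)
  have inv: "Hilbert_Choice.inv T ` box l u = T -` box l u"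
    using orthogonal_transformation_bij[OF T] by (simp add: bij_vimage_eq_inv_image)
  have "emeasure lborel (T -` box l u) = emeasure lborel (box l u)"
    using emeasure_le_orthogonal_image[OF T op]
      emeasure_le_orthogonal_image[OF orthogonal_transformation_inv[OF T] open_box, of l u]
    unfolding surj inv by (rule antisym)
  then show "emeasure (distr lborel borel T) (box l u) = ennreal (\<Prod>b\<in>Basis. (u - l) \<bullet> b)"
    using lu by (simp add: emeasure_distr[OF m] emeasure_lborel_box)
qed simp

lemma sphere_measure_rotation_invariant:
  fixes T :: "real^'n::finite \<Rightarrow> real^'n"
  assumes T: "orthogonal_transformation T"
  shows "distr sphere_measure sphere_measure T = sphere_measure"
proof (rule measure_eqI)
  have lin: "linear T" and nT: "norm (T x) = norm x" for x
    using T by (auto simp: orthogonal_transformation)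
  have contT: "T \<in> borel_measurable borel"
    using lin by (intro borel_measurable_continuous_onI linear_continuous_on)
      (simp add: linear_conv_bounded_linear)
  have mT: "T \<in> measurable sphere_measure sphere_measure"
    unfolding measurable_cong_sets[OF sets_sphere_measure sets_sphere_measure]
    using contT nT by (intro measurable_restrict_space3) auto
  show "sets (distr sphere_measure sphere_measure T) = sets sphere_measure" by simp
  fix A assume "A \<in> sets (distr sphere_measure sphere_measure T)"
  then have A: "A \<in> sets sphere_measure" by simp
  then have bA: "A \<in> sets borel" and subA: "A \<subseteq> sphere 0 1"
    by (auto simp: sets_sphere_measure sets_restrict_space)
  have pre: "T -` A \<inter> sphere 0 1 \<in> sets sphere_measure"
    using measurable_sets[OF mT A] by (simp add: space_sphere_measure)
  have sgnT: "sgn (T x) = T (sgn x)" for x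
    by (simp add: sgn_div_norm nT linear_scale[OF lin])
  define S where "S = ball 0 1 \<inter> sgn -` A"
  have Sb: "S \<in> sets borel"
    unfolding S_def using measurable_sets[OF sgn_borel_measurable bA] by simp
  have eq: "ball 0 1 \<inter> sgn -` (T -` A \<inter> sphere 0 1) = T -` S"
    using subA unfolding S_def by (auto simp: sgnT nT)
  have "emeasure lborel (T -` S) = emeasure (distr lborel borel T) S"
    using contT Sb by (simp add: emeasure_distr)
  also have "\<dots> = emeasure lborel S"
    by (simp add: distr_lborel_orthogonal[OF T])
  finally have "emeasure lborel (T -` S) = emeasure lborel S" .
  then show "emeasure (distr sphere_measure sphere_measure T) A = emeasure sphere_measure A"
    unfolding emeasure_distr[OF mT A] space_sphere_measure emeasure_sphere_measure[OF pre]
      emeasure_sphere_measure[OF A] eq S_def[symmetric] by simp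
qed

end

theory Submission
  imports Defs
begin

text \<open>
  Let \<open>X\<close> be a finite sum of the spaces \<open>\<H>\<^sub>j\<close>, \<open>j \<in> J\<close>, with orthonormal basis \<open>B\<close>. Its
  reproducing kernel \<open>\<Sum>\<^sub>b b(x) b(t)\<^sup>*\<close> is rotation invariant, and a harmonic homogeneous polynomial
  that is invariant under the stabilizer of a point is a multiple of a Legendre polynomial, so the
  kernel is \<open>\<kappa>(\<langle>x, t\<rangle>)\<close> with \<open>\<kappa> = \<Sum>\<^sub>j N\<^sub>j L\<^sub>j\<close>. The projection constant is the common \<open>L\<^sup>1\<close> norm
  of its sections.

  Upper bound: the orthogonal projection, which has this kernel, extends to every Banach space
  that contains \<open>X\<close> by a single application of the Hahn-Banach theorem.

  Lower bound: let \<open>Q\<close> be a projection of \<open>C(S)\<close> onto \<open>X\<close> and \<open>h\<close> a polynomial with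
  \<open>\<bar>h\<bar> \<le> 1\<close> on \<open>[-1, 1]\<close>. Expanding \<open>h\<close> in Legendre polynomials shows that the average over \<open>x\<close>
  of \<open>Q (h \<langle>x, \<cdot>\<rangle>) (x)\<close> is \<open>\<integral> h(\<eta>\<^sub>1) \<kappa>(\<eta>\<^sub>1) d\<sigma>\<close>, whatever \<open>Q\<close> is. Hence this integral is at most
  the norm of \<open>Q\<close>, and \<open>h\<close> may approximate the sign of \<open>\<kappa>\<close>.
\<close>

section \<open>The Hahn-Banach theorem\<close>

text \<open>All symmetry is exploited through single reflections: one reflection interchanges two
  given vectors of equal length, which gives transitivity on the sphere and the passage from an
  arbitrary point to a coordinate axis. The dimension \<open>N_dim\<close> enters as a trace, namely
  as the integral of the kernel over the diagonal. The decomposition of polynomials into harmonics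
  is read off from the Legendre expansion of \<open>t^d\<close>, applied to powers of linear forms,
  which span the homogeneous polynomials. Banach spaces are records with a carrier, so Hahn-Banach
  is developed for modules over \<open>complex_ring\<close> with explicit carrier. The test space of
  the lower bound has to live in the universe \<open>'u\<close>; this is possible because a
  continuous function on the sphere can be coded by a real number, and \<open>'u\<close> receives an
  injection of the reals. The sign of the kernel is in general not a polynomial, hence the limit
  argument at the end.\<close>

definition sublinear_on :: "(complex, 'w, 'm) module_scheme \<Rightarrow> ('w \<Rightarrow> real) \<Rightarrow> bool" where
  "sublinear_on W p \<longleftrightarrow>
     (\<forall>x\<in>carrier W. \<forall>y\<in>carrier W. p (x \<oplus>\<^bsub>W\<^esub> y) \<le> p x + p y) \<and>
     (\<forall>x\<in>carrier W. \<forall>t\<ge>0. p (of_real t \<odot>\<^bsub>W\<^esub> x) = t * p x)"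

locale complex_module = Module.module complex_ring W for W :: "(complex, 'w, 'm) module_scheme" (structure)
begin

lemma scal_closed [simp]: "x \<in> carrier W \<Longrightarrow> c \<odot> x \<in> carrier W"
  using smult_closed[of c x] by (simp add: complex_ring_def)

lemma scal_add_left: "x \<in> carrier W \<Longrightarrow> (a + b) \<odot> x = a \<odot> x \<oplus> b \<odot> x"
  using smult_l_distr[of a b x] by (simp add: complex_ring_def)

lemma scal_add_right:
  "x \<in> carrier W \<Longrightarrow> y \<in> carrier W \<Longrightarrow> a \<odot> (x \<oplus> y) = a \<odot> x \<oplus> a \<odot> y"
  using smult_r_distr[of a x y] by (simp add: complex_ring_def)

lemma scal_scal: "x \<in> carrier W \<Longrightarrow> a \<odot> (b \<odot> x) = (a * b) \<odot> x"
  using smult_assoc1[of a b x] by (simp add: complex_ring_def)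

lemma scal_one [simp]: "x \<in> carrier W \<Longrightarrow> 1 \<odot> x = x"
  using smult_one[of x] by (simp add: complex_ring_def)

lemma scal_zero_left [simp]: "x \<in> carrier W \<Longrightarrow> 0 \<odot> x = \<zero>"
  using smult_l_null[of x] by (simp add: complex_ring_def)

lemma scal_zero_right [simp]: "c \<odot> \<zero> = \<zero>"
  using smult_r_null[of c] by (simp add: complex_ring_def)

lemma scal_minus_one: "x \<in> carrier W \<Longrightarrow> (-1) \<odot> x = \<ominus> x"
  using scal_add_left[of x "-1" 1] by (simp add: minus_equality)

lemma sublinear_add:
  "sublinear_on W p \<Longrightarrow> x \<in> carrier W \<Longrightarrow> y \<in> carrier W \<Longrightarrow> p (x \<oplus> y) \<le> p x + p y"
  by (auto simp: sublinear_on_def)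

lemma sublinear_scal:
  "sublinear_on W p \<Longrightarrow> x \<in> carrier W \<Longrightarrow> t \<ge> 0 \<Longrightarrow> p (of_real t \<odot> x) = t * p x"
  by (auto simp: sublinear_on_def)

lemma sublinear_zero: "sublinear_on W p \<Longrightarrow> p \<zero> = 0"
  using sublinear_scal[of p \<zero> 0] by simp

lemma sublinear_minus: "sublinear_on W p \<Longrightarrow> x \<in> carrier W \<Longrightarrow> - p (\<ominus> x) \<le> p x"
  using sublinear_add[of p x "\<ominus> x"] sublinear_zero[of p] by (simp add: r_neg)

text \<open>Homogeneity follows from the inequality alone, since the inequality for
  \<open>1 / t\<close> at the point \<open>t x\<close> is the reverse one for \<open>t\<close> at
  \<open>x\<close>.\<close>

lemma sublinear_onI:
  assumes add: "\<And>x y. x \<in> carrier W \<Longrightarrow> y \<in> carrier W \<Longrightarrow> p (x \<oplus> y) \<le> p x + p y"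
    and scal: "\<And>x t. x \<in> carrier W \<Longrightarrow> t > 0 \<Longrightarrow> p (of_real t \<odot> x) \<le> t * p x"
    and zero: "p \<zero> = 0"
  shows "sublinear_on W p"
  unfolding sublinear_on_def
proof (intro conjI ballI allI impI)
  fix x t assume x: "x \<in> carrier W" and "(t::real) \<ge> 0"
  show "p (of_real t \<odot> x) = t * p x"
  proof (cases "t = 0")
    case True
    then show ?thesis using x zero by simp
  next
    case False
    then have t: "t > 0" using \<open>t \<ge> 0\<close> by simp
    have "p x = p (of_real (1 / t) \<odot> (of_real t \<odot> x))"
      using x t by (simp add: scal_scal)
    also have "\<dots> \<le> (1 / t) * p (of_real t \<odot> x)"
      using x t by (intro scal) auto
    finally have "t * p x \<le> p (of_real t \<odot> x)"
      using t by (simp add: field_simps)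
    with scal[OF x t] show ?thesis by simp
  qed
qed (use add in auto)

text \<open>\<open>q\<close> is an inf-convolution of \<open>p\<close> with \<open>f\<close> along
  the cone. It lowers the majorant so that any linear functional below it is at least
  \<open>f\<close> on \<open>C\<close>. It serves twice: with a subspace, to encode the functional
  to be extended, and with a ray, to show that a minimal sublinear function is additive.\<close>

lemma sublinear_cone_inf:
  assumes p: "sublinear_on W p" and C: "C \<subseteq> carrier W" "\<zero> \<in> C"
    and Cadd: "\<And>x y. x \<in> C \<Longrightarrow> y \<in> C \<Longrightarrow> x \<oplus> y \<in> C"
    and Cscal: "\<And>x t. x \<in> C \<Longrightarrow> t \<ge> 0 \<Longrightarrow> of_real t \<odot> x \<in> C"
    and fadd: "\<And>x y. x \<in> C \<Longrightarrow> y \<in> C \<Longrightarrow> f (x \<oplus> y) = f x + f y"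
    and fscal: "\<And>x t. x \<in> C \<Longrightarrow> t \<ge> 0 \<Longrightarrow> f (of_real t \<odot> x) = t * f x"
    and fp: "\<And>x. x \<in> C \<Longrightarrow> f x \<le> p x"
  defines "q \<equiv> \<lambda>x. INF m\<in>C. p (x \<oplus> m) - f m"
  shows "sublinear_on W q"
    and "\<And>x m. x \<in> carrier W \<Longrightarrow> m \<in> C \<Longrightarrow> q x \<le> p (x \<oplus> m) - f m"
    and "\<And>x. x \<in> carrier W \<Longrightarrow> q x \<le> p x"
    and "\<And>m. m \<in> C \<Longrightarrow> q (\<ominus> m) \<le> - f m"
proof -
  have Cc: "x \<in> carrier W" if "x \<in> C" for x using that C by auto
  have f0: "f \<zero> = 0" using fscal[of \<zero> 0] C by simp
  \<comment> \<open>Keeps the infimum that defines \<open>q\<close> finite: write \<open>m\<close>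
    as \<open>-x + (x + m)\<close> and use \<open>f \<le> p\<close> on the cone.\<close>
  have bound: "- p (\<ominus> x) \<le> p (x \<oplus> m) - f m" if "x \<in> carrier W" "m \<in> C" for x m
  proof -
    have "m = \<ominus> x \<oplus> (x \<oplus> m)"
      using that by (simp add: Cc r_neg1)
    then have "p m \<le> p (\<ominus> x) + p (x \<oplus> m)"
      using that Cc[OF that(2)] sublinear_add[OF p, of "\<ominus> x" "x \<oplus> m"] by simp
    then show ?thesis using fp[OF that(2)] by simp
  qed
  show le: "q x \<le> p (x \<oplus> m) - f m" if "x \<in> carrier W" "m \<in> C" for x m
    unfolding q_def
    by (rule cINF_lower[OF bdd_belowI2[of C "- p (\<ominus> x)"] that(2)]) (use bound that in auto)
  have ge: "r \<le> q x" if "\<And>m. m \<in> C \<Longrightarrow> r \<le> p (x \<oplus> m) - f m" for r x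
    unfolding q_def by (rule cINF_greatest) (use C that in auto)
  show "q x \<le> p x" if "x \<in> carrier W" for x
    using le[OF that C(2)] that f0 by simp
  show "q (\<ominus> m) \<le> - f m" if "m \<in> C" for m
    using le[of "\<ominus> m" m] that Cc[OF that] sublinear_zero[OF p] by (simp add: l_neg)
  show "sublinear_on W q"
  proof (rule sublinear_onI)
    fix x y assume x: "x \<in> carrier W" and y: "y \<in> carrier W"
    have "q (x \<oplus> y) \<le> (p (x \<oplus> m) - f m) + (p (y \<oplus> n) - f n)" if "m \<in> C" "n \<in> C" for m n
    proof -
      have eq: "(x \<oplus> y) \<oplus> (m \<oplus> n) = (x \<oplus> m) \<oplus> (y \<oplus> n)"
        using x y Cc[OF that(1)] Cc[OF that(2)] by (simp add: a_ac)
      show ?thesis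
        using le[of "x \<oplus> y" "m \<oplus> n"] Cadd[OF that] fadd[OF that] x y Cc[OF that(1)] Cc[OF that(2)]
          sublinear_add[OF p, of "x \<oplus> m" "y \<oplus> n"]
        unfolding eq by simp
    qed
    then have "q (x \<oplus> y) - (p (y \<oplus> n) - f n) \<le> q x" if "n \<in> C" for n
      using that by (intro ge) (auto simp: algebra_simps)
    then have "q (x \<oplus> y) - q x \<le> q y"
      by (intro ge) (auto simp: algebra_simps)
    then show "q (x \<oplus> y) \<le> q x + q y" by simp
  next
    fix x and t :: real assume x: "x \<in> carrier W" and t: "t > 0"
    have "q (of_real t \<odot> x) / t \<le> q x"
    proof (rule ge)
      fix m assume m: "m \<in> C"
      have "q (of_real t \<odot> x)
          \<le> p (of_real t \<odot> x \<oplus> of_real t \<odot> m) - f (of_real t \<odot> m)"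
        using x m t by (intro le Cscal) auto
      also have "\<dots> = t * (p (x \<oplus> m) - f m)"
        using x Cc[OF m] t m
        by (simp add: scal_add_right[symmetric] sublinear_scal[OF p] fscal algebra_simps)
      finally show "q (of_real t \<odot> x) / t \<le> p (x \<oplus> m) - f m"
        using t by (simp add: field_simps)
    qed
    then show "q (of_real t \<odot> x) \<le> t * q x"
      using t by (simp add: field_simps)
  next
    show "q \<zero> = 0"
    proof (rule antisym)
      show "q \<zero> \<le> 0"
        using le[of \<zero> \<zero>] C f0 sublinear_zero[OF p] by simp
      show "0 \<le> q \<zero>"
        by (rule ge) (use Cc fp in auto)
    qed
  qed
qed

text \<open>On the ray through \<open>v\<close> the function \<open>q\<close> is itself additive, so
  it can be lowered along this ray by the inf-convolution with \<open>f = q\<close>. Minimality says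
  that nothing is gained, and the term \<open>m = v\<close> of the infimum then is the inequality
  \<open>q x + q v \<le> q (x + v)\<close>.\<close>

lemma minimal_sublinear_additive:
  assumes q: "sublinear_on W q"
    and min: "\<And>r. sublinear_on W r \<Longrightarrow> (\<And>x. x \<in> carrier W \<Longrightarrow> r x \<le> q x) \<Longrightarrow>
      (\<And>x. x \<in> carrier W \<Longrightarrow> r x = q x)"
    and x: "x \<in> carrier W" and v: "v \<in> carrier W"
  shows "q (x \<oplus> v) = q x + q v"
proof -
  define C where "C = {of_real t \<odot> v | t. t \<ge> 0}"
  let ?r = "\<lambda>x. INF m\<in>C. q (x \<oplus> m) - q m"
  have C: "C \<subseteq> carrier W" "\<zero> \<in> C" "v \<in> C"
    using v scal_zero_left[OF v] scal_one[OF v] unfolding C_def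
    by (auto intro: exI[of _ "0::real"] exI[of _ "1::real"])
  have Cadd: "x \<oplus> y \<in> C \<and> q (x \<oplus> y) = q x + q y" if xy: "x \<in> C" "y \<in> C" for x y
  proof -
    obtain s t where st: "x = of_real s \<odot> v" "y = of_real t \<odot> v" "s \<ge> 0" "t \<ge> 0"
      using xy unfolding C_def by auto
    then have "x \<oplus> y = of_real (s + t) \<odot> v"
      using v by (simp add: scal_add_left)
    moreover have "q (of_real (s + t) \<odot> v) = q x + q y"
      using st sublinear_scal[OF q v, of "s + t"]
      by (simp only: sublinear_scal[OF q v]) (simp add: algebra_simps)
    ultimately show ?thesis
      using st unfolding C_def by (auto intro!: exI[of _ "s + t"])
  qed
  have Cscal: "of_real t \<odot> x \<in> C" if x: "x \<in> C" and t: "t \<ge> 0" for x t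
  proof -
    obtain s where "x = of_real s \<odot> v" "s \<ge> 0"
      using x unfolding C_def by auto
    then show ?thesis
      using t v unfolding C_def by (auto simp: scal_scal intro!: exI[of _ "t * s"])
  qed
  have Cc: "x \<in> carrier W" if "x \<in> C" for x using that C by auto
  note r = sublinear_cone_inf[OF q C(1,2) conjunct1[OF Cadd] Cscal conjunct2[OF Cadd]
      sublinear_scal[OF q Cc] order_refl, simplified]
  have "?r x = q x"
    by (rule min[OF r(1) r(3) x])
  moreover have "?r x \<le> q (x \<oplus> v) - q v"
    by (rule r(2)[OF x C(3)])
  ultimately show ?thesis
    using sublinear_add[OF q x v] by simp
qed

text \<open>Subadditivity involves two members of the chain, one for each summand; comparability
  lets the smaller one serve for both. The values \<open>- p (- x)\<close> bound the infimum from
  below.\<close>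

lemma sublinear_chain_inf:
  assumes C: "C \<noteq> {}" "\<And>q. q \<in> C \<Longrightarrow> sublinear_on W q"
    and bdd: "\<And>q x. q \<in> C \<Longrightarrow> x \<in> carrier W \<Longrightarrow> q x \<le> p x"
    and chain: "\<And>q r. q \<in> C \<Longrightarrow> r \<in> C \<Longrightarrow>
      (\<forall>x\<in>carrier W. q x \<le> r x) \<or> (\<forall>x\<in>carrier W. r x \<le> q x)"
  defines "u \<equiv> \<lambda>x. INF q\<in>C. q x"
  shows "sublinear_on W u" and "\<And>q x. q \<in> C \<Longrightarrow> x \<in> carrier W \<Longrightarrow> u x \<le> q x"
proof -
  have low: "- p (\<ominus> x) \<le> q x" if "q \<in> C" "x \<in> carrier W" for q x
    using sublinear_minus[OF C(2)[OF that(1)] that(2)] bdd[OF that(1), of "\<ominus> x"] that by simp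
  show le: "u x \<le> q x" if "q \<in> C" "x \<in> carrier W" for q x
    unfolding u_def
    by (rule cINF_lower[OF bdd_belowI2[of C "- p (\<ominus> x)"] that(1)]) (use low that in auto)
  have ge: "r \<le> u x" if "\<And>q. q \<in> C \<Longrightarrow> r \<le> q x" for r x
    unfolding u_def by (rule cINF_greatest) (use C that in auto)
  show "sublinear_on W u"
  proof (rule sublinear_onI)
    fix x y assume x: "x \<in> carrier W" and y: "y \<in> carrier W"
    have "u (x \<oplus> y) \<le> q x + r y" if "q \<in> C" "r \<in> C" for q r
      using chain[OF that]
    proof
      assume "\<forall>x\<in>carrier W. q x \<le> r x"
      then show ?thesis
        using le[OF that(1), of "x \<oplus> y"] sublinear_add[OF C(2)[OF that(1)] x y] x y by fastforce
    next
      assume "\<forall>x\<in>carrier W. r x \<le> q x"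
      then show ?thesis
        using le[OF that(2), of "x \<oplus> y"] sublinear_add[OF C(2)[OF that(2)] x y] x y by fastforce
    qed
    then have "u (x \<oplus> y) - r y \<le> u x" if "r \<in> C" for r
      using that by (intro ge) (auto simp: algebra_simps)
    then have "u (x \<oplus> y) - u x \<le> u y"
      by (intro ge) (auto simp: algebra_simps)
    then show "u (x \<oplus> y) \<le> u x + u y" by simp
  next
    fix x and t :: real assume x: "x \<in> carrier W" and t: "t > 0"
    have "u (of_real t \<odot> x) / t \<le> u x"
    proof (rule ge)
      fix q assume q: "q \<in> C"
      show "u (of_real t \<odot> x) / t \<le> q x"
        using le[OF q, of "of_real t \<odot> x"] sublinear_scal[OF C(2)[OF q] x, of t] x t
        by (simp add: field_simps)
    qed
    then show "u (of_real t \<odot> x) \<le> t * u x"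
      using t by (simp add: field_simps)
  next
    obtain q where "q \<in> C" using C by auto
    with le[of q \<zero>] ge[of 0 \<zero>] sublinear_zero[OF C(2)] show "u \<zero> = 0"
      by force
  qed
qed

lemma exists_minimal_sublinear:
  assumes p: "sublinear_on W p"
  shows "\<exists>q. sublinear_on W q \<and> (\<forall>x\<in>carrier W. q x \<le> p x) \<and>
    (\<forall>r. sublinear_on W r \<longrightarrow> (\<forall>x\<in>carrier W. r x \<le> q x) \<longrightarrow> (\<forall>x\<in>carrier W. r x = q x))"
proof -
  have restr: "sublinear_on W (restrict r (carrier W)) \<longleftrightarrow> sublinear_on W r" for r
    by (simp add: sublinear_on_def)
  \<comment> \<open>Zorn's lemma needs antisymmetry, while sublinearity only sees the carrier; the
    functions are therefore normalized to be \<open>extensional\<close>.\<close>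
  define A where "A = {q \<in> extensional (carrier W). sublinear_on W q \<and> (\<forall>x\<in>carrier W. q x \<le> p x)}"
  \<comment> \<open>The order is reversed, so that a maximal element is a minimal sublinear
    function.\<close>
  define P where "P = (\<lambda>(q::'w \<Rightarrow> real) r. \<forall>x\<in>carrier W. r x \<le> q x)"
  have po: "partial_order_on A (relation_of P A)"
  proof (rule partial_order_on_relation_ofI)
    show "\<And>q. q \<in> A \<Longrightarrow> P q q" by (auto simp: P_def)
    show "\<And>q r s. q \<in> A \<Longrightarrow> r \<in> A \<Longrightarrow> s \<in> A \<Longrightarrow> P q r \<Longrightarrow> P r s \<Longrightarrow> P q s"
      by (force simp: P_def intro: order_trans)
    show "\<And>q r. q \<in> A \<Longrightarrow> r \<in> A \<Longrightarrow> P q r \<Longrightarrow> P r q \<Longrightarrow> q = r"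
      by (rule extensionalityI[of _ "carrier W"]) (auto simp: P_def A_def intro: antisym)
  qed
  have "\<exists>m\<in>A. \<forall>a\<in>A. P m a \<longrightarrow> a = m"
  proof (rule predicate_Zorn[OF po])
    fix C assume "C \<in> Chains (relation_of P A)"
    then have CA: "C \<subseteq> A" and chain: "\<And>q r. q \<in> C \<Longrightarrow> r \<in> C \<Longrightarrow> P q r \<or> P r q"
      by (auto simp: Chains_def relation_of_def)
    show "\<exists>u\<in>A. \<forall>a\<in>C. P a u"
    proof (cases "C = {}")
      case True
      have "restrict p (carrier W) \<in> A"
        unfolding A_def using p by (simp add: restr)
      with True show ?thesis by auto
    next
      case False
      have CA': "sublinear_on W q" "x \<in> carrier W \<Longrightarrow> q x \<le> p x" if "q \<in> C" for q x
        using CA that unfolding A_def by auto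
      let ?u = "\<lambda>x. INF q\<in>C. q x"
      have u: "sublinear_on W ?u" "\<And>q x. q \<in> C \<Longrightarrow> x \<in> carrier W \<Longrightarrow> ?u x \<le> q x"
        using sublinear_chain_inf[of C p] chain False CA' unfolding P_def by blast+
      obtain q where q: "q \<in> C" using False by auto
      have "restrict ?u (carrier W) \<in> A"
        unfolding A_def using u(1) order_trans[OF u(2)[OF q] CA'(2)[OF q]]
        by (simp add: restr)
      then show ?thesis
        using u(2) by (intro bexI[of _ "restrict ?u (carrier W)"]) (auto simp: P_def)
    qed
  qed
  then obtain q where q: "q \<in> A" and min: "\<And>r. r \<in> A \<Longrightarrow> P q r \<Longrightarrow> r = q" by blast
  have "r x = q x" if r: "sublinear_on W r" "\<forall>x\<in>carrier W. r x \<le> q x" and x: "x \<in> carrier W" for r x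
  proof -
    have "restrict r (carrier W) \<in> A"
      using r q order_trans unfolding A_def by (fastforce simp: restr)
    then have "restrict r (carrier W) = q"
      by (rule min) (use r in \<open>auto simp: P_def\<close>)
    then show ?thesis using x by (metis restrict_apply')
  qed
  then show ?thesis
    using q unfolding A_def by blast
qed

text \<open>A minimal sublinear function below the inf-convolution of \<open>p\<close> with
  \<open>f\<close> is linear and at least \<open>f\<close> on \<open>M\<close>. As \<open>M\<close>
  is closed under negation, it equals \<open>f\<close> there.\<close>

theorem hahn_banach_real:
  assumes p: "sublinear_on W p" and M: "M \<subseteq> carrier W" "\<zero> \<in> M"
    and Madd: "\<And>x y. x \<in> M \<Longrightarrow> y \<in> M \<Longrightarrow> x \<oplus> y \<in> M"
    and Mscal: "\<And>x t. x \<in> M \<Longrightarrow> of_real t \<odot> x \<in> M"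
    and fadd: "\<And>x y. x \<in> M \<Longrightarrow> y \<in> M \<Longrightarrow> f (x \<oplus> y) = f x + f y"
    and fscal: "\<And>x t. x \<in> M \<Longrightarrow> f (of_real t \<odot> x) = t * f x"
    and fp: "\<And>x. x \<in> M \<Longrightarrow> f x \<le> p x"
  obtains g where "\<And>x y. x \<in> carrier W \<Longrightarrow> y \<in> carrier W \<Longrightarrow> g (x \<oplus> y) = g x + g y"
    and "\<And>x t. x \<in> carrier W \<Longrightarrow> g (of_real t \<odot> x) = t * g x"
    and "\<And>x. x \<in> carrier W \<Longrightarrow> g x \<le> p x" and "\<And>x. x \<in> M \<Longrightarrow> g x = f x"
proof -
  define p' where "p' = (\<lambda>x. INF m\<in>M. p (x \<oplus> m) - f m)"
  have p': "sublinear_on W p'" "\<And>x. x \<in> carrier W \<Longrightarrow> p' x \<le> p x"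
    "\<And>m. m \<in> M \<Longrightarrow> p' (\<ominus> m) \<le> - f m"
    unfolding p'_def
    using sublinear_cone_inf[OF p M Madd Mscal fadd fscal fp] by simp_all
  obtain q where q: "sublinear_on W q" "\<forall>x\<in>carrier W. q x \<le> p' x"
    and min: "\<forall>r. sublinear_on W r \<longrightarrow> (\<forall>x\<in>carrier W. r x \<le> q x) \<longrightarrow> (\<forall>x\<in>carrier W. r x = q x)"
    using exists_minimal_sublinear[OF p'(1)] by blast
  have add: "q (x \<oplus> y) = q x + q y" if "x \<in> carrier W" "y \<in> carrier W" for x y
    by (rule minimal_sublinear_additive[OF q(1) _ that]) (use min in blast)
  have neg: "q (\<ominus> x) = - q x" if "x \<in> carrier W" for x
    using add[of x "\<ominus> x"] that sublinear_zero[OF q(1)] by (simp add: r_neg)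
  have scal: "q (of_real t \<odot> x) = t * q x" if x: "x \<in> carrier W" for x t
  proof (cases "t \<ge> 0")
    case True
    then show ?thesis using sublinear_scal[OF q(1) x] by simp
  next
    case False
    have "of_real t \<odot> x = \<ominus> (of_real (- t) \<odot> x)"
      using x by (subst scal_minus_one[symmetric]) (auto simp: scal_scal)
    then show ?thesis
      using x False sublinear_scal[OF q(1) x, of "- t"] neg[of "of_real (- t) \<odot> x"]
      by simp
  qed
  have ge: "f x \<le> q x" if "x \<in> M" for x
    using p'(3)[OF that] q(2) neg[of x] that M(1) by (metis a_inv_closed neg_le_iff_le order_trans subsetD)
  have "q x = f x" if x: "x \<in> M" for x
    using ge[OF x] ge[OF Mscal[OF x, of "-1"]] fscal[OF x, of "-1"] scal[of x "-1"] x M(1) by auto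
  moreover have "q x \<le> p x" if "x \<in> carrier W" for x
    using q(2) p'(2)[OF that] that by force
  ultimately show thesis
    using add scal that by blast
qed

text \<open>A complex functional is determined by its real part through
  \<open>g x = u x - i u (i x)\<close>, where \<open>u\<close> extends \<open>Re f\<close>. The
  bound passes from \<open>u\<close> to \<open>g\<close> after multiplying \<open>x\<close> by a
  unimodular number.\<close>

theorem hahn_banach_complex:
  assumes padd: "\<And>x y. x \<in> carrier W \<Longrightarrow> y \<in> carrier W \<Longrightarrow> p (x \<oplus> y) \<le> p x + p y"
    and pscal: "\<And>x c. x \<in> carrier W \<Longrightarrow> p (c \<odot> x) = cmod c * p x"
    and M: "M \<subseteq> carrier W" "\<zero> \<in> M"
    and Madd: "\<And>x y. x \<in> M \<Longrightarrow> y \<in> M \<Longrightarrow> x \<oplus> y \<in> M"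
    and Mscal: "\<And>x c. x \<in> M \<Longrightarrow> c \<odot> x \<in> M"
    and fadd: "\<And>x y. x \<in> M \<Longrightarrow> y \<in> M \<Longrightarrow> f (x \<oplus> y) = f x + f y"
    and fscal: "\<And>x c. x \<in> M \<Longrightarrow> f (c \<odot> x) = c * f x"
    and fp: "\<And>x. x \<in> M \<Longrightarrow> cmod (f x) \<le> p x"
  obtains g :: "'w \<Rightarrow> complex"
  where "\<And>x y. x \<in> carrier W \<Longrightarrow> y \<in> carrier W \<Longrightarrow> g (x \<oplus> y) = g x + g y"
    and "\<And>x c. x \<in> carrier W \<Longrightarrow> g (c \<odot> x) = c * g x"
    and "\<And>x. x \<in> carrier W \<Longrightarrow> cmod (g x) \<le> p x" and "\<And>x. x \<in> M \<Longrightarrow> g x = f x"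
proof -
  have "sublinear_on W p"
    unfolding sublinear_on_def using padd pscal by simp
  then obtain u where uadd: "\<And>x y. x \<in> carrier W \<Longrightarrow> y \<in> carrier W \<Longrightarrow> u (x \<oplus> y) = u x + u y"
    and uscal: "\<And>x t. x \<in> carrier W \<Longrightarrow> u (of_real t \<odot> x) = t * u x"
    and up: "\<And>x. x \<in> carrier W \<Longrightarrow> u x \<le> p x" and uf: "\<And>x. x \<in> M \<Longrightarrow> u x = Re (f x)"
  proof (rule hahn_banach_real[where f = "\<lambda>x. Re (f x)", OF _ M Madd Mscal])
    show "Re (f x) \<le> p x" if "x \<in> M" for x
      using fp[OF that] complex_Re_le_cmod order_trans by blast
  qed (use fadd fscal in auto)
  define g where "g = (\<lambda>x. Complex (u x) (- u (\<i> \<odot> x)))"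
  have gadd: "g (x \<oplus> y) = g x + g y" if "x \<in> carrier W" "y \<in> carrier W" for x y
    using that by (simp add: g_def uadd scal_add_right complex_eq_iff)
  have gscal: "g (c \<odot> x) = c * g x" if x: "x \<in> carrier W" for x c
  proof -
    have "c \<odot> x = of_real (Re c) \<odot> x \<oplus> of_real (Im c) \<odot> (\<i> \<odot> x)"
      using x by (simp add: scal_scal scal_add_left[symmetric] complex_eq_iff)
        (metis complex_eq mult.commute)
    then have 1: "u (c \<odot> x) = Re c * u x + Im c * u (\<i> \<odot> x)"
      using x by (simp add: uadd uscal)
    have "\<i> \<odot> (c \<odot> x) = of_real (- Im c) \<odot> x \<oplus> of_real (Re c) \<odot> (\<i> \<odot> x)"
    proof -
      have "\<i> * c = of_real (- Im c) + of_real (Re c) * \<i>"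
        by (simp add: complex_eq_iff)
      then show ?thesis
        using x by (simp add: scal_scal scal_add_left[symmetric])
    qed
    then have 2: "u (\<i> \<odot> (c \<odot> x)) = - Im c * u x + Re c * u (\<i> \<odot> x)"
      using x uadd[of "of_real (- Im c) \<odot> x"] uscal[of x "- Im c"] uscal[of "\<i> \<odot> x" "Re c"]
      by simp
    show ?thesis
      unfolding g_def 1 2 by (simp add: complex_eq_iff)
  qed
  have gp: "cmod (g x) \<le> p x" if x: "x \<in> carrier W" for x
  proof -
    \<comment> \<open>\<open>c\<close> rotates \<open>g x\<close> onto its modulus, so that the
      modulus becomes a value of the real part \<open>u\<close>.\<close>
    obtain c where c: "cmod c = 1" "c * g x = of_real (cmod (g x))"
    proof (cases "g x = 0")
      case False
      then have "cmod (cnj (g x) / of_real (cmod (g x))) = 1"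
        by (simp add: norm_divide)
      moreover have "cnj (g x) / of_real (cmod (g x)) * g x = of_real (cmod (g x))"
        using False by (simp add: field_simps complex_norm_square[symmetric] power2_eq_square)
      ultimately show thesis using that by blast
    qed (use that[of 1] in auto)
    have "cmod (g x) = Re (g (c \<odot> x))"
      using c gscal[OF x] by simp
    also have "\<dots> = u (c \<odot> x)" by (simp add: g_def)
    also have "\<dots> \<le> p (c \<odot> x)" using x by (intro up) simp
    also have "\<dots> = p x" using x c by (simp add: pscal)
    finally show ?thesis .
  qed
  have "g x = f x" if x: "x \<in> M" for x
    using uf[OF x] uf[OF Mscal[OF x, of \<i>]] fscal[OF x, of \<i>] by (simp add: g_def complex_eq_iff)
  then show thesis
    using gadd gscal gp that by blast
qed

end

section \<open>Continuous functions on the sphere\<close>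

lemma finite_measure_sphere_measure: "finite_measure (sphere_measure :: (real^'n::finite) measure)"
  by (rule finite_measureI) (simp add: space_sphere_measure emeasure_sphere_measure_space)

lemma integral_sphere_const:
  "(LINT x|(sphere_measure :: (real^'n::finite) measure). c) = (c :: 'b::{banach, second_countable_topology})"
  by (simp add: space_sphere_measure measure_def emeasure_sphere_measure_space)

lemma borel_measurable_sphere_measure:
  fixes f :: "real^'n::finite \<Rightarrow> 'b::topological_space"
  assumes "continuous_on (sphere 0 1) f"
  shows "f \<in> borel_measurable sphere_measure"
  using borel_measurable_continuous_on_restrict[OF assms]
  by (simp add: measurable_cong_sets[OF sets_sphere_measure refl])

lemma integrable_sphere_measure:
  fixes f :: "real^'n::finite \<Rightarrow> 'b::{banach, second_countable_topology}"
  assumes "continuous_on (sphere 0 1) f"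
  shows "integrable sphere_measure f"
proof -
  interpret finite_measure "sphere_measure :: (real^'n) measure"
    by (rule finite_measure_sphere_measure)
  have "bounded (f ` sphere 0 1)"
    by (intro compact_imp_bounded compact_continuous_image assms) simp
  then obtain b where "\<forall>x\<in>sphere 0 1. norm (f x) \<le> b"
    unfolding bounded_iff by blast
  then show ?thesis
    by (intro integrable_const_bound[of _ b] borel_measurable_sphere_measure[OF assms])
      (auto simp: space_sphere_measure)
qed

lemma orthogonal_transformation_sphere:
  "orthogonal_transformation T \<Longrightarrow> x \<in> sphere 0 1 \<Longrightarrow> T x \<in> sphere 0 1"
  for T :: "real^'n::finite \<Rightarrow> real^'n"
  by (simp add: orthogonal_transformation)

lemma continuous_on_orthogonal_transformation:
  "orthogonal_transformation T \<Longrightarrow> continuous_on A T" for T :: "real^'n::finite \<Rightarrow> real^'n"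
  by (simp add: linear_continuous_on linear_conv_bounded_linear[symmetric]
      orthogonal_transformation_linear)

lemma integral_sphere_orthogonal_transformation:
  fixes f :: "real^'n::finite \<Rightarrow> 'b::{banach, second_countable_topology}"
    and T :: "real^'n \<Rightarrow> real^'n"
  assumes T: "orthogonal_transformation T" and f: "continuous_on (sphere 0 1) f"
  shows "(LINT x|sphere_measure. f (T x)) = (LINT x|sphere_measure. f x)"
proof -
  have "T \<in> borel_measurable borel"
    by (intro borel_measurable_continuous_onI continuous_on_orthogonal_transformation[OF T])
  then have "T \<in> measurable sphere_measure sphere_measure"
    unfolding measurable_cong_sets[OF sets_sphere_measure sets_sphere_measure]
    using orthogonal_transformation_sphere[OF T] by (intro measurable_restrict_space3) auto
  from integral_distr[OF this borel_measurable_sphere_measure[OF f]] show ?thesis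
    by (simp add: sphere_measure_rotation_invariant[OF T])
qed

text \<open>The cone over the set inside the punctured ball is open and contains
  \<open>x / 2\<close>, so it has positive Lebesgue measure. Full support of the surface measure
  turns almost everywhere statements about continuous functions into pointwise ones.\<close>

lemma emeasure_sphere_measure_open_pos:
  fixes U :: "(real^'n::finite) set"
  assumes U: "open U" and x: "x \<in> U" "x \<in> sphere 0 1"
  shows "emeasure sphere_measure (U \<inter> sphere 0 1) \<noteq> 0"
proof
  let ?A = "U \<inter> sphere 0 1"
  let ?V = "(ball 0 1 - {0}) \<inter> sgn -` U"
  assume "emeasure sphere_measure ?A = 0"
  moreover have "?A \<in> sets sphere_measure"
    using U by (auto simp: sets_sphere_measure sets_restrict_space)
  moreover have "emeasure lborel (ball 0 1 :: (real^'n) set) < Orderings.top"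
    using emeasure_bounded_finite[OF bounded_ball] by simp
  ultimately have 0: "emeasure lborel (ball 0 1 \<inter> sgn -` ?A) = 0"
    by (auto simp: emeasure_sphere_measure ennreal_divide_eq_0_iff)
  have V: "open ?V"
    by (rule continuous_open_preimage[OF _ _ U]) (auto intro!: continuous_intros)
  have "emeasure lborel ?V \<le> emeasure lborel (ball 0 1 \<inter> sgn -` ?A)"
  proof (rule emeasure_mono)
    show "?V \<subseteq> ball 0 1 \<inter> sgn -` ?A" by (auto simp: norm_sgn)
    have "?A \<in> sets borel" using U by auto
    then show "ball 0 1 \<inter> sgn -` ?A \<in> sets lborel"
      using measurable_sets[OF sgn_borel_measurable, of ?A] by simp
  qed
  then have "?V \<in> null_sets lborel"
    using 0 V by (auto simp: null_sets_def)
  then have "negligible ?V"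
    by (simp add: negligible_iff_null_sets null_sets_completionI)
  moreover have "(1/2) *\<^sub>R x \<in> ?V"
    using x by (auto simp: sgn_div_norm)
  ultimately show False
    using open_not_negligible[OF V] by blast
qed

text \<open>Behind the definiteness of \<open>ip\<close>: the set where \<open>f\<close> is nonzero
  is relatively open and contained in a null set, hence empty.\<close>

lemma integral_sphere_eq_0:
  fixes f :: "real^'n::finite \<Rightarrow> real"
  assumes f: "continuous_on (sphere 0 1) f" and pos: "\<And>x. x \<in> sphere 0 1 \<Longrightarrow> f x \<ge> 0"
    and 0: "(LINT x|sphere_measure. f x) = 0" and x: "x \<in> sphere 0 1"
  shows "f x = 0"
proof (rule ccontr)
  assume nz: "f x \<noteq> 0"
  have "AE y in sphere_measure. 0 \<le> f y"
    using pos by (intro AE_I2) (simp add: space_sphere_measure)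
  then have "AE y in sphere_measure. f y = 0"
    using integral_nonneg_eq_0_iff_AE[OF integrable_sphere_measure[OF f]] 0 by simp
  then obtain N where N: "{y \<in> space sphere_measure. f y \<noteq> 0} \<subseteq> N" "emeasure sphere_measure N = 0"
      "N \<in> sets sphere_measure"
    by (rule AE_E)
  obtain U where U: "open U" "U \<inter> sphere 0 1 = f -` (- {0}) \<inter> sphere 0 1"
    using f[unfolded continuous_on_open_invariant, rule_format, of "- {0}"] by auto
  have "emeasure sphere_measure (U \<inter> sphere 0 1) \<le> emeasure sphere_measure N"
    using N U by (intro emeasure_mono) (auto simp: space_sphere_measure)
  moreover have "x \<in> U"
    using U(2) x nz by blast
  ultimately show False
    using emeasure_sphere_measure_open_pos[OF U(1), of x] x N by auto
qed

text \<open>Extension by zero matches \<open>sphere_restr\<close> and makes equality of functions on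
  the sphere an equality in the function type, so that spans and dimensions can be taken
  there.\<close>

definition csphere :: "(real^'n::finite \<Rightarrow> complex) set" where
  "csphere = {f. continuous_on (sphere 0 1) f \<and> (\<forall>x. x \<notin> sphere 0 1 \<longrightarrow> f x = 0)}"

lemma csphere_continuous: "f \<in> csphere \<Longrightarrow> continuous_on (sphere 0 1) f"
  by (simp add: csphere_def)

lemma csphere_eqI:
  "f \<in> csphere \<Longrightarrow> g \<in> csphere \<Longrightarrow> (\<And>x. x \<in> sphere 0 1 \<Longrightarrow> f x = g x) \<Longrightarrow> f = g"
  unfolding csphere_def by (rule ext) (metis (mono_tags, lifting) mem_Collect_eq)

lemma subspace_csphere: "cfun.subspace csphere"
  by (auto simp: cfun.subspace_def csphere_def intro!: continuous_intros)

lemma sum_fun_apply: "(\<Sum>a\<in>A. F a) x = (\<Sum>a\<in>A. (F a x :: 'b::comm_monoid_add))"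
  by (induction A rule: infinite_finite_induct) auto

section \<open>Inner product and orthonormal systems\<close>

definition ip :: "(real^'n::finite \<Rightarrow> complex) \<Rightarrow> (real^'n \<Rightarrow> complex) \<Rightarrow> complex" where
  "ip f g = (LINT x|sphere_measure. f x * cnj (g x))"

lemma integrable_ip:
  "f \<in> csphere \<Longrightarrow> g \<in> csphere \<Longrightarrow> integrable sphere_measure (\<lambda>x. f x * cnj (g x))"
  by (intro integrable_sphere_measure continuous_intros csphere_continuous)

lemma ip_add_left:
  "f \<in> csphere \<Longrightarrow> g \<in> csphere \<Longrightarrow> h \<in> csphere \<Longrightarrow> ip (f + g) h = ip f h + ip g h"
  by (simp add: ip_def algebra_simps integrable_ip)

lemma ip_diff_left:
  "f \<in> csphere \<Longrightarrow> g \<in> csphere \<Longrightarrow> h \<in> csphere \<Longrightarrow> ip (f - g) h = ip f h - ip g h"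
  by (simp add: ip_def algebra_simps integrable_ip)

lemma ip_scale_left: "ip (\<lambda>x. c * f x) g = c * ip f g"
  by (simp add: ip_def mult.assoc)

lemma ip_cnj: "ip f g = cnj (ip g f)"
  unfolding ip_def Bochner_Integration.integral_cnj[symmetric] by (simp add: mult.commute)

lemma ip_scale_right: "ip f (\<lambda>x. c * g x) = cnj c * ip f g"
  unfolding ip_cnj[of f] by (simp add: ip_scale_left)

lemma ip_sum_left:
  assumes "\<And>a. a \<in> A \<Longrightarrow> F a \<in> csphere" "h \<in> csphere"
  shows "ip (\<lambda>x. \<Sum>a\<in>A. c a * F a x) h = (\<Sum>a\<in>A. c a * ip (F a) h)"
proof -
  have "ip (\<lambda>x. \<Sum>a\<in>A. c a * F a x) h = (LINT x|sphere_measure. (\<Sum>a\<in>A. c a * (F a x * cnj (h x))))"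
    by (simp add: ip_def sum_distrib_right mult.assoc)
  also have "\<dots> = (\<Sum>a\<in>A. (LINT x|sphere_measure. c a * (F a x * cnj (h x))))"
    by (rule Bochner_Integration.integral_sum) (use assms in \<open>simp add: integrable_ip\<close>)
  finally show ?thesis by (simp add: ip_def)
qed

lemma ip_sum_right:
  assumes "\<And>a. a \<in> A \<Longrightarrow> F a \<in> csphere" "h \<in> csphere"
  shows "ip h (\<lambda>x. \<Sum>a\<in>A. c a * F a x) = (\<Sum>a\<in>A. cnj (c a) * ip h (F a))"
  unfolding ip_cnj[of h] by (simp add: ip_sum_left[OF assms])

lemma ip_self: "ip f f = of_real (LINT x|sphere_measure. (cmod (f x))\<^sup>2)"
  unfolding ip_def complex_norm_square[symmetric] of_real_power[symmetric] by (rule integral_complex_of_real)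

lemma ip_eq_0:
  assumes f: "f \<in> csphere" and 0: "ip f f = 0"
  shows "f = 0"
proof (rule csphere_eqI[OF f])
  show "(0::_ \<Rightarrow> complex) \<in> csphere" by (simp add: csphere_def zero_fun_def)
  fix x :: "real^'a" assume x: "x \<in> sphere 0 1"
  have "(cmod (f x))\<^sup>2 = 0"
    by (rule integral_sphere_eq_0[OF _ _ _ x])
      (use 0 f in \<open>auto simp: ip_self intro!: continuous_intros csphere_continuous\<close>)
  then show "f x = 0 x" by simp
qed

lemma cspan_finite_repr:
  assumes "finite B" "g \<in> cfun.span B"
  obtains u where "\<And>x. g x = (\<Sum>f\<in>B. u f * f x)"
  using assms(2) unfolding cfun.span_finite[OF assms(1)] by (auto simp: sum_fun_apply)

lemma cspan_sum_mem: "(\<lambda>x. \<Sum>f\<in>B. u f * f x) \<in> cfun.span B"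
proof -
  have "(\<lambda>x. \<Sum>f\<in>B. u f * f x) = (\<Sum>f\<in>B. (\<lambda>x. u f * f x))"
    by (rule ext) (simp add: sum_fun_apply)
  also have "\<dots> \<in> cfun.span B"
    by (intro cfun.span_sum cfun.span_scale cfun.span_base)
  finally show ?thesis .
qed

definition orthonormal :: "(real^'n::finite \<Rightarrow> complex) set \<Rightarrow> bool" where
  "orthonormal B \<longleftrightarrow> finite B \<and> B \<subseteq> csphere \<and>
     (\<forall>f\<in>B. \<forall>g\<in>B. ip f g = (if f = g then 1 else 0))"

lemma orthonormalD:
  assumes "orthonormal B"
  shows "finite B" "B \<subseteq> csphere" "\<And>f. f \<in> B \<Longrightarrow> f \<in> csphere" "cfun.span B \<subseteq> csphere"
    "\<And>f g. f \<in> B \<Longrightarrow> g \<in> B \<Longrightarrow> ip f g = (if f = g then 1 else 0)"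
  using assms cfun.span_minimal[OF _ subspace_csphere, of B] unfolding orthonormal_def by auto

lemma orthonormal_expansion:
  assumes B: "orthonormal B" and g: "g \<in> cfun.span B"
  shows "g x = (\<Sum>f\<in>B. ip g f * f x)"
proof -
  obtain u where u: "\<And>x. g x = (\<Sum>f\<in>B. u f * f x)"
    using cspan_finite_repr[OF orthonormalD(1)[OF B] g] by blast
  then have g_eq: "g = (\<lambda>x. \<Sum>f\<in>B. u f * f x)" by auto
  have "ip g h = u h" if h: "h \<in> B" for h
  proof -
    have "ip g h = (\<Sum>f\<in>B. u f * ip f h)"
      unfolding g_eq by (rule ip_sum_left) (use orthonormalD[OF B] h in auto)
    also have "\<dots> = (\<Sum>f\<in>B. if f = h then u f else 0)"
      by (rule sum.cong) (use orthonormalD(5)[OF B _ h] in auto)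
    finally show ?thesis using h orthonormalD(1)[OF B] by simp
  qed
  then show ?thesis using u by simp
qed

text \<open>Links the trace of the kernel, which counts basis elements, to the dimension in
  \<open>N_dim\<close>.\<close>

lemma orthonormal_card_eq_dim:
  assumes B: "orthonormal B"
  shows "card B = cfun.dim (cfun.span B)"
proof -
  have "cfun.independent B"
  proof (rule cfun.independent_if_scalars_zero[OF orthonormalD(1)[OF B]])
    fix u h assume 0: "(\<Sum>f\<in>B. (\<lambda>x. u f * f x)) = 0" and h: "h \<in> B"
    have "(\<lambda>x. \<Sum>f\<in>B. u f * f x) = 0"
      using 0 by (simp add: fun_eq_iff sum_fun_apply)
    then have "0 = ip (\<lambda>x. \<Sum>f\<in>B. u f * f x) h"
      by (simp add: ip_def)
    also have "\<dots> = (\<Sum>f\<in>B. u f * ip f h)"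
      by (rule ip_sum_left) (use orthonormalD[OF B] h in auto)
    also have "\<dots> = (\<Sum>f\<in>B. if f = h then u f else 0)"
      by (rule sum.cong) (use orthonormalD(5)[OF B _ h] in auto)
    finally show "u h = 0" using h orthonormalD(1)[OF B] by simp
  qed
  then show ?thesis by (simp add: cfun.dim_eq_card_independent)
qed

text \<open>\<open>F\<close> may be dependent: a vector whose orthogonal remainder \<open>b\<close>
  is zero is dropped, and only the span is preserved.\<close>

lemma gram_schmidt:
  assumes "finite F" "F \<subseteq> csphere"
  shows "\<exists>B. orthonormal B \<and> cfun.span B = cfun.span F"
  using assms
proof (induction F rule: finite_induct)
  case empty
  show ?case by (intro exI[of _ "{}"]) (simp add: orthonormal_def)
next
  case (insert a F)
  then obtain B where B: "orthonormal B" "cfun.span B = cfun.span F" by auto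
  have a: "a \<in> csphere" using insert by simp
  define s where "s = (\<lambda>x. \<Sum>f\<in>B. ip a f * f x)"
  define b where "b = a - s"
  have sB: "s \<in> cfun.span B" unfolding s_def by (rule cspan_sum_mem)
  have sc: "s \<in> csphere" using sB orthonormalD(4)[OF B(1)] by auto
  have bc: "b \<in> csphere" unfolding b_def by (rule cfun.subspace_diff[OF subspace_csphere a sc])
  have orth: "ip b f = 0" if f: "f \<in> B" for f
  proof -
    have "ip s f = (\<Sum>g\<in>B. ip a g * ip g f)"
      unfolding s_def by (rule ip_sum_left) (use orthonormalD[OF B(1)] f in auto)
    also have "\<dots> = (\<Sum>g\<in>B. if g = f then ip a g else 0)"
      by (rule sum.cong) (use orthonormalD(5)[OF B(1) _ f] in auto)
    also have "\<dots> = ip a f" using f orthonormalD(1)[OF B(1)] by simp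
    finally show ?thesis
      unfolding b_def using ip_diff_left[OF a sc] orthonormalD(3)[OF B(1) f] by simp
  qed
  have span_a: "cfun.span (insert a F) = cfun.span (insert b B)"
  proof
    have "a = b + s" by (simp add: b_def)
    then have "a \<in> cfun.span (insert b B)"
      using cfun.span_add[OF cfun.span_base[of b "insert b B"]
          subsetD[OF cfun.span_mono[of B "insert b B"] sB]] by auto
    moreover have "F \<subseteq> cfun.span (insert b B)"
      using cfun.span_superset[of F] B(2) cfun.span_mono[of B "insert b B"] by auto
    ultimately show "cfun.span (insert a F) \<subseteq> cfun.span (insert b B)"
      by (intro cfun.span_minimal) auto
    have m: "cfun.span B \<subseteq> cfun.span (insert a F)"
      unfolding B(2) by (rule cfun.span_mono) auto
    then have "b \<in> cfun.span (insert a F)"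
      unfolding b_def using sB cfun.span_diff[OF cfun.span_base[of a "insert a F"]] by auto
    then show "cfun.span (insert b B) \<subseteq> cfun.span (insert a F)"
      using m cfun.span_superset[of B] by (intro cfun.span_minimal) auto
  qed
  show ?case
  proof (cases "b = 0")
    case True
    then show ?thesis using span_a B(1) by (intro exI[of _ B]) (simp add: cfun.span_insert_0)
  next
    case False
    define r where "r = (LINT x|sphere_measure. (cmod (b x))\<^sup>2)"
    have r: "r > 0"
    proof -
      have "r \<ge> 0" unfolding r_def by simp
      moreover have "r \<noteq> 0" using ip_eq_0[OF bc] False ip_self[of b] by (auto simp: r_def)
      ultimately show ?thesis by simp
    qed
    define c where "c = complex_of_real (1 / sqrt r)"
    define b' where "b' = (\<lambda>x. c * b x)"
    have c: "c \<noteq> 0" "c * cnj c * of_real r = 1"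
      using r unfolding c_def by (simp_all flip: of_real_mult add: real_sqrt_mult_self)
    have b'c: "b' \<in> csphere" unfolding b'_def
      by (rule cfun.subspace_scale[OF subspace_csphere bc])
    have "ip b' b' = c * cnj c * ip b b"
      unfolding b'_def ip_scale_left ip_scale_right by simp
    then have b'b': "ip b' b' = 1" using c ip_self[of b] by (simp add: r_def)
    have orth': "ip b' f = 0" "ip f b' = 0" if "f \<in> B" for f
      using orth[OF that] ip_cnj[of f b] unfolding b'_def by (simp_all add: ip_scale_left ip_scale_right)
    have "b' \<notin> B" using b'b' orth'(1)[of b'] by auto
    then have "orthonormal (insert b' B)"
      using B(1) b'c b'b' orth' unfolding orthonormal_def by auto
    moreover have "cfun.span (insert b' B) = cfun.span (insert b B)"
    proof
      have "b' \<in> cfun.span (insert b B)"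
        unfolding b'_def by (intro cfun.span_scale cfun.span_base) simp
      then show "cfun.span (insert b' B) \<subseteq> cfun.span (insert b B)"
        using cfun.span_superset[of "insert b B"] by (intro cfun.span_minimal) auto
      have "b = (\<lambda>x. inverse c * b' x)" unfolding b'_def using c by auto
      then have "b \<in> cfun.span (insert b' B)"
        using cfun.span_scale[OF cfun.span_base, of b' "insert b' B" "inverse c"] by simp
      then show "cfun.span (insert b B) \<subseteq> cfun.span (insert b' B)"
        using cfun.span_superset[of "insert b' B"] by (intro cfun.span_minimal) auto
    qed
    ultimately show ?thesis using span_a by blast
  qed
qed

section \<open>Reproducing kernels\<close>

definition rep_kernel :: "(real^'n::finite \<Rightarrow> complex) set \<Rightarrow> real^'n \<Rightarrow> real^'n \<Rightarrow> complex" where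
  "rep_kernel B x t = (\<Sum>f\<in>B. f x * cnj (f t))"

lemma rep_kernel_span: "(\<lambda>x. rep_kernel B x t) \<in> cfun.span B"
  unfolding rep_kernel_def using cspan_sum_mem[of "\<lambda>f. cnj (f t)" B] by (simp add: mult.commute)

lemma ip_rep_kernel:
  assumes B: "orthonormal B" and g: "g \<in> cfun.span B"
  shows "ip g (\<lambda>x. rep_kernel B x t) = g t"
proof -
  have "ip g (\<lambda>x. \<Sum>f\<in>B. cnj (f t) * f x) = (\<Sum>f\<in>B. cnj (cnj (f t)) * ip g f)"
    by (rule ip_sum_right) (use orthonormalD[OF B] g in auto)
  then show ?thesis
    using orthonormal_expansion[OF B g, of t] by (simp add: rep_kernel_def mult.commute)
qed

text \<open>The reproducing kernel does not depend on the orthonormal basis, hence inherits the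
  invariance of the space.\<close>

lemma rep_kernel_rotation_invariant:
  fixes T :: "real^'n::finite \<Rightarrow> real^'n"
  assumes B: "orthonormal B" and T: "orthogonal_transformation T"
    and inv: "\<And>f T. f \<in> cfun.span B \<Longrightarrow> orthogonal_transformation T \<Longrightarrow> (\<lambda>x. f (T x)) \<in> cfun.span B"
  shows "rep_kernel B (T x) (T t) = rep_kernel B x t"
proof -
  let ?T' = "Hilbert_Choice.inv T"
  define W where "W = (\<lambda>x. rep_kernel B (T x) (T t))"
  define D where "D = W - (\<lambda>x. rep_kernel B x t)"
  note c = subsetD[OF orthonormalD(4)[OF B]]
  have T': "orthogonal_transformation ?T'" by (rule orthogonal_transformation_inv[OF T])
  have T'T: "?T' (T x) = x" for x
    using orthogonal_transformation_inj[OF T] by simp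
  have W: "W \<in> cfun.span B" unfolding W_def by (rule inv[OF rep_kernel_span T])
  have D: "D \<in> cfun.span B" unfolding D_def by (rule cfun.span_diff[OF W rep_kernel_span])
  \<comment> \<open>\<open>W\<close> and the section of the kernel at \<open>t\<close> both
    represent evaluation at \<open>t\<close> on the span, so their difference is orthogonal to the
    span and in particular to itself.\<close>
  have "ip g W = g t" if g: "g \<in> cfun.span B" for g
  proof -
    have g': "(\<lambda>x. g (?T' x)) \<in> cfun.span B" by (rule inv[OF g T'])
    have "ip g W = (LINT x|sphere_measure. g (?T' (T x)) * cnj (rep_kernel B (T x) (T t)))"
      by (simp add: ip_def W_def T'T)
    also have "\<dots> = ip (\<lambda>x. g (?T' x)) (\<lambda>x. rep_kernel B x (T t))"
      unfolding ip_def
      by (rule integral_sphere_orthogonal_transformation[OF T, of "\<lambda>x. g (?T' x) * cnj (rep_kernel B x (T t))"])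
        (intro continuous_intros csphere_continuous c g' rep_kernel_span)
    also have "\<dots> = g t" by (simp add: ip_rep_kernel[OF B g'] T'T)
    finally show ?thesis .
  qed
  then have "ip W D = ip (\<lambda>x. rep_kernel B x t) D"
    using D ip_rep_kernel[OF B D, of t] unfolding ip_cnj[of _ D] by simp
  then have "ip D D = 0"
    using ip_diff_left[OF c[OF W] c[OF rep_kernel_span] c[OF D]] by (simp add: D_def)
  then have "D = 0" by (rule ip_eq_0[OF c[OF D]])
  then have "D x = 0" by simp
  then show ?thesis by (simp add: D_def W_def)
qed

section \<open>Homogeneous polynomials\<close>

lemma finite_multi_indices: "finite {\<alpha> :: 'n::finite \<Rightarrow> nat. sum \<alpha> UNIV \<le> d}"
proof (rule finite_subset)
  have "\<alpha> i \<le> sum \<alpha> UNIV" for \<alpha> :: "'n \<Rightarrow> nat" and i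
    by (rule member_le_sum) auto
  then show "{\<alpha> :: 'n \<Rightarrow> nat. sum \<alpha> UNIV \<le> d} \<subseteq> PiE UNIV (\<lambda>_. {..d})"
    by (auto intro: order_trans)
  show "finite (PiE (UNIV :: 'n set) (\<lambda>_. {..d}))" by (rule finite_PiE) auto
qed

lemma finite_multi_indices_eq: "finite {\<alpha> :: 'n::finite \<Rightarrow> nat. sum \<alpha> UNIV = d}"
  by (rule finite_subset[OF _ finite_multi_indices[of d]]) auto

lemma cspan_image_finite:
  assumes "finite A"
  shows "{\<lambda>x. \<Sum>\<alpha>\<in>A. c \<alpha> * m \<alpha> x | c. True} = cfun.span (m ` A)" (is "?L = _")
proof
  show "?L \<subseteq> cfun.span (m ` A)"
  proof
    fix f assume "f \<in> ?L"
    then obtain c where "f = (\<lambda>x. \<Sum>\<alpha>\<in>A. c \<alpha> * m \<alpha> x)" by auto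
    then have f: "f = (\<Sum>\<alpha>\<in>A. (\<lambda>x. c \<alpha> * m \<alpha> x))"
      by (simp add: fun_eq_iff sum_fun_apply)
    show "f \<in> cfun.span (m ` A)"
      unfolding f by (intro cfun.span_sum cfun.span_scale cfun.span_base) auto
  qed
  have sub: "cfun.subspace ?L"
  proof (rule cfun.subspaceI)
    show "0 \<in> ?L" by (auto intro!: exI[of _ "\<lambda>_. 0"])
    show "f + g \<in> ?L" if fg: "f \<in> ?L" "g \<in> ?L" for f g
    proof -
      obtain c d where "f = (\<lambda>x. \<Sum>\<alpha>\<in>A. c \<alpha> * m \<alpha> x)" "g = (\<lambda>x. \<Sum>\<alpha>\<in>A. d \<alpha> * m \<alpha> x)"
        using fg by auto
      then show ?thesis
        by (auto simp: fun_eq_iff sum.distrib algebra_simps intro!: exI[of _ "\<lambda>\<alpha>. c \<alpha> + d \<alpha>"])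
    qed
    show "(\<lambda>x. a * f x) \<in> ?L" if f: "f \<in> ?L" for a f
    proof -
      obtain c where "f = (\<lambda>x. \<Sum>\<alpha>\<in>A. c \<alpha> * m \<alpha> x)" using f by auto
      then show ?thesis
        by (auto simp: fun_eq_iff sum_distrib_left mult.assoc intro!: exI[of _ "\<lambda>\<alpha>. a * c \<alpha>"])
    qed
  qed
  have "m \<alpha> \<in> ?L" if "\<alpha> \<in> A" for \<alpha>
    using that assms
    by (auto simp: fun_eq_iff if_distrib[of "\<lambda>c. c * _"] cong: if_cong
        intro!: exI[of _ "\<lambda>\<beta>. if \<beta> = \<alpha> then 1 else 0"])
  then show "cfun.span (m ` A) \<subseteq> ?L"
    by (intro cfun.span_minimal sub) auto
qed

lemma hom_polys_eq_span:
  "(hom_polys d :: (real^'n::finite \<Rightarrow> complex) set) = cfun.span (monomial_fun ` {\<alpha>. sum \<alpha> UNIV = d})"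
  unfolding hom_polys_def by (rule cspan_image_finite[OF finite_multi_indices_eq])

lemma polys_le_eq_span:
  "(polys_le d :: (real^'n::finite \<Rightarrow> complex) set) = cfun.span (monomial_fun ` {\<alpha>. sum \<alpha> UNIV \<le> d})"
  unfolding polys_le_def by (rule cspan_image_finite[OF finite_multi_indices])

lemma subspace_hom_polys: "cfun.subspace (hom_polys d :: (real^'n::finite \<Rightarrow> complex) set)"
  unfolding hom_polys_eq_span by (rule cfun.subspace_span)

lemma monomial_in_hom_polys: "sum \<alpha> UNIV = d \<Longrightarrow> monomial_fun \<alpha> \<in> hom_polys d"
  unfolding hom_polys_eq_span by (rule cfun.span_base) auto

text \<open>An induction principle: a property that defines a subspace has to be checked on
  monomials only.\<close>

lemma hom_polys_subset:
  assumes "cfun.subspace V" "\<And>\<alpha>. sum \<alpha> UNIV = d \<Longrightarrow> monomial_fun \<alpha> \<in> V"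
  shows "hom_polys d \<subseteq> V"
  unfolding hom_polys_eq_span by (rule cfun.span_minimal[OF _ assms(1)]) (use assms(2) in auto)

lemma monomial_fun_Suc:
  "monomial_fun (\<alpha>(i := Suc (\<alpha> i))) x = of_real (x $ i) * monomial_fun \<alpha> x"
  unfolding monomial_fun_def
  by (subst (1 2) prod.remove[of UNIV i]) (auto intro!: prod.cong)

lemma sum_multi_index_Suc: "sum (\<alpha>(i := Suc (\<alpha> i))) UNIV = Suc (sum \<alpha> (UNIV :: 'n::finite set))"
  by (subst (1 2) sum.remove[of UNIV i]) (auto intro!: sum.cong)

lemma multi_index_SucE:
  assumes "sum \<alpha> UNIV = Suc k"
  obtains \<beta> and i :: "'n::finite" where "sum \<beta> UNIV = k" "\<alpha> = \<beta>(i := Suc (\<beta> i))"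
proof -
  obtain i where i: "\<alpha> i \<noteq> 0" using assms by (metis Zero_not_Suc sum.neutral)
  define \<beta> where "\<beta> = \<alpha>(i := \<alpha> i - 1)"
  have \<alpha>: "\<alpha> = \<beta>(i := Suc (\<beta> i))" using i by (auto simp: \<beta>_def)
  then show thesis
    using that[of \<beta> i] assms sum_multi_index_Suc[of \<beta> i] by simp
qed

lemma hom_polys_0: "(hom_polys 0 :: (real^'n::finite \<Rightarrow> complex) set) = {\<lambda>x. c | c. True}"
proof -
  have "sum \<alpha> UNIV = 0 \<longleftrightarrow> \<alpha> = (\<lambda>_. 0)" for \<alpha> :: "'n \<Rightarrow> nat"
    by (auto simp: fun_eq_iff)
  then show ?thesis
    by (auto simp: hom_polys_def monomial_fun_def)
qed

lemma hom_polys_mult_coord: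
  assumes "f \<in> hom_polys d"
  shows "(\<lambda>x. of_real (x $ i) * f x) \<in> hom_polys (Suc d)"
proof -
  let ?V = "{f. (\<lambda>x. of_real (x $ i) * f x) \<in> hom_polys (Suc d)}"
  have "hom_polys d \<subseteq> ?V"
  proof (rule hom_polys_subset)
    show "cfun.subspace ?V"
      using cfun.subspace_0[OF subspace_hom_polys] cfun.subspace_add[OF subspace_hom_polys]
        cfun.subspace_scale[OF subspace_hom_polys]
      by (intro cfun.subspaceI) (force simp: zero_fun_def plus_fun_def algebra_simps)+
    show "monomial_fun \<alpha> \<in> ?V" if "sum \<alpha> UNIV = d" for \<alpha>
      using monomial_in_hom_polys[OF sum_multi_index_Suc[of \<alpha> i]] that
      by (simp add: monomial_fun_Suc[symmetric])
  qed
  then show ?thesis using assms by auto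
qed

lemma hom_polys_sum:
  assumes "\<And>i. i \<in> A \<Longrightarrow> F i \<in> hom_polys d"
  shows "(\<lambda>x. \<Sum>i\<in>A. c i * F i x) \<in> hom_polys d"
proof -
  have "(\<lambda>x. \<Sum>i\<in>A. c i * F i x) = (\<Sum>i\<in>A. (\<lambda>x. c i * F i x))"
    by (simp add: fun_eq_iff sum_fun_apply)
  then show ?thesis
    using cfun.subspace_sum[OF subspace_hom_polys, of A "\<lambda>i x. c i * F i x"]
      cfun.subspace_scale[OF subspace_hom_polys assms] by simp
qed

lemma hom_polys_mult_inner:
  assumes "f \<in> hom_polys d"
  shows "(\<lambda>x. of_real (y \<bullet> x) * f x) \<in> hom_polys (Suc d)"
proof -
  have "(\<lambda>x. of_real (y \<bullet> x) * f x) = (\<lambda>x. \<Sum>i\<in>UNIV. of_real (y $ i) * (of_real (x $ i) * f x))"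
    by (simp add: inner_vec_def sum_distrib_right mult.assoc)
  then show ?thesis
    using hom_polys_sum[of UNIV "\<lambda>i x. of_real (x $ i) * f x" "Suc d" "\<lambda>i. of_real (y $ i)"]
      hom_polys_mult_coord[OF assms] by simp
qed

lemma inner_power_in_hom_polys: "(\<lambda>x. of_real (y \<bullet> x) ^ d) \<in> hom_polys d"
  by (induction d) (auto simp: hom_polys_0 intro!: hom_polys_mult_inner)

lemma hom_polys_mult_squares:
  assumes "f \<in> hom_polys d"
  shows "(\<lambda>x. of_real (\<Sum>i\<in>I. (x $ i)\<^sup>2) * f x) \<in> hom_polys (d + 2)"
proof -
  have "(\<lambda>x. of_real (\<Sum>i\<in>I. (x $ i)\<^sup>2) * f x) =
      (\<lambda>x. \<Sum>i\<in>I. 1 * (of_real (x $ i) * (of_real (x $ i) * f x)))"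
    by (simp add: sum_distrib_right power2_eq_square mult.assoc)
  then show ?thesis
    using hom_polys_sum[of I "\<lambda>i x. of_real (x $ i) * (of_real (x $ i) * f x)" "d + 2" "\<lambda>_. 1"]
      hom_polys_mult_coord[OF hom_polys_mult_coord[OF assms]] by simp
qed

lemma norm_squares: "(norm (x :: real^'n::finite))\<^sup>2 = (\<Sum>i\<in>UNIV. (x $ i)\<^sup>2)"
  by (simp add: norm_vec_def L2_set_def sum_nonneg)

text \<open>On the sphere the extra factor is 1, so the degree is raised by \<open>2 * j\<close>
  without a change of the restriction.\<close>

lemma hom_polys_mult_norm_power:
  assumes "f \<in> hom_polys d"
  shows "(\<lambda>x. of_real (norm x) ^ (2 * j) * f x) \<in> hom_polys (d + 2 * j)"
proof (induction j)
  case (Suc j)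
  have "complex_of_real (norm x) ^ (2 * Suc j) * f x =
      of_real (\<Sum>i\<in>UNIV. (x $ i)\<^sup>2) * (of_real (norm x) ^ (2 * j) * f x)" for x
    unfolding norm_squares[symmetric] by (simp add: power2_eq_square mult.assoc)
  then show ?case
    using hom_polys_mult_squares[OF Suc.IH, of UNIV] by (simp only: add.assoc[symmetric] mult_Suc_right add.commute[of 2])
qed (use assms in simp)

lemma hom_polys_scaleR:
  assumes "f \<in> hom_polys d"
  shows "f (r *\<^sub>R x) = of_real r ^ d * f x"
proof -
  have "hom_polys d \<subseteq> {f. f (r *\<^sub>R x) = of_real r ^ d * f x}"
  proof (rule hom_polys_subset)
    show "cfun.subspace {f. f (r *\<^sub>R x) = of_real r ^ d * f x}"
      by (intro cfun.subspaceI) (auto simp: algebra_simps)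
    show "monomial_fun \<alpha> \<in> {f. f (r *\<^sub>R x) = of_real r ^ d * f x}" if "sum \<alpha> UNIV = d" for \<alpha>
      using that
      by (auto simp: monomial_fun_def power_mult_distrib prod.distrib power_sum[symmetric])
  qed
  then show ?thesis using assms by auto
qed

lemma continuous_on_hom_polys:
  assumes "f \<in> hom_polys d"
  shows "continuous_on A f"
proof -
  have "hom_polys d \<subseteq> {f. continuous_on A f}"
  proof (rule hom_polys_subset)
    show "cfun.subspace {f :: real^'a \<Rightarrow> complex. continuous_on A f}"
      by (intro cfun.subspaceI) (auto simp: plus_fun_def zero_fun_def intro!: continuous_intros)
    show "monomial_fun \<alpha> \<in> {f. continuous_on A f}" for \<alpha> :: "'a \<Rightarrow> nat"
      unfolding monomial_fun_def by (auto intro!: continuous_intros)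
  qed
  then show ?thesis using assms by auto
qed

subsection \<open>Polarization\<close>

text \<open>Replacing \<open>s\<close> by \<open>2 * s\<close> and subtracting
  \<open>2 ^ Suc N\<close> times the original kills the top coefficient and multiplies the others by
  nonzero numbers, which gives an induction on \<open>N\<close>. Only positive \<open>s\<close> are
  tested, because later \<open>s\<close> is the square of a length.\<close>

lemma coefficients_in_subspace:
  assumes V: "cfun.subspace V"
    and "\<And>s. s > 0 \<Longrightarrow> (\<lambda>x. \<Sum>i\<le>N. of_real s ^ i * v i x) \<in> V"
  shows "i \<le> N \<Longrightarrow> v i \<in> V"
  using assms(2)
proof (induction N arbitrary: v i)
  case 0
  then show ?case using "0.prems"(2)[of 1] by simp
next
  case (Suc N)
  define w where "w = (\<lambda>i x. (of_real (2 ^ i) - of_real (2 ^ Suc N)) * v i x :: complex)"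
  have "(\<lambda>x. \<Sum>i\<le>N. of_real s ^ i * w i x) \<in> V" if s: "s > 0" for s
  proof -
    have "(\<lambda>x. \<Sum>i\<le>N. of_real s ^ i * w i x) =
        (\<lambda>x. \<Sum>i\<le>Suc N. of_real (2 * s) ^ i * v i x) - (\<lambda>x. of_real (2 ^ Suc N) * (\<Sum>i\<le>Suc N. of_real s ^ i * v i x))"
      by (simp add: fun_eq_iff w_def algebra_simps sum_subtractf sum_distrib_left sum_distrib_right power_mult_distrib)
    then show ?thesis
      using cfun.subspace_diff[OF V Suc.prems(2)[of "2 * s"] cfun.subspace_scale[OF V Suc.prems(2)[OF s]]] s
      by simp
  qed
  then have w: "w i \<in> V" if "i \<le> N" for i using Suc.IH[OF that] by blast
  have v: "v i \<in> V" if i: "i \<le> N" for i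
  proof -
    have "(2::complex) ^ i \<noteq> 2 ^ Suc N"
      using i by (metis of_nat_eq_iff of_nat_numeral of_nat_power power_inject_exp le_imp_less_Suc nat_neq_iff one_less_numeral_iff semiring_norm(76))
    then have "v i = (\<lambda>x. inverse (of_real (2 ^ i) - of_real (2 ^ Suc N)) * w i x)"
      by (auto simp: w_def fun_eq_iff)
    then show ?thesis
      using cfun.subspace_scale[OF V w[OF i]] by metis
  qed
  have "(\<Sum>i\<le>N. v i) \<in> V" by (rule cfun.subspace_sum[OF V]) (use v in auto)
  then have "(\<lambda>x. \<Sum>i\<le>Suc N. of_real 1 ^ i * v i x) - (\<Sum>i\<le>N. v i) \<in> V"
    by (intro cfun.subspace_diff[OF V Suc.prems(2)]) auto
  moreover have "v (Suc N) = (\<lambda>x. \<Sum>i\<le>Suc N. of_real 1 ^ i * v i x) - (\<Sum>i\<le>N. v i)"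
    by (simp add: fun_eq_iff sum_fun_apply)
  ultimately have "v (Suc N) \<in> V" by metis
  then show ?case using v Suc.prems(1) by (cases "i = Suc N") auto
qed

text \<open>Powers of linear forms are the generators on which rotations and the Laplacian act
  explicitly. A monomial is built up from them one coordinate at a time: the derivative of a power
  in the direction of an axis supplies the coordinate as a factor, and this derivative is read off
  as a coefficient.\<close>

lemma hom_polys_eq_span_powers:
  "(hom_polys d :: (real^'n::finite \<Rightarrow> complex) set) = cfun.span (range (\<lambda>y x. of_real (y \<bullet> x) ^ d))"
    (is "_ = ?V")
proof
  show "?V \<subseteq> hom_polys d"
    by (intro cfun.span_minimal subspace_hom_polys) (use inner_power_in_hom_polys in auto)
  have "\<forall>a z. k + a = d \<longrightarrow> (\<lambda>x. of_real (z \<bullet> x) ^ a * monomial_fun \<alpha> x) \<in> ?V"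
    if "sum \<alpha> UNIV = k" for k and \<alpha> :: "'n \<Rightarrow> nat"
    using that
  proof (induction k arbitrary: \<alpha>)
    case 0
    then have "monomial_fun \<alpha> = (\<lambda>_. 1)" by (simp add: monomial_fun_def fun_eq_iff)
    then show ?case by (auto intro!: cfun.span_base)
  next
    case (Suc k)
    show ?case
    proof (intro allI impI)
      fix a and z :: "real^'n" assume a: "Suc k + a = d"
      obtain \<beta> i where \<beta>: "sum \<beta> UNIV = k" "\<alpha> = \<beta>(i := Suc (\<beta> i))"
        using multi_index_SucE[OF Suc.prems] by blast
      \<comment> \<open>The coefficients of \<open>((z + s e_i) \<bullet> x) ^ (a + 1)\<close> in
        powers of \<open>s\<close>, times the remaining monomial. The linear one is
        \<open>(a + 1) x_i (z \<bullet> x) ^ a\<close>, which contains the wanted factor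
        \<open>x_i\<close>.\<close>
      define v where "v = (\<lambda>j x. of_nat (Suc a choose j) * (of_real (x $ i) ^ j *
        of_real (z \<bullet> x) ^ (Suc a - j)) * monomial_fun \<beta> x)"
      have "v 1 \<in> ?V"
      proof (rule coefficients_in_subspace[where N = "Suc a"])
        fix s :: real
        have "(\<lambda>x. of_real ((z + s *\<^sub>R axis i 1) \<bullet> x) ^ Suc a * monomial_fun \<beta> x) \<in> ?V"
          using Suc.IH[OF \<beta>(1)] a by auto
        also have "(\<lambda>x. of_real ((z + s *\<^sub>R axis i 1) \<bullet> x) ^ Suc a * monomial_fun \<beta> x) =
            (\<lambda>x. \<Sum>j\<le>Suc a. of_real s ^ j * v j x)"
        proof
          fix x :: "real^'n"
          have "complex_of_real ((z + s *\<^sub>R axis i 1) \<bullet> x) ^ Suc a =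
              (of_real s * of_real (x $ i) + of_real (z \<bullet> x)) ^ Suc a"
            by (simp add: inner_add_left inner_axis' add.commute)
          also have "\<dots> = (\<Sum>j\<le>Suc a. of_nat (Suc a choose j) * (of_real s * of_real (x $ i)) ^ j *
              of_real (z \<bullet> x) ^ (Suc a - j))"
            by (rule binomial_ring)
          finally show "of_real ((z + s *\<^sub>R axis i 1) \<bullet> x) ^ Suc a * monomial_fun \<beta> x =
              (\<Sum>j\<le>Suc a. of_real s ^ j * v j x)"
            unfolding v_def sum_distrib_right
            by (simp only: sum_distrib_left sum_distrib_right power_mult_distrib mult_ac)
        qed
        finally show "(\<lambda>x. \<Sum>j\<le>Suc a. of_real s ^ j * v j x) \<in> ?V" .
      qed (auto intro: cfun.subspace_span)
      then have "(\<lambda>x. inverse (of_nat (Suc a)) * v 1 x) \<in> ?V"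
        by (rule cfun.span_scale)
      also have "(\<lambda>x. inverse (of_nat (Suc a)) * v 1 x) =
          (\<lambda>x. of_real (z \<bullet> x) ^ a * monomial_fun \<alpha> x)"
      proof
        fix x
        have "of_nat (Suc a) \<noteq> (0::complex)" by (simp only: of_nat_eq_0_iff)
        then show "inverse (of_nat (Suc a)) * v 1 x = of_real (z \<bullet> x) ^ a * monomial_fun \<alpha> x"
          unfolding \<beta>(2) monomial_fun_Suc v_def by (simp del: of_nat_Suc add: field_simps)
      qed
      finally show "(\<lambda>x. of_real (z \<bullet> x) ^ a * monomial_fun \<alpha> x) \<in> ?V" .
    qed
  qed
  from this[of _ d] show "hom_polys d \<subseteq> ?V"
    by (intro hom_polys_subset) auto
qed

subsection \<open>The Laplacian\<close>

text \<open>\<open>laplacian\<close> is built from \<open>vector_derivative\<close>, a total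
  function that has a value even where no derivative exists. The relational form carries the
  differentiability along and is therefore closed under sums and scalar multiples.\<close>

definition has_laplacian :: "(real^'n::finite \<Rightarrow> complex) \<Rightarrow> (real^'n \<Rightarrow> complex) \<Rightarrow> bool" where
  "has_laplacian f g \<longleftrightarrow> (\<exists>f1 f2.
     (\<forall>i x. ((\<lambda>t. f (x + t *\<^sub>R axis i 1)) has_vector_derivative f1 i x) (at 0)) \<and>
     (\<forall>i x. ((\<lambda>t. f1 i (x + t *\<^sub>R axis i 1)) has_vector_derivative f2 i x) (at 0)) \<and>
     (\<forall>x. g x = (\<Sum>i\<in>UNIV. f2 i x)))"

lemma has_laplacianI:
  assumes "\<And>i x. ((\<lambda>t. f (x + t *\<^sub>R axis i 1)) has_vector_derivative f1 i x) (at 0)"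
    "\<And>i x. ((\<lambda>t. f1 i (x + t *\<^sub>R axis i 1)) has_vector_derivative f2 i x) (at 0)"
    "\<And>x. g x = (\<Sum>i\<in>UNIV. f2 i x)"
  shows "has_laplacian f g"
  using assms unfolding has_laplacian_def by blast

lemma has_laplacian_imp_eq:
  assumes "has_laplacian f g"
  shows "laplacian f = g"
proof -
  obtain f1 f2 where
    1: "\<And>i x. ((\<lambda>t. f (x + t *\<^sub>R axis i 1)) has_vector_derivative f1 i x) (at 0)" and
    2: "\<And>i x. ((\<lambda>t. f1 i (x + t *\<^sub>R axis i 1)) has_vector_derivative f2 i x) (at 0)" and
    g: "\<And>x. g x = (\<Sum>i\<in>UNIV. f2 i x)"
    using assms unfolding has_laplacian_def by blast
  have "partial_deriv i f = f1 i" for i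
    unfolding partial_deriv_def by (rule ext) (rule vector_derivative_at[OF 1])
  moreover have "partial_deriv i (f1 i) = f2 i" for i
    unfolding partial_deriv_def by (rule ext) (rule vector_derivative_at[OF 2])
  ultimately show ?thesis
    by (intro ext) (simp add: laplacian_def g)
qed

lemma has_laplacian_add:
  assumes "has_laplacian f g" "has_laplacian f' g'"
  shows "has_laplacian (\<lambda>x. f x + f' x) (\<lambda>x. g x + g' x)"
proof -
  obtain f1 f2 where
    1: "\<And>i x. ((\<lambda>t. f (x + t *\<^sub>R axis i 1)) has_vector_derivative f1 i x) (at 0)"
      "\<And>i x. ((\<lambda>t. f1 i (x + t *\<^sub>R axis i 1)) has_vector_derivative f2 i x) (at 0)"
      "\<And>x. g x = (\<Sum>i\<in>UNIV. f2 i x)"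
    using assms(1) unfolding has_laplacian_def by blast
  obtain h1 h2 where
    2: "\<And>i x. ((\<lambda>t. f' (x + t *\<^sub>R axis i 1)) has_vector_derivative h1 i x) (at 0)"
      "\<And>i x. ((\<lambda>t. h1 i (x + t *\<^sub>R axis i 1)) has_vector_derivative h2 i x) (at 0)"
      "\<And>x. g' x = (\<Sum>i\<in>UNIV. h2 i x)"
    using assms(2) unfolding has_laplacian_def by blast
  show ?thesis
    by (rule has_laplacianI[where ?f1.0 = "\<lambda>i x. f1 i x + h1 i x" and ?f2.0 = "\<lambda>i x. f2 i x + h2 i x"])
      (use 1 2 in \<open>auto simp: sum.distrib intro!: derivative_intros\<close>)
qed

lemma has_laplacian_scale:
  assumes "has_laplacian f g"
  shows "has_laplacian (\<lambda>x. c * f x) (\<lambda>x. c * g x)"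
proof -
  obtain f1 f2 where
    1: "\<And>i x. ((\<lambda>t. f (x + t *\<^sub>R axis i 1)) has_vector_derivative f1 i x) (at 0)"
      "\<And>i x. ((\<lambda>t. f1 i (x + t *\<^sub>R axis i 1)) has_vector_derivative f2 i x) (at 0)"
      "\<And>x. g x = (\<Sum>i\<in>UNIV. f2 i x)"
    using assms(1) unfolding has_laplacian_def by blast
  show ?thesis
    by (rule has_laplacianI[where ?f1.0 = "\<lambda>i x. c * f1 i x" and ?f2.0 = "\<lambda>i x. c * f2 i x"])
      (use 1 in \<open>auto simp: sum_distrib_left intro!: derivative_intros\<close>)
qed

lemma has_laplacian_const: "has_laplacian (\<lambda>_. c) (\<lambda>_. 0)"
  by (rule has_laplacianI[where ?f1.0 = "\<lambda>_ _. 0" and ?f2.0 = "\<lambda>_ _. 0"]) auto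

lemma has_laplacian_sum:
  assumes "\<And>a. a \<in> A \<Longrightarrow> has_laplacian (F a) (G a)"
  shows "has_laplacian (\<lambda>x. \<Sum>a\<in>A. F a x) (\<lambda>x. \<Sum>a\<in>A. G a x)"
  using assms by (induction A rule: infinite_finite_induct)
    (auto simp: has_laplacian_const intro!: has_laplacian_add)

text \<open>Only \<open>y \<bullet> y\<close> and \<open>y \<bullet> x\<close> occur in the result,
  which is the source of rotation invariance. For \<open>d < 2\<close> the truncated exponent is
  harmless, since the factor \<open>d * (d - 1)\<close> is zero.\<close>

lemma has_laplacian_inner_power:
  fixes y :: "real^'n::finite"
  shows
  "has_laplacian (\<lambda>x. of_real (y \<bullet> x) ^ d) (\<lambda>x. of_real (real (d * (d - 1)) * (y \<bullet> y) * (y \<bullet> x) ^ (d - 2)))"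
proof (rule has_laplacianI)
  fix i and x :: "real^'n"
  have inner: "y \<bullet> (x + t *\<^sub>R axis i 1) = y \<bullet> x + t * (y $ i)" for t
    by (simp add: inner_add_right inner_axis)
  have "((\<lambda>t. (y \<bullet> x + t * (y $ i)) ^ d) has_real_derivative real d * (y $ i) * (y \<bullet> x) ^ (d - 1)) (at 0)"
    by (auto intro!: derivative_eq_intros)
  from has_vector_derivative_of_real[OF this]
  show "((\<lambda>t. of_real (y \<bullet> (x + t *\<^sub>R axis i 1)) ^ d :: complex)
      has_vector_derivative of_real (real d * (y $ i) * (y \<bullet> x) ^ (d - 1))) (at 0)"
    unfolding inner by simp
  have "((\<lambda>t. real d * (y $ i) * (y \<bullet> x + t * (y $ i)) ^ (d - 1)) has_real_derivative
      real (d * (d - 1)) * (y $ i)\<^sup>2 * (y \<bullet> x) ^ (d - 2)) (at 0)"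
    by (auto intro!: derivative_eq_intros simp: power2_eq_square numeral_2_eq_2)
  from has_vector_derivative_of_real[OF this]
  show "((\<lambda>t. of_real (real d * (y $ i) * (y \<bullet> (x + t *\<^sub>R axis i 1)) ^ (d - 1)) :: complex)
      has_vector_derivative of_real (real (d * (d - 1)) * (y $ i)\<^sup>2 * (y \<bullet> x) ^ (d - 2))) (at 0)"
    unfolding inner by simp
next
  fix x :: "real^'n"
  show "of_real (real (d * (d - 1)) * (y \<bullet> y) * (y \<bullet> x) ^ (d - 2)) =
      (\<Sum>i\<in>UNIV. complex_of_real (real (d * (d - 1)) * (y $ i)\<^sup>2 * (y \<bullet> x) ^ (d - 2)))"
    unfolding of_real_sum[symmetric] sum_distrib_right[symmetric] sum_distrib_left[symmetric]
    by (simp only: inner_vec_def power2_eq_square inner_real_def)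
qed

lemma orthogonal_transformation_inner_inv:
  fixes T :: "real^'n::finite \<Rightarrow> real^'n"
  assumes T: "orthogonal_transformation T"
  shows "y \<bullet> T x = Hilbert_Choice.inv T y \<bullet> x"
proof -
  have "T (Hilbert_Choice.inv T y) = y"
    using orthogonal_transformation_surj[OF T] by (rule surj_f_inv_f)
  moreover have "T v \<bullet> T w = v \<bullet> w" for v w
    using T by (simp add: orthogonal_transformation_def)
  ultimately show ?thesis by metis
qed

text \<open>On a power of \<open>y \<bullet> x\<close> a rotation merely replaces \<open>y\<close>
  by its preimage, which has the same length. The conclusions are proved together, since one
  subspace has to carry a common witness for the Laplacians of \<open>f\<close> and of its
  rotation.\<close>

lemma hom_polys_laplacian_rotate:
  fixes T :: "real^'n::finite \<Rightarrow> real^'n"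
  assumes f: "f \<in> hom_polys d" and T: "orthogonal_transformation T"
  shows "(\<lambda>x. f (T x)) \<in> hom_polys d" "laplacian (\<lambda>x. f (T x)) = (\<lambda>x. laplacian f (T x))"
    "has_laplacian f (laplacian f)"
proof -
  let ?V = "{f. (\<lambda>x. f (T x)) \<in> hom_polys d \<and>
    (\<exists>g. has_laplacian f g \<and> has_laplacian (\<lambda>x. f (T x)) (\<lambda>x. g (T x)))}"
  have "cfun.span (range (\<lambda>y x. of_real (y \<bullet> x) ^ d)) \<subseteq> ?V"
  proof (rule cfun.span_minimal)
    show "cfun.subspace ?V"
    proof (rule cfun.subspaceI)
      show "0 \<in> ?V"
        using has_laplacian_const[of 0] cfun.subspace_0[OF subspace_hom_polys]
        by (auto simp: zero_fun_def)
      show "f + g \<in> ?V" if fg: "f \<in> ?V" "g \<in> ?V" for f g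
      proof -
        obtain g1 g2 where "has_laplacian f g1" "has_laplacian (\<lambda>x. f (T x)) (\<lambda>x. g1 (T x))"
          "has_laplacian g g2" "has_laplacian (\<lambda>x. g (T x)) (\<lambda>x. g2 (T x))"
          using fg by blast
        then show ?thesis
          using cfun.subspace_add[OF subspace_hom_polys, of "\<lambda>x. f (T x)" d "\<lambda>x. g (T x)"] fg
          by (auto simp: plus_fun_def intro!: has_laplacian_add exI[of _ "\<lambda>x. g1 x + g2 x"])
      qed
      show "(\<lambda>x. c * f x) \<in> ?V" if f: "f \<in> ?V" for c f
      proof -
        obtain g where "has_laplacian f g" "has_laplacian (\<lambda>x. f (T x)) (\<lambda>x. g (T x))"
          using f by blast
        then show ?thesis
          using cfun.subspace_scale[OF subspace_hom_polys, of "\<lambda>x. f (T x)" d c] f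
          by (auto intro!: has_laplacian_scale exI[of _ "\<lambda>x. c * g x"])
      qed
    qed
    show "range (\<lambda>y x. of_real (y \<bullet> x) ^ d) \<subseteq> ?V"
    proof (rule image_subsetI)
      fix y :: "real^'n"
      let ?y = "Hilbert_Choice.inv T y"
      have n: "?y \<bullet> ?y = y \<bullet> y"
        using orthogonal_transformation_inv[OF T] by (simp add: orthogonal_transformation_def)
      have "(\<lambda>x. of_real (y \<bullet> T x) ^ d) \<in> hom_polys d"
        unfolding orthogonal_transformation_inner_inv[OF T] by (rule inner_power_in_hom_polys)
      moreover have "\<exists>g. has_laplacian (\<lambda>x. of_real (y \<bullet> x) ^ d) g \<and>
          has_laplacian (\<lambda>x. of_real (y \<bullet> T x) ^ d) (\<lambda>x. g (T x))"
        using has_laplacian_inner_power[of y d] has_laplacian_inner_power[of ?y d, unfolded n,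
            folded orthogonal_transformation_inner_inv[OF T]] by blast
      ultimately show "(\<lambda>x. of_real (y \<bullet> x) ^ d) \<in> ?V" by blast
    qed
  qed
  then obtain g where f': "(\<lambda>x. f (T x)) \<in> hom_polys d" "has_laplacian f g"
      "has_laplacian (\<lambda>x. f (T x)) (\<lambda>x. g (T x))"
    using f unfolding hom_polys_eq_span_powers[symmetric] by blast
  then show "(\<lambda>x. f (T x)) \<in> hom_polys d" "laplacian (\<lambda>x. f (T x)) = (\<lambda>x. laplacian f (T x))"
    "has_laplacian f (laplacian f)"
    by (simp_all add: has_laplacian_imp_eq)
qed

lemma hom_polys_has_laplacian: "f \<in> hom_polys d \<Longrightarrow> has_laplacian f (laplacian f)"
  for f :: "real^'n::finite \<Rightarrow> complex"
  by (rule hom_polys_laplacian_rotate(3)[OF _ orthogonal_transformation_id])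

lemma harmonic_hom_polysD:
  assumes "f \<in> harmonic_hom_polys d"
  shows "has_laplacian f (\<lambda>x. 0)" "f \<in> hom_polys d"
proof -
  have "laplacian f = (\<lambda>x. 0)" "f \<in> hom_polys d"
    using assms by (auto simp: harmonic_hom_polys_def)
  then show "has_laplacian f (\<lambda>x. 0)" "f \<in> hom_polys d"
    using hom_polys_has_laplacian[of f d] by simp_all
qed

lemma harmonic_hom_polysI:
  "f \<in> hom_polys d \<Longrightarrow> has_laplacian f (\<lambda>x. 0) \<Longrightarrow> f \<in> harmonic_hom_polys d"
  using has_laplacian_imp_eq by (fastforce simp: harmonic_hom_polys_def)

lemma subspace_harmonic_hom_polys:
  "cfun.subspace (harmonic_hom_polys d :: (real^'n::finite \<Rightarrow> complex) set)"
proof (rule cfun.subspaceI)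
  show "0 \<in> (harmonic_hom_polys d :: (real^'n \<Rightarrow> complex) set)"
    unfolding zero_fun_def
    by (rule harmonic_hom_polysI[OF _ has_laplacian_const])
      (use cfun.subspace_0[OF subspace_hom_polys] in \<open>simp add: zero_fun_def\<close>)
  fix f g :: "real^'n \<Rightarrow> complex" and c
  assume f: "f \<in> harmonic_hom_polys d"
  then have lf: "has_laplacian f (\<lambda>x. 0)" "f \<in> hom_polys d"
    using harmonic_hom_polysD by blast+
  show "(\<lambda>x. c * f x) \<in> harmonic_hom_polys d"
    using has_laplacian_imp_eq[OF has_laplacian_scale[OF lf(1), of c]]
      cfun.subspace_scale[OF subspace_hom_polys lf(2)]
    by (auto simp: harmonic_hom_polys_def)
  assume g: "g \<in> harmonic_hom_polys d"
  then have lg: "has_laplacian g (\<lambda>x. 0)" "g \<in> hom_polys d"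
    using harmonic_hom_polysD by blast+
  show "f + g \<in> harmonic_hom_polys d"
    using has_laplacian_imp_eq[OF has_laplacian_add[OF lf(1) lg(1)]]
      cfun.subspace_add[OF subspace_hom_polys lf(2) lg(2)]
    by (auto simp: harmonic_hom_polys_def plus_fun_def)
qed

lemma harmonic_hom_polys_rotate:
  fixes T :: "real^'n::finite \<Rightarrow> real^'n"
  assumes "f \<in> harmonic_hom_polys d" "orthogonal_transformation T"
  shows "(\<lambda>x. f (T x)) \<in> harmonic_hom_polys d"
  using assms hom_polys_laplacian_rotate[of f d T] by (auto simp: harmonic_hom_polys_def)

section \<open>Zonal harmonics\<close>

definition householder :: "real^'n::finite \<Rightarrow> real^'n \<Rightarrow> real^'n" where
  "householder z x = x - (2 * (x \<bullet> z) / (z \<bullet> z)) *\<^sub>R z"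

lemma orthogonal_transformation_householder: "orthogonal_transformation (householder z)"
  unfolding orthogonal_transformation_def
proof (intro conjI allI)
  show "linear (householder z)"
    by (rule linearI)
      (simp_all add: householder_def inner_add_left algebra_simps add_divide_distrib)
  fix v w
  show "householder z v \<bullet> householder z w = v \<bullet> w"
  proof (cases "z = 0")
    case False
    define a where "a = 2 * (v \<bullet> z) / (z \<bullet> z)"
    define b where "b = 2 * (w \<bullet> z) / (z \<bullet> z)"
    have "a * (z \<bullet> z) = 2 * (v \<bullet> z)" "b * (z \<bullet> z) = 2 * (z \<bullet> w)"
      using False by (simp_all add: a_def b_def inner_commute)
    moreover have "householder z v \<bullet> householder z w =
        v \<bullet> w - b * (v \<bullet> z) - a * (z \<bullet> w) + a * (b * (z \<bullet> z))"
      unfolding householder_def a_def[symmetric] b_def[symmetric]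
      by (simp add: inner_diff_left inner_diff_right algebra_simps)
    moreover have "b * (a * (z \<bullet> z)) = a * (b * (z \<bullet> z))" by simp
    ultimately show ?thesis by simp
  qed (simp add: householder_def)
qed

lemma householder_fixes: "x \<bullet> z = 0 \<Longrightarrow> householder z x = x"
  by (simp add: householder_def)

text \<open>For vectors of equal length
  \<open>(x - y) \<bullet> (x - y) = 2 * (x \<bullet> (x - y))\<close>, so the reflection along
  \<open>x - y\<close> subtracts exactly \<open>x - y\<close>. This is the transitivity of rotations
  on spheres; for \<open>x = y\<close> the map is the identity.\<close>

lemma householder_swap:
  assumes "norm x = norm y"
  shows "householder (x - y) x = y"
proof (cases "x = y")
  case False
  have eq: "x \<bullet> x = y \<bullet> y" using assms by (simp add: norm_eq_sqrt_inner)
  have "(x - y) \<bullet> (x - y) = 2 * (x \<bullet> (x - y))"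
    using eq by (simp add: inner_diff_left inner_diff_right inner_commute)
  moreover have "(x - y) \<bullet> (x - y) \<noteq> 0" using False by simp
  ultimately have "2 * (x \<bullet> (x - y)) / ((x - y) \<bullet> (x - y)) = 1" by (metis divide_self)
  then show ?thesis unfolding householder_def by (simp only: scaleR_one) simp
qed (simp add: householder_def)

text \<open>The homogeneous counterpart of the factor \<open>1 - t^2\<close> in the Legendre
  polynomials, with which it agrees on the sphere for \<open>t = x $ i\<close>.\<close>

definition rest_sq :: "'n::finite \<Rightarrow> real^'n \<Rightarrow> real" where
  "rest_sq i x = (\<Sum>j\<in>UNIV - {i}. (x $ j)\<^sup>2)"

lemma rest_sq_nonneg: "rest_sq i x \<ge> 0"
  by (simp add: rest_sq_def sum_nonneg)

lemma norm_sq_rest_sq: "(norm x)\<^sup>2 = (x $ i)\<^sup>2 + rest_sq i x"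
  unfolding norm_squares rest_sq_def by (rule sum.remove) auto

lemma rest_sq_eq_norm: "rest_sq i x = (norm (x - (x $ i) *\<^sub>R axis i 1))\<^sup>2"
proof -
  have "(\<Sum>j\<in>UNIV. ((x - (x $ i) *\<^sub>R axis i 1) $ j)\<^sup>2) =
      ((x - (x $ i) *\<^sub>R axis i 1) $ i)\<^sup>2 + (\<Sum>j\<in>UNIV - {i}. ((x - (x $ i) *\<^sub>R axis i 1) $ j)\<^sup>2)"
    by (rule sum.remove) auto
  also have "\<dots> = rest_sq i x"
    by (auto simp: rest_sq_def axis_def intro!: sum.cong)
  finally show ?thesis by (simp add: norm_squares)
qed

section \<open>Functions invariant under the stabilizer of an axis\<close>

lemma exists_other_index:
  fixes i :: "'n::finite"
  assumes "CARD('n) \<ge> 2"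
  shows "\<exists>j. j \<noteq> i"
proof -
  have "\<not> UNIV \<subseteq> {i}"
    using assms card_mono[of "{i}" UNIV] by auto
  then show ?thesis by blast
qed

lemma zonal_at_plane:
  fixes f :: "real^'n::finite \<Rightarrow> complex"
  assumes inv: "\<forall>T. orthogonal_transformation T \<longrightarrow> T (axis i 1) = axis i 1 \<longrightarrow> (\<forall>x. f (T x) = f x)"
    and j: "j \<noteq> i" and r: "r\<^sup>2 = rest_sq i x"
  shows "f x = f ((x $ i) *\<^sub>R axis i 1 + r *\<^sub>R axis j 1)"
proof -
  let ?e = "axis i 1 :: real^'n" and ?u = "axis j 1 :: real^'n"
  let ?v = "x - (x $ i) *\<^sub>R ?e"
  let ?T = "householder (?v - r *\<^sub>R ?u)"
  have lin: "linear ?T"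
    using orthogonal_transformation_householder by (rule orthogonal_transformation_linear)
  have "sqrt (r\<^sup>2) = sqrt ((norm ?v)\<^sup>2)"
    using r unfolding rest_sq_eq_norm by simp
  then have "norm ?v = norm (r *\<^sub>R ?u)"
    by (simp only: real_sqrt_abs abs_norm_cancel norm_scaleR norm_axis_1 mult_1_right)
  then have 1: "?T ?v = r *\<^sub>R ?u" by (rule householder_swap)
  have e: "?T ?e = ?e"
    by (rule householder_fixes) (use j in \<open>simp add: inner_axis', simp add: axis_def\<close>)
  have "?T x = ?T ((x $ i) *\<^sub>R ?e + ?v)" by simp
  also have "\<dots> = (x $ i) *\<^sub>R ?e + r *\<^sub>R ?u"
    unfolding linear_add[OF lin] linear_scale[OF lin] 1 e by simp
  finally show ?thesis
    using inv[rule_format, OF orthogonal_transformation_householder e, of x] by simp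
qed

lemma hom_polys_on_plane:
  fixes f :: "real^'n::finite \<Rightarrow> complex"
  assumes "f \<in> hom_polys k"
  shows "\<exists>c. \<forall>a r. f (a *\<^sub>R v + r *\<^sub>R w) = (\<Sum>m\<le>k. c m * of_real (a ^ (k - m) * r ^ m))"
proof -
  let ?V = "{f :: real^'n \<Rightarrow> complex. \<exists>c. \<forall>a r. f (a *\<^sub>R v + r *\<^sub>R w) = (\<Sum>m\<le>k. c m * of_real (a ^ (k - m) * r ^ m))}"
  have "cfun.span (range (\<lambda>y x. of_real (y \<bullet> x) ^ k)) \<subseteq> ?V"
  proof (rule cfun.span_minimal)
    show "cfun.subspace ?V"
    proof (rule cfun.subspaceI)
      show "0 \<in> ?V" by (auto intro!: exI[of _ "\<lambda>_. 0"])
      show "f + g \<in> ?V" if fg: "f \<in> ?V" "g \<in> ?V" for f g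
      proof -
        obtain c d where "\<forall>a r. f (a *\<^sub>R v + r *\<^sub>R w) = (\<Sum>m\<le>k. c m * of_real (a ^ (k - m) * r ^ m))"
          "\<forall>a r. g (a *\<^sub>R v + r *\<^sub>R w) = (\<Sum>m\<le>k. d m * of_real (a ^ (k - m) * r ^ m))"
          using fg by blast
        then show ?thesis
          by (auto simp: sum.distrib algebra_simps intro!: exI[of _ "\<lambda>m. c m + d m"])
      qed
      show "(\<lambda>x. b * f x) \<in> ?V" if f: "f \<in> ?V" for b f
      proof -
        obtain c where "\<forall>a r. f (a *\<^sub>R v + r *\<^sub>R w) = (\<Sum>m\<le>k. c m * of_real (a ^ (k - m) * r ^ m))"
          using f by blast
        then show ?thesis
          by (auto simp: sum_distrib_left mult.assoc intro!: exI[of _ "\<lambda>m. b * c m"])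
      qed
    qed
    show "range (\<lambda>y x. of_real (y \<bullet> x) ^ k) \<subseteq> ?V"
    proof (rule image_subsetI)
      fix y :: "real^'n"
      have power_eq: "complex_of_real (y \<bullet> (a *\<^sub>R v + r *\<^sub>R w)) ^ k =
          (\<Sum>m\<le>k. of_real (real (k choose m) * (y \<bullet> w) ^ m * (y \<bullet> v) ^ (k - m)) * of_real (a ^ (k - m) * r ^ m))"
        for a r
      proof -
        have "(y \<bullet> (a *\<^sub>R v + r *\<^sub>R w)) ^ k = (r * (y \<bullet> w) + a * (y \<bullet> v)) ^ k"
          by (simp add: inner_add_right add.commute)
        also have "\<dots> = (\<Sum>m\<le>k. of_nat (k choose m) * (r * (y \<bullet> w)) ^ m * (a * (y \<bullet> v)) ^ (k - m))"
          by (rule binomial_ring)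
        also have "\<dots> = (\<Sum>m\<le>k. (real (k choose m) * (y \<bullet> w) ^ m * (y \<bullet> v) ^ (k - m)) * (a ^ (k - m) * r ^ m))"
          by (intro sum.cong refl) (simp add: power_mult_distrib)
        finally show ?thesis by (simp only: of_real_power[symmetric] of_real_mult[symmetric] of_real_sum)
      qed
      show "(\<lambda>x. of_real (y \<bullet> x) ^ k) \<in> ?V"
        unfolding mem_Collect_eq
        by (rule exI[of _ "\<lambda>m. of_real (real (k choose m) * (y \<bullet> w) ^ m * (y \<bullet> v) ^ (k - m))"])
          (intro allI power_eq)
    qed
  qed
  then show ?thesis using assms unfolding hom_polys_eq_span_powers[symmetric] by blast
qed

lemma sum_even_indices:
  fixes k :: nat
  shows "(\<Sum>m\<le>k. if even m then g m else 0) = (\<Sum>j\<le>k div 2. g (2 * j) :: 'b::comm_monoid_add)"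
proof -
  have "(\<Sum>m\<le>k. if even m then g m else 0) = (\<Sum>m\<in>{m. m \<le> k \<and> even m}. g m)"
    by (subst sum.inter_filter[symmetric]) (auto intro!: sum.cong finite_atMost)
  also have "\<dots> = (\<Sum>j\<le>k div 2. g (2 * j))"
    by (rule sum.reindex_bij_witness[of _ "\<lambda>j. 2 * j" "\<lambda>m. m div 2"]) auto
  finally show ?thesis .
qed

text \<open>On the plane of two axes \<open>f\<close> is a form in two coordinates. Averaging its
  values at \<open>r\<close> and \<open>-r\<close> cancels the odd powers of \<open>r\<close>, and
  the even ones are powers of \<open>rest_sq\<close>.\<close>

lemma zonal_expansion:
  fixes f :: "real^'n::finite \<Rightarrow> complex"
  assumes n: "CARD('n) \<ge> 2" and f: "f \<in> hom_polys k"
    and inv: "\<forall>T. orthogonal_transformation T \<longrightarrow> T (axis i 1) = axis i 1 \<longrightarrow> (\<forall>x. f (T x) = f x)"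
  shows "\<exists>c. \<forall>x. f x = (\<Sum>j\<le>k div 2. c j * of_real ((x $ i) ^ (k - 2 * j) * rest_sq i x ^ j))"
proof -
  obtain j where j: "j \<noteq> i" using exists_other_index[OF n] by blast
  obtain c where c: "\<And>a r. f (a *\<^sub>R axis i 1 + r *\<^sub>R axis j 1) = (\<Sum>m\<le>k. c m * of_real (a ^ (k - m) * r ^ m))"
    using hom_polys_on_plane[OF f] by blast
  have "f x = (\<Sum>j\<le>k div 2. c (2 * j) * of_real ((x $ i) ^ (k - 2 * j) * rest_sq i x ^ j))" for x
  proof -
    let ?a = "x $ i" and ?r = "sqrt (rest_sq i x)"
    have r2: "?r\<^sup>2 = rest_sq i x" "(- ?r)\<^sup>2 = rest_sq i x" using rest_sq_nonneg[of i x] by simp_all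
    have "f x = (f x + f x) / 2" by simp
    also have "\<dots> = ((\<Sum>m\<le>k. c m * of_real (?a ^ (k - m) * ?r ^ m)) +
        (\<Sum>m\<le>k. c m * of_real (?a ^ (k - m) * (- ?r) ^ m))) / 2"
      using zonal_at_plane[OF inv j r2(1)] zonal_at_plane[OF inv j r2(2)]
      unfolding c by simp
    also have "\<dots> = (\<Sum>m\<le>k. if even m then c m * of_real (?a ^ (k - m) * ?r ^ m) else 0)"
      unfolding sum.distrib[symmetric] sum_divide_distrib
      by (intro sum.cong) (auto simp: power_minus_odd)
    also have "\<dots> = (\<Sum>j\<le>k div 2. c (2 * j) * of_real (?a ^ (k - 2 * j) * ?r ^ (2 * j)))"
      by (rule sum_even_indices)
    also have "\<dots> = (\<Sum>j\<le>k div 2. c (2 * j) * of_real ((x $ i) ^ (k - 2 * j) * rest_sq i x ^ j))"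
      unfolding power_mult r2 by simp
    finally show ?thesis .
  qed
  then show ?thesis by (intro exI[of _ "\<lambda>j. c (2 * j)"]) blast
qed

section \<open>The Laplace equation for zonal functions\<close>

lemma rest_sq_axis:
  "rest_sq i (x + t *\<^sub>R axis j 1) = (if j = i then rest_sq i x else rest_sq i x + 2 * t * (x $ j) + t\<^sup>2)"
proof (cases "j = i")
  case True
  then show ?thesis by (auto simp: rest_sq_def axis_def intro!: sum.cong)
next
  case False
  have "rest_sq i y = (y $ j)\<^sup>2 + (\<Sum>k\<in>UNIV - {i} - {j}. (y $ k)\<^sup>2)" for y :: "real^'a"
    unfolding rest_sq_def by (rule sum.remove) (use False in auto)
  moreover have "(\<Sum>k\<in>UNIV - {i} - {j}. ((x + t *\<^sub>R axis j 1) $ k)\<^sup>2) = (\<Sum>k\<in>UNIV - {i} - {j}. (x $ k)\<^sup>2)"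
    by (intro sum.cong) (auto simp: axis_def)
  ultimately show ?thesis
    using False by (simp add: axis_def power2_sum algebra_simps)
qed

text \<open>In \<open>CARD('n) - 1\<close> variables the Laplacian sends the power \<open>m\<close>
  of the squared length to \<open>2m (2m + CARD('n) - 3)\<close> times the power
  \<open>m - 1\<close>; the axis contributes a plain second derivative. Truncated exponents occur
  only with coefficient zero.\<close>

lemma has_laplacian_zonal_monomial:
  fixes i :: "'n::finite"
  shows "has_laplacian (\<lambda>x. of_real ((x $ i) ^ a * rest_sq i x ^ m))
    (\<lambda>x. of_real ((real a * real (a - 1)) * (x $ i) ^ (a - 2) * rest_sq i x ^ m +
       real (2 * m) * (real (2 * m) + real CARD('n) - 3) * (x $ i) ^ a * rest_sq i x ^ (m - 1)))"
proof (rule has_laplacianI)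
  fix j and x :: "real^'n"
  let ?f1 = "\<lambda>j x. if j = i then real a * (x $ i) ^ (a - 1) * rest_sq i x ^ m
    else real (2 * m) * (x $ j) * (x $ i) ^ a * rest_sq i x ^ (m - 1)"
  let ?f2 = "\<lambda>j x. if j = i then (real a * real (a - 1)) * (x $ i) ^ (a - 2) * rest_sq i x ^ m
    else (x $ i) ^ a * (real (2 * m) * rest_sq i x ^ (m - 1) +
      (4 * real m * real (m - 1)) * (x $ j)\<^sup>2 * rest_sq i x ^ (m - 2))"
  have ax: "(x + t *\<^sub>R axis j 1) $ k = x $ k + (if k = j then t else 0)" for t k
    by (simp add: axis_def)
  have "((\<lambda>t. ((x + t *\<^sub>R axis j 1) $ i) ^ a * rest_sq i (x + t *\<^sub>R axis j 1) ^ m)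
      has_real_derivative ?f1 j x) (at 0)"
    unfolding ax rest_sq_axis
    by (cases "j = i") (auto intro!: derivative_eq_intros)
  from has_vector_derivative_of_real[OF this]
  show "((\<lambda>t. of_real (((x + t *\<^sub>R axis j 1) $ i) ^ a * rest_sq i (x + t *\<^sub>R axis j 1) ^ m) :: complex)
      has_vector_derivative of_real (?f1 j x)) (at 0)" .
  have "((\<lambda>t. ?f1 j (x + t *\<^sub>R axis j 1)) has_real_derivative ?f2 j x) (at 0)"
    unfolding ax rest_sq_axis
    by (cases "j = i")
      (auto intro!: derivative_eq_intros simp: numeral_2_eq_2 mult_ac distrib_left)
  from has_vector_derivative_of_real[OF this]
  show "((\<lambda>t. of_real (?f1 j (x + t *\<^sub>R axis j 1)) :: complex)
      has_vector_derivative of_real (?f2 j x)) (at 0)" .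
next
  fix x :: "real^'n"
  let ?f2 = "\<lambda>j x. if j = i then (real a * real (a - 1)) * (x $ i) ^ (a - 2) * rest_sq i x ^ m
    else (x $ i) ^ a * (real (2 * m) * rest_sq i x ^ (m - 1) +
      (4 * real m * real (m - 1)) * (x $ j)\<^sup>2 * rest_sq i x ^ (m - 2))"
  have card: "real (card (UNIV - {i})) = real CARD('n) - 1"
    by (simp add: card_Diff_singleton of_nat_diff Suc_le_eq)
  \<comment> \<open>For \<open>m < 2\<close> the exponent \<open>m - 2\<close> is truncated, but
    then both sides have a factor zero.\<close>
  have m: "(4 * real m * real (m - 1)) * (rest_sq i x * rest_sq i x ^ (m - 2)) =
      real (2 * m) * (real (2 * m) - 2) * rest_sq i x ^ (m - 1)"
  proof (cases "m \<ge> 2")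
    case True
    then have "rest_sq i x * rest_sq i x ^ (m - 2) = rest_sq i x ^ (m - 1)"
      by (simp flip: power_Suc add: Suc_diff_Suc numeral_2_eq_2)
    then show ?thesis using True by (simp add: of_nat_diff algebra_simps)
  next
    case False
    then consider "m = 0" | "m = 1" by linarith
    then show ?thesis by cases simp_all
  qed
  have "(\<Sum>j\<in>UNIV. ?f2 j x) = ?f2 i x + (\<Sum>j\<in>UNIV - {i}. ?f2 j x)"
    by (rule sum.remove) auto
  also have "(\<Sum>j\<in>UNIV - {i}. ?f2 j x) =
      (\<Sum>j\<in>UNIV - {i}. (x $ i) ^ a * (real (2 * m) * rest_sq i x ^ (m - 1) +
        (4 * real m * real (m - 1)) * (x $ j)\<^sup>2 * rest_sq i x ^ (m - 2)))"
    by (intro sum.cong) auto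
  also have "\<dots> = (x $ i) ^ a * (real (card (UNIV - {i})) * real (2 * m) * rest_sq i x ^ (m - 1) +
      (4 * real m * real (m - 1)) * (rest_sq i x * rest_sq i x ^ (m - 2)))"
    unfolding rest_sq_def[of i x] sum_distrib_left[symmetric] sum.distrib
    by (simp add: sum_distrib_left sum_distrib_right mult_ac)
  also have "\<dots> = real (2 * m) * (real (2 * m) + real CARD('n) - 3) * (x $ i) ^ a * rest_sq i x ^ (m - 1)"
    unfolding m card by (simp add: algebra_simps)
  finally have "(\<Sum>j\<in>UNIV. ?f2 j x) = (real a * real (a - 1)) * (x $ i) ^ (a - 2) * rest_sq i x ^ m +
       real (2 * m) * (real (2 * m) + real CARD('n) - 3) * (x $ i) ^ a * rest_sq i x ^ (m - 1)"
    by simp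
  then show "of_real ((real a * real (a - 1)) * (x $ i) ^ (a - 2) * rest_sq i x ^ m +
       real (2 * m) * (real (2 * m) + real CARD('n) - 3) * (x $ i) ^ a * rest_sq i x ^ (m - 1)) =
     (\<Sum>j\<in>UNIV. complex_of_real (?f2 j x))"
    by (simp only: of_real_sum[symmetric])
qed

text \<open>Collected by powers of \<open>rest_sq\<close>: the second derivative along the axis of
  term \<open>j\<close> meets the transversal part of term \<open>j + 1\<close>. The vanishing of
  each bracket will be the recursion of the Legendre coefficients.\<close>

lemma has_laplacian_zonal:
  fixes i :: "'n::finite" and c :: "nat \<Rightarrow> complex"
  shows "has_laplacian (\<lambda>x. \<Sum>j\<le>k div 2. c j * of_real ((x $ i) ^ (k - 2 * j) * rest_sq i x ^ j))
    (\<lambda>x. \<Sum>j<k div 2. (c j * of_real ((real (k - 2 * j) * real (k - 2 * j - 1))) +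
        c (Suc j) * of_real (real (2 * Suc j) * (real (2 * j) + real CARD('n) - 1))) *
      of_real ((x $ i) ^ (k - 2 * j - 2) * rest_sq i x ^ j))" (is "has_laplacian ?f ?g")
proof -
  let ?N = "k div 2"
  define A where "A = (\<lambda>j x. c j * complex_of_real ((real (k - 2 * j) * real (k - 2 * j - 1)) *
    (x $ i) ^ (k - 2 * j - 2) * rest_sq i x ^ j))"
  define B where "B = (\<lambda>j x. c j * complex_of_real (real (2 * j) * (real (2 * j) + real CARD('n) - 3) *
    (x $ i) ^ (k - 2 * j) * rest_sq i x ^ (j - 1)))"
  have "has_laplacian ?f (\<lambda>x. \<Sum>j\<le>?N. A j x + B j x)"
    using has_laplacian_scale[OF has_laplacian_zonal_monomial]
    unfolding A_def B_def distrib_left[symmetric] of_real_add[symmetric]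
    by (intro has_laplacian_sum) blast
  moreover have "(\<lambda>x. \<Sum>j\<le>?N. A j x + B j x) = ?g"
  proof
    fix x
    \<comment> \<open>The last exponent of \<open>x $ i\<close> is 0 or 1, so its second derivative
      vanishes.\<close>
    have "A ?N x = 0"
    proof -
      have "k - 2 * (k div 2) = 0 \<or> k - 2 * (k div 2) = 1" by linarith
      then show ?thesis unfolding A_def by fastforce
    qed
    then have "(\<Sum>j\<le>?N. A j x) = (\<Sum>j<?N. A j x)"
      by (simp add: lessThan_Suc_atMost[symmetric])
    moreover have "(\<Sum>j\<le>?N. B j x) = B 0 x + (\<Sum>j<?N. B (Suc j) x)"
      by (rule sum.atMost_shift)
    moreover have "B 0 x = 0" by (simp add: B_def)
    moreover have AB: "A j x + B (Suc j) x = (c j * of_real ((real (k - 2 * j) * real (k - 2 * j - 1))) +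
        c (Suc j) * of_real (real (2 * Suc j) * (real (2 * j) + real CARD('n) - 1))) *
      of_real ((x $ i) ^ (k - 2 * j - 2) * rest_sq i x ^ j)" if "j < ?N" for j
    proof -
      have "k - 2 * Suc j = k - 2 * j - 2" "real (2 * Suc j) + real CARD('n) - 3 = real (2 * j) + real CARD('n) - 1"
        by simp_all
      then show ?thesis
        unfolding A_def B_def by (simp only: diff_Suc_1 of_real_mult) (simp only: ring_distribs mult_ac)
    qed
    ultimately have "(\<Sum>j\<le>?N. A j x + B j x) = (\<Sum>j<?N. A j x + B (Suc j) x)"
      by (simp only: sum.distrib add_0)
    also have "\<dots> = ?g x"
      by (intro sum.cong refl) (use AB in simp)
    finally show "(\<Sum>j\<le>?N. A j x + B j x) = ?g x" .
  qed
  ultimately show ?thesis by (simp only:)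
qed

lemma legendre_coeff_0: "n \<ge> 2 \<Longrightarrow> legendre_coeff n k 0 = 1"
  using Gamma_real_pos[of "(real n - 1) / 2", THEN less_imp_neq] by (auto simp: legendre_coeff_def)

text \<open>With \<open>z = j + (n - 1) / 2\<close> the factor \<open>2 j + n - 1\<close> is
  \<open>2 z\<close>, and it is supplied by \<open>Gamma (z + 1) = z * Gamma z\<close>. This makes
  the brackets in \<open>has_laplacian_zonal\<close> vanish.\<close>

lemma legendre_coeff_Suc:
  assumes n: "n \<ge> 2" and j: "2 * Suc j \<le> k"
  shows "legendre_coeff n k (Suc j) * (real (2 * Suc j) * (real (2 * j) + real n - 1)) =
    - legendre_coeff n k j * (real (k - 2 * j) * real (k - 2 * j - 1))"
proof -
  define z where "z = real j + (real n - 1) / 2"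
  have z: "z > 0" using n unfolding z_def by (intro add_nonneg_pos divide_pos_pos) auto
  then have "z \<notin> \<int>\<^sub>\<le>\<^sub>0" by (auto elim!: nonpos_Ints_cases)
  then have "Gamma (real (Suc j) + (real n - 1) / 2) = z * Gamma z"
    using Gamma_plus1[of z] by (simp add: z_def algebra_simps)
  moreover have "fact (k - 2 * j) = (real (k - 2 * j) * real (k - 2 * j - 1)) * fact (k - 2 * Suc j)"
  proof -
    obtain l where "k = 2 * Suc j + l" using j by (rule less_eqE)
    then have "k - 2 * j = Suc (Suc l)" by simp
    moreover then have "k - 2 * Suc j = l" by simp
    ultimately show ?thesis by (simp add: algebra_simps)
  qed
  moreover have "Gamma z \<noteq> 0" "real (2 * j) + real n - 1 = 2 * z"
    using Gamma_real_pos[OF z] by (auto simp: z_def)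
  moreover have "(real (k - 2 * j) * real (k - 2 * j - 1)) \<noteq> 0" using j by simp
  ultimately show ?thesis
    using z unfolding legendre_coeff_def z_def[symmetric]
    by (simp add: divide_simps del: of_nat_mult of_nat_Suc) (simp add: algebra_simps)
qed

text \<open>The homogeneous extension of the Legendre polynomial from the sphere to the whole
  space.\<close>

definition zonal :: "'n::finite \<Rightarrow> nat \<Rightarrow> real^'n \<Rightarrow> complex" where
  "zonal i k x = (\<Sum>j\<le>k div 2. of_real (legendre_coeff CARD('n) k j) *
     of_real ((x $ i) ^ (k - 2 * j) * rest_sq i x ^ j))"

lemma zonal_on_sphere:
  fixes x :: "real^'n::finite"
  assumes "norm x = 1"
  shows "zonal i k x = of_real (legendre CARD('n) k (x $ i))"
proof -
  have "rest_sq i x = 1 - (x $ i)\<^sup>2" using norm_sq_rest_sq[of x i] assms by simp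
  then show ?thesis
    unfolding zonal_def legendre_def by (simp only: of_real_mult[symmetric] of_real_sum mult.assoc)
qed

lemma zonal_harmonic:
  fixes i :: "'n::finite"
  assumes n: "CARD('n) \<ge> 2"
  shows "zonal i k \<in> harmonic_hom_polys k"
proof (rule harmonic_hom_polysI)
  have rest: "(\<lambda>x. of_real (rest_sq i x ^ j)) \<in> hom_polys (2 * j)" for j
  proof (induction j)
    case (Suc j)
    then show ?case
      using hom_polys_mult_squares[OF Suc.IH, of "UNIV - {i}"]
      unfolding rest_sq_def[symmetric] of_real_mult[symmetric] by simp
  qed (auto simp: hom_polys_0)
  have hom: "(\<lambda>x. of_real ((x $ i) ^ a * rest_sq i x ^ j)) \<in> hom_polys (a + 2 * j)" for a j
  proof (induction a)
    case (Suc a)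
    then show ?case
      using hom_polys_mult_coord[OF Suc.IH, of i] by (simp add: mult.assoc)
  qed (use rest in simp)
  then have "(\<lambda>x. of_real ((x $ i) ^ (k - 2 * j) * rest_sq i x ^ j)) \<in> hom_polys k" if "j \<le> k div 2" for j
  proof -
    have "k - 2 * j + 2 * j = k" using that by linarith
    then show ?thesis using hom[of "k - 2 * j" j] by simp
  qed
  then show "zonal i k \<in> hom_polys k"
    using hom_polys_sum[of "{..k div 2}" "\<lambda>j x. of_real ((x $ i) ^ (k - 2 * j) * rest_sq i x ^ j)" k
      "\<lambda>j. of_real (legendre_coeff CARD('n) k j)"]
    unfolding zonal_def[abs_def] by auto
  have "of_real (legendre_coeff CARD('n) k j) * complex_of_real ((real (k - 2 * j) * real (k - 2 * j - 1))) +
      of_real (legendre_coeff CARD('n) k (Suc j)) *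
        of_real (real (2 * Suc j) * (real (2 * j) + real CARD('n) - 1)) = 0" if "j < k div 2" for j
    unfolding of_real_mult[symmetric, where 'a = complex] using legendre_coeff_Suc[OF n, of j k] that by simp
  then show "has_laplacian (zonal i k) (\<lambda>x. 0)"
    using has_laplacian_zonal[where k = k and c = "\<lambda>j. of_real (legendre_coeff CARD('n) k j)" and i = i]
    unfolding zonal_def[abs_def] by simp
qed

text \<open>Harmonicity makes every bracket of \<open>has_laplacian_zonal\<close> zero, and the
  resulting recursion determines all coefficients from the first one. That one is read off at the
  pole, where \<open>zonal\<close> is 1.\<close>

lemma zonal_unique:
  fixes f :: "real^'n::finite \<Rightarrow> complex"
  assumes n: "CARD('n) \<ge> 2" and f: "f \<in> harmonic_hom_polys k"
    and inv: "\<forall>T. orthogonal_transformation T \<longrightarrow> T (axis i 1) = axis i 1 \<longrightarrow> (\<forall>x. f (T x) = f x)"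
  shows "f x = f (axis i 1) * zonal i k x"
proof -
  obtain c where c: "\<And>x. f x = (\<Sum>j\<le>k div 2. c j * of_real ((x $ i) ^ (k - 2 * j) * rest_sq i x ^ j))"
    using zonal_expansion[OF n harmonic_hom_polysD(2)[OF f] inv] by blast
  then have f_eq: "f = (\<lambda>x. \<Sum>j\<le>k div 2. c j * of_real ((x $ i) ^ (k - 2 * j) * rest_sq i x ^ j))"
    by blast
  obtain j0 where j0: "j0 \<noteq> i" using exists_other_index[OF n] by blast
  define d where "d = (\<lambda>j. c j * of_real ((real (k - 2 * j) * real (k - 2 * j - 1))) +
    c (Suc j) * of_real (real (2 * Suc j) * (real (2 * j) + real CARD('n) - 1)))"
  have lap: "(\<Sum>j<k div 2. d j * of_real ((x $ i) ^ (k - 2 * j - 2) * rest_sq i x ^ j)) = 0" for x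
    using has_laplacian_imp_eq[OF has_laplacian_zonal[where k = k and c = c and i = i]] harmonic_hom_polysD(1)[OF f]
    unfolding f_eq d_def by (metis (no_types, lifting) has_laplacian_imp_eq)
  have d0: "d j = 0" if j: "j < k div 2" for j
  proof -
    obtain N where N: "k div 2 = Suc N" using j by (metis less_imp_Suc_add)
    \<comment> \<open>The points \<open>e_i + sqrt s * e_j0\<close> have axial coordinate 1 and
      \<open>rest_sq = s\<close>, so the Laplacian becomes a polynomial in \<open>s\<close> that
      vanishes for all \<open>s > 0\<close>. With the zero subspace of
      \<open>unit \<Rightarrow> complex\<close>, \<open>coefficients_in_subspace\<close> says that
      its coefficients vanish.\<close>
    have sub: "cfun.subspace {0 :: unit \<Rightarrow> complex}" by (rule cfun.subspace_single_0)
    have "(\<lambda>_. d j) \<in> {0 :: unit \<Rightarrow> complex}"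
    proof (rule coefficients_in_subspace[OF sub, where N = N and v = "\<lambda>j _. d j"])
      show "j \<le> N" using j N by simp
      fix s :: real assume s: "s > 0"
      let ?x = "axis i 1 + sqrt s *\<^sub>R axis j0 1 :: real^'n"
      have "axis j0 1 $ i = (0::real)" "axis i 1 $ j0 = (0::real)" "rest_sq i (axis i 1) = 0"
        using j0 by (auto simp: axis_def rest_sq_def intro!: sum.neutral)
      then have 1: "?x $ i = 1" and 2: "rest_sq i ?x = s"
        using j0 s unfolding rest_sq_axis by simp_all
      then show "(\<lambda>_. \<Sum>j\<le>N. of_real s ^ j * d j) \<in> {0 :: unit \<Rightarrow> complex}"
        using lap[of ?x] unfolding N lessThan_Suc_atMost 1 2 by (simp add: fun_eq_iff mult.commute)
    qed
    then show ?thesis by (simp add: fun_eq_iff)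
  qed
  have cj: "c j = c 0 * of_real (legendre_coeff CARD('n) k j)" if "j \<le> k div 2" for j
    using that
  proof (induction j)
    case 0
    then show ?case using legendre_coeff_0[OF n] by simp
  next
    case (Suc j)
    define p where "p = real (2 * Suc j) * (real (2 * j) + real CARD('n) - 1)"
    have "p > 0" unfolding p_def using n by (intro mult_pos_pos) auto
    then have p: "complex_of_real p \<noteq> 0" by simp
    have "c (Suc j) * of_real p = - c j * of_real ((real (k - 2 * j) * real (k - 2 * j - 1)))"
      using d0[of j] Suc.prems unfolding d_def p_def by (simp add: add_eq_0_iff)
    also have "\<dots> = c 0 * of_real (- legendre_coeff CARD('n) k j * (real (k - 2 * j) * real (k - 2 * j - 1)))"
      using Suc by simp
    also have "- legendre_coeff CARD('n) k j * (real (k - 2 * j) * real (k - 2 * j - 1)) =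
        legendre_coeff CARD('n) k (Suc j) * p"
      unfolding p_def using legendre_coeff_Suc[OF n, of j k] Suc.prems by simp
    finally show ?case using p by simp
  qed
  have f_zonal: "f x = c 0 * zonal i k x" for x
    unfolding c zonal_def sum_distrib_left by (intro sum.cong refl, subst cj) simp_all
  have "zonal i k (axis i 1) = 1"
  proof -
    have "rest_sq i (axis i 1) = 0" by (auto simp: rest_sq_def axis_def intro!: sum.neutral)
    then have "zonal i k (axis i 1) = (\<Sum>j\<le>k div 2. if j = 0 then 1 else 0)"
      unfolding zonal_def using legendre_coeff_0[OF n] by (intro sum.cong) (auto simp: power_0_left)
    then show ?thesis by simp
  qed
  then show ?thesis using f_zonal by simp
qed

section \<open>Spherical harmonics\<close>

lemma sphere_restr_add: "sphere_restr (f + g) = sphere_restr f + sphere_restr g"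
  by (auto simp: sphere_restr_def)

lemma sphere_restr_scale: "sphere_restr (\<lambda>x. c * f x) = (\<lambda>x. c * sphere_restr f x)"
  by (auto simp: sphere_restr_def)

lemma sphere_restr_0: "sphere_restr 0 = 0"
  by (auto simp: sphere_restr_def)

lemma sphere_restr_apply: "norm x = 1 \<Longrightarrow> sphere_restr f x = f x"
  by (simp add: sphere_restr_def)

lemma sphere_restr_csphere: "continuous_on (sphere 0 1) f \<Longrightarrow> sphere_restr f \<in> csphere"
  unfolding csphere_def sphere_restr_def by (auto intro: continuous_on_eq)

lemma subspace_sphere_restr_image:
  fixes V :: "(real^'n::finite \<Rightarrow> complex) set"
  assumes V: "cfun.subspace V"
  shows "cfun.subspace (sphere_restr ` V)"
proof (rule cfun.subspaceI)
  show "0 \<in> sphere_restr ` V"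
    using cfun.subspace_0[OF V] sphere_restr_0 by (metis image_eqI)
  show "f + g \<in> sphere_restr ` V" if "f \<in> sphere_restr ` V" "g \<in> sphere_restr ` V" for f g
    using that cfun.subspace_add[OF V] by (auto simp flip: sphere_restr_add)
  show "(\<lambda>x. c * f x) \<in> sphere_restr ` V" if "f \<in> sphere_restr ` V" for c f
    using that cfun.subspace_scale[OF V, of _ c] by (auto simp flip: sphere_restr_scale)
qed

lemma subspace_sphere_restr_vimage:
  fixes V :: "(real^'n::finite \<Rightarrow> complex) set"
  assumes V: "cfun.subspace V"
  shows "cfun.subspace {f. sphere_restr f \<in> V}"
  by (rule cfun.subspaceI)
    (auto simp: sphere_restr_0 sphere_restr_add sphere_restr_scale
      intro: cfun.subspace_0[OF V] cfun.subspace_add[OF V] cfun.subspace_scale[OF V])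

lemma subspace_Hd_sphere: "cfun.subspace (Hd_sphere k :: (real^'n::finite \<Rightarrow> complex) set)"
  unfolding Hd_sphere_def by (rule subspace_sphere_restr_image[OF subspace_harmonic_hom_polys])

lemma subspace_Pd_sphere: "cfun.subspace (Pd_sphere k :: (real^'n::finite \<Rightarrow> complex) set)"
  unfolding Pd_sphere_def by (rule subspace_sphere_restr_image[OF subspace_hom_polys])

lemma subspace_Ple_sphere: "cfun.subspace (Ple_sphere k :: (real^'n::finite \<Rightarrow> complex) set)"
  unfolding Ple_sphere_def polys_le_eq_span
  by (rule subspace_sphere_restr_image[OF cfun.subspace_span])

lemma Pd_sphere_subset_csphere: "Pd_sphere k \<subseteq> csphere"
  unfolding Pd_sphere_def by (auto intro: sphere_restr_csphere continuous_on_hom_polys)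

lemma Hd_sphere_subset_Pd_sphere: "Hd_sphere k \<subseteq> Pd_sphere k"
  unfolding Hd_sphere_def Pd_sphere_def harmonic_hom_polys_def by auto

lemma Hd_sphere_csphere: "f \<in> Hd_sphere k \<Longrightarrow> f \<in> csphere"
  using Pd_sphere_subset_csphere Hd_sphere_subset_Pd_sphere by blast

lemma Hd_sphere_rotate:
  fixes T :: "real^'n::finite \<Rightarrow> real^'n"
  assumes f: "f \<in> Hd_sphere k" and T: "orthogonal_transformation T"
  shows "(\<lambda>x. f (T x)) \<in> Hd_sphere k"
proof -
  obtain p where p: "p \<in> harmonic_hom_polys k" "f = sphere_restr p"
    using f unfolding Hd_sphere_def by auto
  have "norm (T x) = norm x" for x
    using T by (simp add: orthogonal_transformation)
  then have "(\<lambda>x. f (T x)) = sphere_restr (\<lambda>x. p (T x))"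
    unfolding p by (auto simp: sphere_restr_def)
  then show ?thesis
    using harmonic_hom_polys_rotate[OF p(1) T] unfolding Hd_sphere_def by simp
qed

text \<open>Uniqueness was shown for polynomials on the whole space; homogeneity extends the
  invariance from the sphere along rays.\<close>

lemma Hd_sphere_zonal_unique:
  fixes f :: "real^'n::finite \<Rightarrow> complex"
  assumes n: "CARD('n) \<ge> 2" and f: "f \<in> Hd_sphere k"
    and inv: "\<And>T x. orthogonal_transformation T \<Longrightarrow> T (axis i 1) = axis i 1 \<Longrightarrow> norm x = 1 \<Longrightarrow> f (T x) = f x"
    and x: "norm x = 1"
  shows "f x = f (axis i 1) * of_real (legendre CARD('n) k (x $ i))"
proof -
  obtain p where p: "p \<in> harmonic_hom_polys k" "f = sphere_restr p"
    using f unfolding Hd_sphere_def by auto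
  have "p (T y) = p y" if T: "orthogonal_transformation T" "T (axis i 1) = axis i 1" for T y
  proof (cases "y = 0")
    case True
    then show ?thesis
      using linear_0[OF orthogonal_transformation_linear[OF T(1)]] by simp
  next
    case False
    have nT: "norm (T y) = norm y" for y
      using T(1) by (simp add: orthogonal_transformation)
    have y: "y = norm y *\<^sub>R sgn y" using False by (simp add: sgn_div_norm)
    have s: "norm (sgn y) = 1" using False by (simp add: norm_sgn)
    have Ty: "T y = norm y *\<^sub>R T (sgn y)"
      using y linear_scale[OF orthogonal_transformation_linear[OF T(1)]] by metis
    have "p (T y) = of_real (norm y) ^ k * p (T (sgn y))"
      unfolding Ty by (rule hom_polys_scaleR[OF harmonic_hom_polysD(2)[OF p(1)]])
    also have "p (T (sgn y)) = p (sgn y)"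
      using inv[OF T s] s unfolding p by (simp add: sphere_restr_apply nT)
    also have "of_real (norm y) ^ k * p (sgn y) = p (norm y *\<^sub>R sgn y)"
      by (rule hom_polys_scaleR[OF harmonic_hom_polysD(2)[OF p(1)], symmetric])
    finally show ?thesis using y by simp
  qed
  then have "p x = p (axis i 1) * zonal i k x"
    by (intro zonal_unique[OF n p(1)]) blast
  then show ?thesis
    using x unfolding p by (simp add: sphere_restr_apply zonal_on_sphere)
qed

section \<open>Orthonormal bases and kernels of the spaces of harmonics\<close>

lemma exists_orthonormal_basis:
  assumes V: "cfun.subspace V" "V \<subseteq> csphere" and F: "finite F" "V \<subseteq> cfun.span F"
  shows "\<exists>B. orthonormal B \<and> cfun.span B = V"
proof -
  obtain A where A: "A \<subseteq> V" "cfun.independent A" "V \<subseteq> cfun.span A"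
    using cfun.basis_exists[of V] by metis
  have "finite A"
    using cfun.independent_span_bound[OF F(1) A(2)] A(1) F(2) by auto
  moreover have "cfun.span A = V"
    using A cfun.span_minimal[OF A(1) V(1)] by auto
  ultimately show ?thesis
    using gram_schmidt[of A] A(1) V(2) by auto
qed

definition harm_basis :: "nat \<Rightarrow> (real^'n::finite \<Rightarrow> complex) set" where
  "harm_basis k = (SOME B. orthonormal B \<and> cfun.span B = Hd_sphere k)"

lemma harm_basis:
  "orthonormal (harm_basis k :: (real^'n::finite \<Rightarrow> complex) set)"
  "cfun.span (harm_basis k :: (real^'n \<Rightarrow> complex) set) = Hd_sphere k"
proof -
  let ?m = "monomial_fun ` {\<alpha>. sum \<alpha> UNIV = k} :: (real^'n \<Rightarrow> complex) set"
  let ?F = "sphere_restr ` ?m"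
  have "hom_polys k \<subseteq> {f :: real^'n \<Rightarrow> complex. sphere_restr f \<in> cfun.span ?F}"
    by (intro hom_polys_subset subspace_sphere_restr_vimage cfun.subspace_span)
      (auto intro: cfun.span_base)
  then have "(Hd_sphere k :: (real^'n \<Rightarrow> complex) set) \<subseteq> cfun.span ?F"
    unfolding Hd_sphere_def harmonic_hom_polys_def by auto
  then have "\<exists>B :: (real^'n \<Rightarrow> complex) set. orthonormal B \<and> cfun.span B = Hd_sphere k"
    by (intro exists_orthonormal_basis[of _ ?F] subspace_Hd_sphere)
      (auto simp: finite_multi_indices_eq intro: Hd_sphere_csphere)
  from someI_ex[OF this]
  show "orthonormal (harm_basis k :: (real^'n \<Rightarrow> complex) set)"
    "cfun.span (harm_basis k :: (real^'n \<Rightarrow> complex) set) = Hd_sphere k"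
    unfolding harm_basis_def by auto
qed

lemma harm_basis_csphere: "f \<in> harm_basis k \<Longrightarrow> f \<in> csphere"
  by (rule orthonormalD(3)[OF harm_basis(1)])

lemma Hd_sphere_expansion:
  assumes "f \<in> Hd_sphere k"
  obtains u where "f = (\<lambda>x. \<Sum>h\<in>harm_basis k. u h * h x)"
proof -
  have "f \<in> cfun.span (harm_basis k)" using assms by (simp only: harm_basis(2))
  from cspan_finite_repr[OF orthonormalD(1)[OF harm_basis(1)] this]
  obtain u where "\<And>x. f x = (\<Sum>h\<in>harm_basis k. u h * h x)" by blast
  then show thesis by (intro that ext)
qed

lemma card_harm_basis:
  "card (harm_basis k :: (real^'n::finite \<Rightarrow> complex) set) = N_dim TYPE('n) k"
  unfolding N_dim_def harm_basis(2)[symmetric] by (rule orthonormal_card_eq_dim[OF harm_basis(1)])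

lemma axis_sphere: "norm (axis i 1 :: real^'n::finite) = 1"
  by simp

lemma legendre_1: "n \<ge> 2 \<Longrightarrow> legendre n k 1 = 1"
proof -
  assume n: "n \<ge> 2"
  have "legendre n k 1 = (\<Sum>j\<le>k div 2. if j = 0 then legendre_coeff n k 0 else 0)"
    unfolding legendre_def by (intro sum.cong) (auto simp: power_0_left)
  then show ?thesis using legendre_coeff_0[OF n] by simp
qed

text \<open>The zonal harmonic has the value 1 at its pole, so no space of harmonics is zero. This
  permits division by the dimension.\<close>

lemma N_dim_pos:
  assumes n: "CARD('n::finite) \<ge> 2"
  shows "N_dim TYPE('n) k > 0"
proof (rule ccontr)
  assume "\<not> ?thesis"
  then have "(harm_basis k :: (real^'n \<Rightarrow> complex) set) = {}"
    using card_harm_basis[of k, where 'n = 'n] orthonormalD(1)[OF harm_basis(1)[of k, where 'n = 'n]] by simp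
  then have "(Hd_sphere k :: (real^'n \<Rightarrow> complex) set) = {0}"
    using harm_basis(2)[of k, where 'n = 'n] by simp
  moreover have "sphere_restr (zonal (undefined :: 'n) k) \<in> Hd_sphere k"
    using zonal_harmonic[OF n] unfolding Hd_sphere_def by blast
  ultimately have "sphere_restr (zonal (undefined :: 'n) k) (axis undefined 1) = 0"
    by auto
  then show False
    using zonal_on_sphere[OF axis_sphere, of "undefined :: 'n" k] legendre_1[OF n]
    by (simp add: sphere_restr_apply)
qed

lemma householder_swap':
  assumes "norm x = norm y"
  shows "householder (x - y) y = x"
proof -
  have "householder (- z) y = householder z y" for z
    by (simp add: householder_def)
  from this[of "y - x"] have "householder (x - y) y = householder (y - x) y"
    by simp
  then show ?thesis using householder_swap[of y x] assms by simp
qed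

text \<open>Invariance and the uniqueness of zonal harmonics give a multiple of the Legendre
  polynomial. The factor is the diagonal value, which is constant by transitivity; its integral is
  the sum of the squared norms of the basis functions, that is, the dimension.\<close>

lemma rep_kernel_harm_basis:
  fixes x t :: "real^'n::finite"
  assumes n: "CARD('n) \<ge> 2" and x: "norm x = 1" and t: "norm t = 1"
  shows "rep_kernel (harm_basis k) x t = of_real (real (N_dim TYPE('n) k) * legendre CARD('n) k (x \<bullet> t))"
proof -
  let ?Z = "rep_kernel (harm_basis k) :: real^'n \<Rightarrow> real^'n \<Rightarrow> complex"
  define e where "e = (axis undefined 1 :: real^'n)"
  have e: "norm e = 1" by (simp add: e_def)
  have inv: "?Z (T x) (T t) = ?Z x t" if "orthogonal_transformation T" for T x t
    by (rule rep_kernel_rotation_invariant[OF harm_basis(1) that])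
      (use Hd_sphere_rotate in \<open>auto simp: harm_basis(2)\<close>)
  have diag: "?Z y y = ?Z e e" if y: "norm y = 1" for y
  proof -
    have "householder (y - e) y = e" by (rule householder_swap) (use y e in simp)
    then show ?thesis
      using inv[OF orthogonal_transformation_householder, of "y - e" y y] by simp
  qed
  have "?Z e e = (LINT y|(sphere_measure :: (real^'n) measure). ?Z e e)"
    by (rule integral_sphere_const[symmetric])
  also have "\<dots> = (LINT y|sphere_measure. ?Z y y)"
    by (rule Bochner_Integration.integral_cong) (use diag in \<open>auto simp: space_sphere_measure\<close>)
  also have "\<dots> = (\<Sum>f\<in>(harm_basis k :: (real^'n \<Rightarrow> complex) set). ip f f)"
    unfolding rep_kernel_def ip_def
    by (rule Bochner_Integration.integral_sum) (intro integrable_ip harm_basis_csphere)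
  also have "\<dots> = of_real (real (N_dim TYPE('n) k))"
    using orthonormalD(5)[OF harm_basis(1)[of k, where 'n = 'n]] card_harm_basis[of k, where 'n = 'n] by simp
  finally have Zee: "?Z e e = of_real (real (N_dim TYPE('n) k))" .
  have zonal: "?Z y e = ?Z e e * of_real (legendre CARD('n) k (y \<bullet> e))" if y: "norm y = 1" for y
  proof -
    have "(\<lambda>y. ?Z y e) \<in> Hd_sphere k"
      using rep_kernel_span[of "harm_basis k" e] by (simp add: harm_basis(2))
    then have "?Z y e = ?Z (axis undefined 1) e * of_real (legendre CARD('n) k (y $ undefined))"
      by (rule Hd_sphere_zonal_unique[OF n _ _ y]) (use inv in \<open>metis e_def\<close>)
    then show ?thesis by (simp add: e_def inner_axis)
  qed
  \<comment> \<open>Moves \<open>t\<close> to the pole \<open>e\<close>, where the zonal formula is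
    available.\<close>
  let ?T = "householder (t - e)"
  have T: "orthogonal_transformation ?T" by (rule orthogonal_transformation_householder)
  have Tt: "?T t = e" by (rule householder_swap) (use t e in simp)
  have "?T x \<bullet> e = x \<bullet> t"
    using T Tt unfolding orthogonal_transformation_def by metis
  moreover have "norm (?T x) = 1"
    using T x by (simp add: orthogonal_transformation)
  ultimately show ?thesis
    using zonal[of "?T x"] inv[OF T, of x t] Zee Tt by simp
qed

subsection \<open>Expansions in Legendre polynomials\<close>

text \<open>Expanding \<open>(1 - t^2)^j\<close> contributes the sign \<open>(-1)^j\<close> to the
  top power, which cancels the sign of \<open>legendre_coeff\<close>. So all contributions to the
  leading coefficient are positive, and the degree is exactly \<open>k\<close>.\<close>

lemma legendre_powers:
  assumes n: "n \<ge> 2"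
  shows "\<exists>c. c 0 > 0 \<and> (\<forall>t. legendre n k t = (\<Sum>i\<le>k div 2. c i * t ^ (k - 2 * i)))"
proof -
  define c where "c = (\<lambda>i. \<Sum>j\<le>k div 2. legendre_coeff n k j * (real (j choose i) * (-1) ^ (j - i)))"
  have "legendre n k t = (\<Sum>i\<le>k div 2. c i * t ^ (k - 2 * i))" for t
  proof -
    have "t ^ (k - 2 * j) * (1 - t\<^sup>2) ^ j =
        (\<Sum>i\<le>k div 2. real (j choose i) * (-1) ^ (j - i) * t ^ (k - 2 * i))" if j: "j \<le> k div 2" for j
    proof -
      have "(1 - t\<^sup>2) ^ j = (\<Sum>i\<le>j. of_nat (j choose i) * 1 ^ i * (- (t\<^sup>2)) ^ (j - i))"
        using binomial_ring[of 1 "- (t\<^sup>2)" j] by simp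
      then have "t ^ (k - 2 * j) * (1 - t\<^sup>2) ^ j =
          (\<Sum>i\<le>j. real (j choose i) * (-1) ^ (j - i) * (t ^ (k - 2 * j) * t ^ (2 * (j - i))))"
        by (simp add: sum_distrib_left power_minus[of "t\<^sup>2"] mult_ac flip: power_mult)
      also have "\<dots> = (\<Sum>i\<le>j. real (j choose i) * (-1) ^ (j - i) * t ^ (k - 2 * i))"
      proof (intro sum.cong refl)
        fix i assume "i \<in> {..j}"
        then have "k - 2 * j + 2 * (j - i) = k - 2 * i" using j by auto
        then show "real (j choose i) * (-1) ^ (j - i) * (t ^ (k - 2 * j) * t ^ (2 * (j - i))) =
            real (j choose i) * (-1) ^ (j - i) * t ^ (k - 2 * i)"
          by (simp flip: power_add)
      qed
      also have "\<dots> = (\<Sum>i\<le>k div 2. real (j choose i) * (-1) ^ (j - i) * t ^ (k - 2 * i))"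
        by (rule sum.mono_neutral_left) (use j in \<open>auto simp: binomial_eq_0\<close>)
      finally show ?thesis .
    qed
    then have "legendre n k t = (\<Sum>j\<le>k div 2. legendre_coeff n k j *
        (\<Sum>i\<le>k div 2. real (j choose i) * (-1) ^ (j - i) * t ^ (k - 2 * i)))"
      unfolding legendre_def by (intro sum.cong) (auto simp: mult.assoc)
    also have "\<dots> = (\<Sum>i\<le>k div 2. c i * t ^ (k - 2 * i))"
      unfolding c_def sum_distrib_left sum_distrib_right
      by (subst sum.swap) (simp add: mult.assoc)
    finally show ?thesis .
  qed
  moreover have "c 0 > 0"
  proof -
    have pos: "legendre_coeff n k j * (real (j choose 0) * (-1) ^ (j - 0)) > 0" for j
    proof -
      have "(real n - 1) / 2 > 0" "real j + (real n - 1) / 2 > 0"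
        using n by (auto intro!: add_nonneg_pos)
      then have "Gamma ((real n - 1) / 2) > 0" "Gamma (real j + (real n - 1) / 2) > 0"
        by (auto intro: Gamma_real_pos)
      moreover have "(-1) ^ j * (-1) ^ j = (1 :: real)"
        by (simp flip: power_mult_distrib)
      ultimately show ?thesis
        unfolding legendre_coeff_def by (auto simp: zero_less_mult_iff mult_ac intro!: divide_pos_pos)
    qed
    then show ?thesis unfolding c_def by (intro sum_pos) auto
  qed
  ultimately show ?thesis by blast
qed

text \<open>Triangular inversion of \<open>legendre_powers\<close> by strong induction. Keeping the
  parity matters: in homogeneous polynomials of degree \<open>d\<close> only harmonics of degrees
  \<open>d - 2 * i\<close> may occur.\<close>

lemma power_legendre:
  assumes n: "n \<ge> 2"
  shows "\<exists>a. \<forall>t. t ^ k = (\<Sum>i\<le>k div 2. a i * legendre n (k - 2 * i) t)"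
proof (induction k rule: less_induct)
  case (less k)
  obtain c where c0: "c 0 > 0" and c: "\<And>t. legendre n k t = (\<Sum>i\<le>k div 2. c i * t ^ (k - 2 * i))"
    using legendre_powers[OF n] by blast
  let ?V = "{f :: real \<Rightarrow> real. \<exists>a. \<forall>t. f t = (\<Sum>i\<le>k div 2. a i * legendre n (k - 2 * i) t)}"
  have V_sum: "(\<lambda>t. \<Sum>j\<in>A. b j * F j t) \<in> ?V" if "\<And>j. j \<in> A \<Longrightarrow> F j \<in> ?V" for A b and F :: "nat \<Rightarrow> real \<Rightarrow> real"
  proof -
    have "\<forall>j\<in>A. \<exists>a. \<forall>t. F j t = (\<Sum>i\<le>k div 2. a i * legendre n (k - 2 * i) t)"
      using that by blast
    then obtain a where "\<forall>j\<in>A. \<forall>t. F j t = (\<Sum>i\<le>k div 2. a j i * legendre n (k - 2 * i) t)"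
      by (rule bchoice[THEN exE])
    then have "(\<Sum>j\<in>A. b j * F j t) = (\<Sum>i\<le>k div 2. (\<Sum>j\<in>A. b j * a j i) * legendre n (k - 2 * i) t)" for t
      unfolding sum_distrib_right by (subst sum.swap) (simp add: sum_distrib_left mult.assoc)
    then show ?thesis by (intro CollectI exI allI)
  qed
  have L: "legendre n k \<in> ?V"
    by (intro CollectI exI[of _ "\<lambda>i. if i = 0 then 1 else 0"]) (simp add: if_distrib[of "\<lambda>c. c * _"] cong: if_cong)
  have P: "(\<lambda>t. t ^ (k - 2 * i)) \<in> ?V" if i: "0 < i" "i \<le> k div 2" for i
  proof -
    have "k - 2 * i < k" using i by linarith
    then obtain a where a: "\<And>t. t ^ (k - 2 * i) = (\<Sum>j\<le>(k - 2 * i) div 2. a j * legendre n (k - 2 * i - 2 * j) t)"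
      using less.IH by blast
    have "(\<Sum>j\<le>(k - 2 * i) div 2. a j * legendre n (k - 2 * i - 2 * j) t) =
        (\<Sum>l\<le>k div 2. (if l \<ge> i then a (l - i) else 0) * legendre n (k - 2 * l) t)" for t
    proof -
      have "(\<Sum>l\<le>k div 2. (if l \<ge> i then a (l - i) else 0) * legendre n (k - 2 * l) t) =
          (\<Sum>l\<in>{i..k div 2}. a (l - i) * legendre n (k - 2 * l) t)"
        by (rule sum.mono_neutral_cong_right) auto
      also have "\<dots> = (\<Sum>j\<le>(k - 2 * i) div 2. a j * legendre n (k - 2 * i - 2 * j) t)"
        by (rule sum.reindex_bij_witness[of _ "\<lambda>j. j + i" "\<lambda>l. l - i"])
          (use i in \<open>auto simp: algebra_simps\<close>)
      finally show ?thesis by simp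
    qed
    then show ?thesis using a by auto
  qed
  have "(\<Sum>i\<le>k div 2. c i * t ^ (k - 2 * i)) = c 0 * t ^ k + (\<Sum>i\<in>{1..k div 2}. c i * t ^ (k - 2 * i))" for t
    by (simp add: atMost_atLeast0 sum.atLeast_Suc_atMost)
  \<comment> \<open>Solving for \<open>t ^ k\<close> is written as a two-term combination, so that
    the closure property \<open>V_sum\<close> covers this step too.\<close>
  then have "t ^ k = (\<Sum>j\<in>{0, 1}. (if j = 0 then 1 / c 0 else - 1 / c 0) *
      (if j = (0::nat) then legendre n k t else (\<Sum>i\<in>{1..k div 2}. c i * t ^ (k - 2 * i))))" for t
    using c[of t] c0 by (simp add: field_simps)
  moreover have "(\<lambda>t. \<Sum>j\<in>{0, 1}. (if j = 0 then 1 / c 0 else - 1 / c 0) *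
      (if j = (0::nat) then legendre n k t else (\<Sum>i\<in>{1..k div 2}. c i * t ^ (k - 2 * i)))) \<in> ?V"
    by (rule V_sum) (use L V_sum[of "{1..k div 2}" "\<lambda>i t. t ^ (k - 2 * i)" c] P in auto)
  ultimately show ?case by auto
qed

lemma poly_legendre:
  assumes n: "n \<ge> 2"
  shows "\<exists>a. \<forall>t. poly p t = (\<Sum>j\<le>degree p. a j * legendre n j t)"
proof -
  have "\<exists>a. \<forall>t. t ^ k = (\<Sum>j\<le>degree p. a j * legendre n j t)" if k: "k \<le> degree p" for k
  proof -
    obtain a where a: "\<And>t. t ^ k = (\<Sum>i\<le>k div 2. a i * legendre n (k - 2 * i) t)"
      using power_legendre[OF n] by blast
    have "(\<Sum>i\<le>k div 2. a i * legendre n (k - 2 * i) t) =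
        (\<Sum>j\<le>degree p. (if j \<le> k \<and> even (k - j) then a ((k - j) div 2) else 0) * legendre n j t)" for t
    proof -
      have "(\<Sum>j\<le>degree p. (if j \<le> k \<and> even (k - j) then a ((k - j) div 2) else 0) * legendre n j t) =
          (\<Sum>j\<in>{j. j \<le> k \<and> even (k - j)}. a ((k - j) div 2) * legendre n j t)"
        by (rule sum.mono_neutral_cong_right) (use k in auto)
      also have "\<dots> = (\<Sum>i\<le>k div 2. a i * legendre n (k - 2 * i) t)"
        by (rule sum.reindex_bij_witness[of _ "\<lambda>i. k - 2 * i" "\<lambda>j. (k - j) div 2"]) auto
      finally show ?thesis by simp
    qed
    then show ?thesis using a by auto
  qed
  then obtain a where a: "\<And>k t. k \<le> degree p \<Longrightarrow> t ^ k = (\<Sum>j\<le>degree p. a k j * legendre n j t)"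
    by metis
  have "poly p t = (\<Sum>j\<le>degree p. (\<Sum>k\<le>degree p. coeff p k * a k j) * legendre n j t)" for t
  proof -
    have "poly p t = (\<Sum>k\<le>degree p. coeff p k * (\<Sum>j\<le>degree p. a k j * legendre n j t))"
      unfolding poly_altdef by (intro sum.cong refl) (simp add: a)
    also have "\<dots> = (\<Sum>j\<le>degree p. (\<Sum>k\<le>degree p. coeff p k * a k j) * legendre n j t)"
      unfolding sum_distrib_left sum_distrib_right by (subst sum.swap) (simp add: mult.assoc)
    finally show ?thesis .
  qed
  then show ?thesis by (intro exI allI)
qed

text \<open>The leading coefficients are nonzero, so the difference is a nonzero polynomial and has
  finitely many roots.\<close>

lemma legendre_distinct:
  assumes n: "n \<ge> 2" and jk: "j < k" and eq: "\<And>s. \<bar>s\<bar> \<le> 1 \<Longrightarrow> legendre n j s = legendre n k s"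
  shows False
proof -
  have "\<exists>p. degree p \<le> k \<and> coeff p k \<noteq> 0 \<and> (\<forall>t. poly p t = legendre n k t)" for k
  proof -
    obtain c where c0: "c 0 > 0" and c: "\<And>t. legendre n k t = (\<Sum>i\<le>k div 2. c i * t ^ (k - 2 * i))"
      using legendre_powers[OF n] by blast
    let ?p = "\<Sum>i\<le>k div 2. monom (c i) (k - 2 * i)"
    have "degree ?p \<le> k"
      by (intro degree_sum_le) (auto intro: order_trans[OF degree_monom_le])
    moreover have "coeff ?p k = (\<Sum>i\<le>k div 2. if i = 0 then c 0 else 0)"
      unfolding coeff_sum by (intro sum.cong) (auto simp: coeff_monom)
    then have "coeff ?p k \<noteq> 0" using c0 by simp
    moreover have "poly ?p t = legendre n k t" for t
      by (simp add: c poly_sum poly_monom)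
    ultimately show ?thesis by blast
  qed
  then obtain p q where p: "degree p \<le> j" "\<And>t. poly p t = legendre n j t"
    and q: "degree q \<le> k" "coeff q k \<noteq> 0" "\<And>t. poly q t = legendre n k t"
    by metis
  have "coeff (q - p) k \<noteq> 0" using q p(1) jk by (simp add: coeff_eq_0)
  then have "q - p \<noteq> 0" by auto
  then have "finite {t. poly (q - p) t = 0}" by (rule poly_roots_finite)
  moreover have "{-1..1} \<subseteq> {t. poly (q - p) t = 0}"
    using eq by (auto simp: p q abs_le_iff)
  ultimately have "finite {-1..1::real}" by (rule rev_finite_subset)
  then show False by (simp add: infinite_Icc)
qed

subsection \<open>Orthogonality\<close>

lemma orthonormal_coeffs_zero:
  assumes B: "orthonormal B" and 0: "\<And>x. x \<in> sphere 0 1 \<Longrightarrow> (\<Sum>f\<in>B. u f * f x) = 0" and h: "h \<in> B"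
  shows "u h = 0"
proof -
  have "0 = ip (\<lambda>x. \<Sum>f\<in>B. u f * f x) h"
    unfolding ip_def
    by (subst Bochner_Integration.integral_cong[OF refl, of _ _ "\<lambda>_. 0"]) (simp_all add: 0 space_sphere_measure)
  also have "\<dots> = (\<Sum>f\<in>B. u f * ip f h)"
    by (rule ip_sum_left) (use orthonormalD[OF B] h in auto)
  also have "\<dots> = (\<Sum>f\<in>B. if f = h then u f else 0)"
    by (rule sum.cong) (use orthonormalD(5)[OF B _ h] in auto)
  finally show ?thesis using h orthonormalD(1)[OF B] by simp
qed

lemma exists_sphere_coord:
  assumes n: "CARD('n::finite) \<ge> 2" and s: "\<bar>s\<bar> \<le> 1"
  shows "\<exists>x :: real^'n. norm x = 1 \<and> x $ i = s"
proof -
  obtain j where j: "j \<noteq> i" using exists_other_index[OF n] by blast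
  let ?x = "s *\<^sub>R axis i 1 + sqrt (1 - s\<^sup>2) *\<^sub>R axis j 1 :: real^'n"
  have s2: "s\<^sup>2 \<le> 1" using s by (simp add: abs_square_le_1)
  have "(norm ?x)\<^sup>2 = 1"
    using j s2 by (simp add: power2_norm_eq_inner inner_add_left inner_add_right inner_axis_axis)
      (simp add: power2_eq_square[symmetric])
  then have "norm ?x = 1" by (simp add: power2_eq_1_iff) (smt (verit) norm_ge_zero)
  moreover have "?x $ i = s" using j by (simp add: axis_def)
  ultimately show ?thesis by blast
qed

text \<open>The convolution of the kernels of \<open>\<H>\<^sub>j\<close> and \<open>\<H>\<^sub>k\<close> is rotation invariant, hence a
  multiple of both Legendre polynomials.\<close>

lemma Hd_sphere_orthogonal:
  fixes f g :: "real^'n::finite \<Rightarrow> complex"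
  assumes n: "CARD('n) \<ge> 2" and jk: "j \<noteq> k" and f: "f \<in> Hd_sphere j" and g: "g \<in> Hd_sphere k"
  shows "ip f g = 0"
proof -
  let ?Bj = "harm_basis j :: (real^'n \<Rightarrow> complex) set" and ?Bk = "harm_basis k :: (real^'n \<Rightarrow> complex) set"
  define Z where "Z = (\<lambda>k (y::real^'n) x. rep_kernel (harm_basis k) x y :: complex)"
  \<comment> \<open>As a function of \<open>x\<close> this lies in \<open>Hd_sphere j\<close>, as a
    function of \<open>y\<close> in \<open>Hd_sphere k\<close> up to conjugation.\<close>
  define G where "G = (\<lambda>j k (x::real^'n) (y::real^'n). ip (Z k y) (Z j x))"
  define e where "e = (axis undefined 1 :: real^'n)"
  have e: "norm e = 1" by (simp add: e_def)
  have Zc: "Z k y \<in> csphere" for k and y :: "real^'n"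
    using rep_kernel_span[of "harm_basis k" y] harm_basis(2)[of k] Hd_sphere_csphere unfolding Z_def by blast
  have Zinv: "Z k (T y) (T x) = Z k y x" if "orthogonal_transformation T" for k T and x y :: "real^'n"
    unfolding Z_def by (rule rep_kernel_rotation_invariant[OF harm_basis(1) that])
      (use Hd_sphere_rotate in \<open>auto simp: harm_basis(2)\<close>)
  have G_eq: "G j k x y = (\<Sum>f\<in>harm_basis j. ip (Z k y) f * f x)" for j k x y
  proof -
    have "Z j x = (\<lambda>t. \<Sum>f\<in>harm_basis j. cnj (f x) * f t)"
      by (simp add: Z_def rep_kernel_def fun_eq_iff mult.commute)
    then have "G j k x y = (\<Sum>f\<in>harm_basis j. cnj (cnj (f x)) * ip (Z k y) f)"
      unfolding G_def by (simp only:) (rule ip_sum_right, use harm_basis_csphere Zc in auto)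
    then show ?thesis by (simp add: mult.commute)
  qed
  have G_mem: "(\<lambda>x. G j k x y) \<in> Hd_sphere j" for j k y
    unfolding G_eq using cspan_sum_mem[of "\<lambda>f. ip (Z k y) f" "harm_basis j"] by (simp add: harm_basis(2))
  have G_cnj: "G j k x y = cnj (G k j y x)" for j k x y
    unfolding G_def by (rule ip_cnj)
  have G_inv: "G j k (T x) (T y) = G j k x y" if T: "orthogonal_transformation T" for j k T x y
  proof -
    have "G j k (T x) (T y) = (LINT t|sphere_measure. Z k (T y) t * cnj (Z j (T x) t))"
      by (simp add: G_def ip_def)
    also have "\<dots> = (LINT t|sphere_measure. Z k (T y) (T t) * cnj (Z j (T x) (T t)))"
      by (rule integral_sphere_orthogonal_transformation[OF T, symmetric])
        (intro continuous_intros csphere_continuous Zc)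
    also have "\<dots> = G j k x y" by (simp add: Zinv[OF T] G_def ip_def)
    finally show ?thesis .
  qed
  have G_zonal: "G j k x e = G j k e e * of_real (legendre CARD('n) j (x $ undefined))" if x: "norm x = 1" for j k x
    using Hd_sphere_zonal_unique[OF n G_mem[where y = e], of undefined j k x] x G_inv[where y = e]
    unfolding e_def by metis
  have G_swap: "G j k x e = G j k e x" if x: "norm x = 1" for j k x
  proof -
    have "norm x = norm e" using x e by simp
    then have "householder (x - e) x = e" "householder (x - e) e = x"
      by (rule householder_swap, rule householder_swap')
    then show ?thesis
      using G_inv[OF orthogonal_transformation_householder, of j k "x - e" x e] by simp
  qed
  \<comment> \<open>Swapping \<open>x\<close> and \<open>e\<close> by a reflection makes both
    descriptions of \<open>G\<close> apply to the same value, with the same factor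
    \<open>G j k e e\<close>.\<close>
  have two: "G j k e e * of_real (legendre CARD('n) j (x $ undefined)) =
      G j k e e * of_real (legendre CARD('n) k (x $ undefined))" if x: "norm x = 1" for x :: "real^'n"
  proof -
    have "G j k e x = cnj (G k j x e)" by (rule G_cnj)
    also have "\<dots> = G j k e e * of_real (legendre CARD('n) k (x $ undefined))"
      unfolding G_zonal[OF x] using G_cnj[of j k e e] by simp
    finally show ?thesis using G_zonal[OF x] G_swap[OF x] by metis
  qed
  \<comment> \<open>The coordinates of points of the sphere fill \<open>[-1, 1]\<close>, so a
    nonzero factor would make two distinct Legendre polynomials equal.\<close>
  have Gee: "G j k e e = 0"
  proof (rule ccontr)
    assume nz: "G j k e e \<noteq> 0"
    have "legendre CARD('n) j s = legendre CARD('n) k s" if s: "\<bar>s\<bar> \<le> 1" for s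
    proof -
      obtain x :: "real^'n" where x: "norm x = 1" "x $ undefined = s"
        using exists_sphere_coord[OF n s] by blast
      show ?thesis using two[OF x(1)] nz x(2) by simp
    qed
    then show False
      using legendre_distinct[OF n, of j k] legendre_distinct[OF n, of k j] jk by (metis linorder_neqE_nat)
  qed
  have G0: "G j k x y = 0" if x: "norm x = 1" and y: "norm y = 1" for x y
  proof -
    let ?T = "householder (y - e)"
    have T: "orthogonal_transformation ?T" by (rule orthogonal_transformation_householder)
    have "?T y = e" by (rule householder_swap) (use y e in simp)
    moreover have "norm (?T x) = 1" using T x by (simp add: orthogonal_transformation)
    ultimately show ?thesis using G_inv[OF T, of j k x y] G_zonal[of "?T x" j k] Gee by simp
  qed
  \<comment> \<open>Independence of an orthonormal system is used twice: first in the variable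
    \<open>x\<close> for the basis of degree \<open>j\<close>, then in \<open>y\<close> for the
    basis of degree \<open>k\<close>.\<close>
  have 1: "ip (Z k y) f = 0" if "f \<in> ?Bj" "norm y = 1" for f y
    by (rule orthonormal_coeffs_zero[OF harm_basis(1) _ that(1), where u = "ip (Z k y)"])
      (use G0 that(2) in \<open>simp add: G_eq\<close>)
  have 2: "ip f g = 0" if fg: "f \<in> ?Bj" "g \<in> ?Bk" for f g
  proof (rule orthonormal_coeffs_zero[OF harm_basis(1) _ fg(2), where u = "ip f"])
    fix y :: "real^'n" assume y: "y \<in> sphere 0 1"
    have "Z k y = (\<lambda>t. \<Sum>g\<in>?Bk. cnj (g y) * g t)"
      by (simp add: Z_def rep_kernel_def fun_eq_iff mult.commute)
    then have "ip f (Z k y) = (\<Sum>g\<in>?Bk. cnj (cnj (g y)) * ip f g)"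
      by (simp only:) (rule ip_sum_right, use harm_basis_csphere fg in auto)
    moreover have "ip f (Z k y) = 0"
      using 1[OF fg(1), of y] y ip_cnj[of f "Z k y"] by simp
    ultimately show "(\<Sum>g\<in>?Bk. ip f g * g y) = 0" by (simp add: mult.commute)
  qed
  obtain u where u: "f = (\<lambda>x. \<Sum>h\<in>?Bj. u h * h x)"
    using Hd_sphere_expansion[OF f] .
  obtain v where v: "g = (\<lambda>x. \<Sum>h\<in>?Bk. v h * h x)"
    using Hd_sphere_expansion[OF g] .
  have "ip f g = (\<Sum>h\<in>?Bj. u h * ip h g)"
    unfolding u by (intro ip_sum_left harm_basis_csphere Hd_sphere_csphere[OF g])
  also have "\<dots> = (\<Sum>h\<in>?Bj. u h * (\<Sum>h'\<in>?Bk. cnj (v h') * ip h h'))"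
  proof (intro sum.cong refl)
    fix h assume "h \<in> ?Bj"
    then have "ip h g = (\<Sum>h'\<in>?Bk. cnj (v h') * ip h h')"
      unfolding v by (intro ip_sum_right harm_basis_csphere)
    then show "u h * ip h g = u h * (\<Sum>h'\<in>?Bk. cnj (v h') * ip h h')" by simp
  qed
  also have "\<dots> = 0" using 2 by simp
  finally show ?thesis .
qed

section \<open>Upper bound\<close>

abbreviation sup_norm :: "(real^'n::finite \<Rightarrow> complex) \<Rightarrow> real" where
  "sup_norm f \<equiv> SUP x\<in>sphere 0 1. cmod (f x)"

lemma sup_norm_upper:
  assumes "f \<in> csphere" "norm x = 1"
  shows "cmod (f x) \<le> sup_norm f"
proof (rule cSUP_upper)
  have "bounded ((\<lambda>x. cmod (f x)) ` sphere 0 1)"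
    by (intro compact_imp_bounded compact_continuous_image continuous_intros csphere_continuous assms) simp
  then show "bdd_above ((\<lambda>x. cmod (f x)) ` sphere 0 1)" by (rule bounded_imp_bdd_above)
qed (use assms in simp)

lemma sup_norm_least:
  fixes f :: "real^'n::finite \<Rightarrow> complex"
  assumes "\<And>x. norm x = 1 \<Longrightarrow> cmod (f x) \<le> c"
  shows "sup_norm f \<le> c"
proof (rule cSUP_least)
  have "(axis undefined 1 :: real^'n) \<in> sphere 0 1" by simp
  then show "(sphere 0 1 :: (real^'n) set) \<noteq> {}" by blast
qed (use assms in simp)

lemma sup_norm_nonneg:
  fixes f :: "real^'n::finite \<Rightarrow> complex"
  assumes "f \<in> csphere"
  shows "sup_norm f \<ge> 0"
  using order_trans[OF norm_ge_zero sup_norm_upper[OF assms, of "axis undefined 1"]] by simp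

lemma sup_norm_eq_0_iff: "f \<in> csphere \<Longrightarrow> sup_norm f = 0 \<longleftrightarrow> f = 0" for f :: "real^'n::finite \<Rightarrow> complex"
proof
  assume f: "f \<in> csphere" and 0: "sup_norm f = 0"
  have "f x = 0" if "norm x = 1" for x
    using sup_norm_upper[OF f that] 0 by simp
  then show "f = 0" using f by (auto simp: csphere_def fun_eq_iff)
next
  assume f: "f \<in> csphere" and "f = 0"
  then have "sup_norm f \<le> 0" by (intro sup_norm_least) simp
  then show "sup_norm f = 0" using sup_norm_nonneg[OF f] by simp
qed

lemma sup_norm_triangle:
  assumes "f \<in> csphere" "g \<in> csphere"
  shows "sup_norm (f + g) \<le> sup_norm f + sup_norm g"
proof (rule sup_norm_least)
  fix x :: "real^'a" assume x: "norm x = 1"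
  have "cmod ((f + g) x) \<le> cmod (f x) + cmod (g x)" by (simp add: norm_triangle_ineq)
  then show "cmod ((f + g) x) \<le> sup_norm f + sup_norm g"
    using sup_norm_upper[OF assms(1) x] sup_norm_upper[OF assms(2) x] by linarith
qed

lemma sup_norm_scale:
  assumes f: "f \<in> csphere"
  shows "sup_norm (\<lambda>x. c * f x) = cmod c * sup_norm f"
proof -
  have le: "sup_norm (\<lambda>x. c * f x) \<le> cmod c * sup_norm f" if f: "f \<in> csphere" for c f
    by (rule sup_norm_least) (use sup_norm_upper[OF f] in \<open>simp add: norm_mult mult_left_mono\<close>)
  show ?thesis
  proof (cases "c = 0")
    case True
    have "(\<lambda>x. 0 :: complex) \<in> csphere" by (simp add: csphere_def)
    then have "sup_norm (\<lambda>x. 0) = 0" using sup_norm_eq_0_iff[of "\<lambda>x. 0"] by (simp add: zero_fun_def)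
    then show ?thesis using True by simp
  next
    case False
    have "(\<lambda>x. c * f x) \<in> csphere" by (rule cfun.subspace_scale[OF subspace_csphere f])
    from le[OF this, of "inverse c"] False
    have "sup_norm f \<le> cmod (inverse c) * sup_norm (\<lambda>x. c * f x)" by (simp flip: mult.assoc)
    then have "cmod c * sup_norm f \<le> sup_norm (\<lambda>x. c * f x)"
      using False by (simp add: norm_inverse pos_le_divide_eq divide_inverse_commute[symmetric] mult.commute)
    then show ?thesis using le[OF f, of c] by simp
  qed
qed

section \<open>Finite sums and tuples in a Banach space\<close>

context complex_banach
begin

sublocale complex_module Y
  by unfold_locales

lemma vnorm_zero: "vnorm Y \<zero> = 0"
  using vnorm_eq_0_iff[of \<zero>] by simp

text \<open>Obtained from the triangle inequality for \<open>x\<close> and \<open>-x\<close>, as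
  nonnegativity is not among the axioms of the locale.\<close>

lemma vnorm_nonneg: "x \<in> carrier Y \<Longrightarrow> vnorm Y x \<ge> 0"
  using vnorm_triangle[of x "(-1) \<odot> x"] vnorm_smult[of x "-1"]
  by (simp add: scal_minus_one r_neg vnorm_zero)

lemma finsum_scal:
  assumes "finite A" "\<And>a. a \<in> A \<Longrightarrow> w a \<in> carrier Y"
  shows "c \<odot> (\<Oplus>a\<in>A. w a) = (\<Oplus>a\<in>A. c \<odot> w a)"
  using assms
proof (induction A rule: finite_induct)
  case (insert a A)
  then show ?case by (simp add: Pi_def scal_add_right)
qed simp

lemma finsum_scal_right:
  assumes "finite A" "y \<in> carrier Y"
  shows "(\<Oplus>a\<in>A. c a \<odot> y) = (\<Sum>a\<in>A. c a) \<odot> y"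
  using assms
proof (induction A rule: finite_induct)
  case (insert a A)
  then show ?case by (simp add: Pi_def scal_add_left)
qed simp

lemma vnorm_finsum:
  assumes "finite A" "\<And>a. a \<in> A \<Longrightarrow> w a \<in> carrier Y"
  shows "vnorm Y (\<Oplus>a\<in>A. w a) \<le> (\<Sum>a\<in>A. vnorm Y (w a))"
  using assms
proof (induction A rule: finite_induct)
  case (insert a A)
  have "vnorm Y (w a \<oplus> (\<Oplus>a\<in>A. w a)) \<le> vnorm Y (w a) + vnorm Y (\<Oplus>a\<in>A. w a)"
    by (rule vnorm_triangle) (use insert in \<open>auto intro: finsum_closed\<close>)
  then show ?case using insert by (simp add: Pi_def)
qed (simp add: vnorm_zero)

text \<open>The tuples are indexed by a whole type, which makes the operations and equality plain
  pointwise ones. Later only the coordinates in the finite basis matter.\<close>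

definition fun_module :: "(complex, 'i \<Rightarrow> 'v) module" where
  "fun_module = \<lparr>carrier = {w. \<forall>b. w b \<in> carrier Y}, mult = undefined, one = undefined,
     zero = (\<lambda>_. \<zero>), add = (\<lambda>v w b. v b \<oplus> w b), smult = (\<lambda>c w b. c \<odot> w b)\<rparr>"

lemma complex_module_fun_module: "complex_module (fun_module :: (complex, 'i \<Rightarrow> 'v) module)"
proof (intro complex_module.intro moduleI)
  show "cring complex_ring" by (rule R.is_cring)
  show "abelian_group (fun_module :: (complex, 'i \<Rightarrow> 'v) module)"
  proof (rule abelian_groupI)
    fix x :: "'i \<Rightarrow> 'v" assume x: "x \<in> carrier fun_module"
    show "\<exists>y\<in>carrier fun_module. y \<oplus>\<^bsub>fun_module\<^esub> x = \<zero>\<^bsub>fun_module\<^esub>"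
      by (rule bexI[of _ "\<lambda>b. \<ominus> x b"]) (use x in \<open>auto simp: fun_module_def fun_eq_iff l_neg\<close>)
  qed (simp_all add: fun_module_def a_ac)
qed (simp_all add: fun_module_def complex_ring_def scal_add_left scal_add_right scal_scal)

text \<open>Makes the seminorm of the Hahn-Banach step integrable. The two norms differ by at most
  \<open>\<Sum>b\<in>B. cmod (b t - b s) * vnorm Y (w b)\<close>, which needs nothing but the
  triangle inequality in \<open>Y\<close>.\<close>

lemma continuous_on_vnorm_combination:
  fixes B :: "(real^'n::finite \<Rightarrow> complex) set"
  assumes B: "finite B" "\<And>b. b \<in> B \<Longrightarrow> continuous_on S b" and w: "\<And>b. b \<in> B \<Longrightarrow> w b \<in> carrier Y"
  shows "continuous_on S (\<lambda>t. vnorm Y (\<Oplus>b\<in>B. cnj (b t) \<odot> w b))"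
proof -
  let ?c = "\<lambda>t. \<Oplus>b\<in>B. cnj (b t) \<odot> w b"
  let ?d = "\<lambda>s t. \<Sum>b\<in>B. cmod (b t - b s) * vnorm Y (w b)"
  have closed: "(\<Oplus>b\<in>B. k b \<odot> w b) \<in> carrier Y" for k
    by (rule finsum_closed) (use w in auto)
  have le: "vnorm Y (?c t) \<le> vnorm Y (?c s) + ?d s t" for s t
  proof -
    have "?c t = (\<Oplus>b\<in>B. cnj (b s) \<odot> w b \<oplus> (cnj (b t) - cnj (b s)) \<odot> w b)"
      by (intro finsum_cong') (use w in \<open>auto simp flip: scal_add_left\<close>)
    also have "\<dots> = ?c s \<oplus> (\<Oplus>b\<in>B. (cnj (b t) - cnj (b s)) \<odot> w b)"
      by (rule finsum_addf) (use w in auto)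
    finally have "vnorm Y (?c t) \<le> vnorm Y (?c s) + vnorm Y (\<Oplus>b\<in>B. (cnj (b t) - cnj (b s)) \<odot> w b)"
      using vnorm_triangle[OF closed closed] by simp
    also have "vnorm Y (\<Oplus>b\<in>B. (cnj (b t) - cnj (b s)) \<odot> w b) \<le>
        (\<Sum>b\<in>B. vnorm Y ((cnj (b t) - cnj (b s)) \<odot> w b))"
      by (rule vnorm_finsum) (use B w in auto)
    also have "\<dots> = ?d s t"
      by (intro sum.cong refl) (use w in \<open>simp add: vnorm_smult flip: complex_cnj_diff\<close>)
    finally show ?thesis by simp
  qed
  have "((\<lambda>t. vnorm Y (?c t)) \<longlongrightarrow> vnorm Y (?c s)) (at s within S)" if s: "s \<in> S" for s
  proof -
    have "((\<lambda>t. ?d s t) \<longlongrightarrow> (\<Sum>b\<in>B. cmod (b s - b s) * vnorm Y (w b))) (at s within S)"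
      using B(2) s by (intro tendsto_intros) (auto simp: continuous_on_def)
    then have d0: "((\<lambda>t. ?d s t) \<longlongrightarrow> 0) (at s within S)" by simp
    have "norm (vnorm Y (?c t) - vnorm Y (?c s)) \<le> ?d s t" for t
      using le[of t s] le[of s t] by (simp add: norm_minus_commute abs_le_iff)
    then have "eventually (\<lambda>t. norm (vnorm Y (?c t) - vnorm Y (?c s)) \<le> ?d s t) (at s within S)"
      by (rule always_eventually[OF allI])
    then have "((\<lambda>t. vnorm Y (?c t) - vnorm Y (?c s)) \<longlongrightarrow> 0) (at s within S)"
      using d0 by (rule Lim_null_comparison)
    then show ?thesis by (rule LIM_zero_cancel)
  qed
  then show ?thesis by (simp add: continuous_on_def)
qed

end

text \<open>A projection with kernel bounded by \<open>K(x, t) = \<Sum>\<^sub>b b(x) b(t)\<^sup>*\<close> is obtained from a single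
  Hahn-Banach extension on \<open>Y\<^sup>B\<close>: the functional \<open>w \<mapsto> \<integral> \<Sum>\<^sub>b b(t)\<^sup>* w\<^sub>b(t) d\<sigma>(t)\<close>, defined on
  tuples from \<open>X\<close>, is dominated by the seminorm \<open>\<integral> \<parallel>\<Sum>\<^sub>b b(t)\<^sup>* w\<^sub>b\<parallel> d\<sigma>(t)\<close>. Extending point
  evaluations separately would leave a measurability problem in \<open>t\<close>.\<close>

theorem rel_projection_const_le:
  fixes B :: "(real^'n::finite \<Rightarrow> complex) set" and Y :: "'u nspace"
  assumes B: "orthonormal B" and Y: "complex_banach Y"
    and I: "linear_isometry (sup_normed (cfun.span B)) Y I"
    and \<Lambda>: "\<And>x. norm x = 1 \<Longrightarrow> (LINT t|sphere_measure. cmod (rep_kernel B x t)) \<le> \<Lambda>"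
  shows "rel_projection_const (I ` carrier (sup_normed (cfun.span B))) Y \<le> ereal \<Lambda>"
proof -
  interpret complex_banach Y by (rule Y)
  let ?F = "cfun.span B"
  note Bfin = orthonormalD(1)[OF B] and Fc = subsetD[OF orthonormalD(4)[OF B]] and Bc = orthonormalD(3)[OF B]
  have Icl: "I f \<in> carrier Y" if "f \<in> ?F" for f
    using I that unfolding linear_isometry_def linear_op_def sup_normed_def by auto
  have Iadd: "I (f + g) = I f \<oplus>\<^bsub>Y\<^esub> I g" if "f \<in> ?F" "g \<in> ?F" for f g
    using I that unfolding linear_isometry_def linear_op_def sup_normed_def by auto
  have Iscal: "I (\<lambda>x. c * f x) = c \<odot>\<^bsub>Y\<^esub> I f" if "f \<in> ?F" for c f
    using I that unfolding linear_isometry_def linear_op_def sup_normed_def by auto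
  have Inorm: "vnorm Y (I f) = sup_norm f" if "f \<in> ?F" for f
    using I that unfolding linear_isometry_def sup_normed_def by auto
  have I0: "I 0 = \<zero>\<^bsub>Y\<^esub>"
    using Iscal[OF cfun.span_zero, of 0] Icl[OF cfun.span_zero] by (simp add: zero_fun_def)
  have Iinj: "inj_on I ?F"
  proof (rule inj_onI)
    fix f g assume f: "f \<in> ?F" and g: "g \<in> ?F" and eq: "I f = I g"
    have d: "f - g \<in> ?F" using f g by (rule cfun.span_diff)
    have "I f = I (f - g) \<oplus>\<^bsub>Y\<^esub> I g" using Iadd[OF d g] by simp
    then have "I (f - g) = \<zero>\<^bsub>Y\<^esub>"
      using eq Icl[OF g] Icl[OF d] by (metis add.r_cancel_one')
    then have "sup_norm (f - g) = 0" using Inorm[OF d] vnorm_zero by simp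
    then show "f = g" using sup_norm_eq_0_iff[OF Fc[OF d]] by simp
  qed
  have Isum: "I (\<lambda>x. \<Sum>a\<in>A. k a * h a x) = (\<Oplus>\<^bsub>Y\<^esub>a\<in>A. k a \<odot>\<^bsub>Y\<^esub> I (h a))"
    "(\<lambda>x. \<Sum>a\<in>A. k a * h a x) \<in> ?F"
    if "finite A" "\<And>a. a \<in> A \<Longrightarrow> h a \<in> ?F" for A k and h :: "(real^'n \<Rightarrow> complex) \<Rightarrow> real^'n \<Rightarrow> complex"
  proof -
    have "I (\<lambda>x. \<Sum>a\<in>A. k a * h a x) = (\<Oplus>\<^bsub>Y\<^esub>a\<in>A. k a \<odot>\<^bsub>Y\<^esub> I (h a)) \<and> (\<lambda>x. \<Sum>a\<in>A. k a * h a x) \<in> ?F"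
      using that
    proof (induction A rule: finite_induct)
      case empty
      show ?case using I0 cfun.span_zero by (simp add: zero_fun_def)
    next
      case (insert a A)
      have eq: "(\<lambda>x. \<Sum>a\<in>insert a A. k a * h a x) = (\<lambda>x. k a * h a x) + (\<lambda>x. \<Sum>a\<in>A. k a * h a x)"
        using insert.hyps by (simp add: fun_eq_iff)
      have h: "h a \<in> ?F" "(\<lambda>x. k a * h a x) \<in> ?F" using insert.prems by (auto intro: cfun.span_scale)
      then show ?case
        unfolding eq using insert Icl
        by (auto simp: Iadd Iscal Pi_def intro: cfun.span_add)
    qed
    then show "I (\<lambda>x. \<Sum>a\<in>A. k a * h a x) = (\<Oplus>\<^bsub>Y\<^esub>a\<in>A. k a \<odot>\<^bsub>Y\<^esub> I (h a))"
      "(\<lambda>x. \<Sum>a\<in>A. k a * h a x) \<in> ?F" by auto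
  qed
  \<comment> \<open>Reads vectors of the embedded copy back as functions, so that they can be
    evaluated under an integral.\<close>
  define J where "J = inv_into ?F I"
  have JI: "J (I f) = f" if "f \<in> ?F" for f
    unfolding J_def by (rule inv_into_f_f[OF Iinj that])
  define W where "W = (fun_module :: (complex, (real^'n \<Rightarrow> complex) \<Rightarrow> 'u) module)"
  interpret W: complex_module W unfolding W_def by (rule complex_module_fun_module)
  have Wc: "w \<in> carrier W \<longleftrightarrow> (\<forall>b. w b \<in> carrier Y)" for w by (simp add: W_def fun_module_def)
  have Wadd: "(v \<oplus>\<^bsub>W\<^esub> w) = (\<lambda>b. v b \<oplus>\<^bsub>Y\<^esub> w b)" for v w by (simp add: W_def fun_module_def)
  have Wscal: "(c \<odot>\<^bsub>W\<^esub> w) = (\<lambda>b. c \<odot>\<^bsub>Y\<^esub> w b)" for c w by (simp add: W_def fun_module_def)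
  have Wzero: "\<zero>\<^bsub>W\<^esub> = (\<lambda>b. \<zero>\<^bsub>Y\<^esub>)" by (simp add: W_def fun_module_def)
  define comb where "comb = (\<lambda>w t. \<Oplus>\<^bsub>Y\<^esub>b\<in>B. cnj (b t) \<odot>\<^bsub>Y\<^esub> w b)"
  define q where "q = (\<lambda>w. LINT t|sphere_measure. vnorm Y (comb w t))"
  have comb_cl: "comb w t \<in> carrier Y" if "w \<in> carrier W" for w t
    unfolding comb_def by (rule finsum_closed) (use that in \<open>auto simp: Wc\<close>)
  have comb_int: "integrable sphere_measure (\<lambda>t. vnorm Y (comb w t))" if "w \<in> carrier W" for w
    unfolding comb_def
    by (intro integrable_sphere_measure continuous_on_vnorm_combination Bfin csphere_continuous Bc)
      (use that in \<open>auto simp: Wc\<close>)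
  have comb_add: "comb (v \<oplus>\<^bsub>W\<^esub> w) t = comb v t \<oplus>\<^bsub>Y\<^esub> comb w t" if "v \<in> carrier W" "w \<in> carrier W" for v w t
  proof -
    have "comb (v \<oplus>\<^bsub>W\<^esub> w) t = (\<Oplus>\<^bsub>Y\<^esub>b\<in>B. cnj (b t) \<odot>\<^bsub>Y\<^esub> v b \<oplus>\<^bsub>Y\<^esub> cnj (b t) \<odot>\<^bsub>Y\<^esub> w b)"
      unfolding comb_def Wadd by (intro finsum_cong') (use that in \<open>auto simp: Wc scal_add_right\<close>)
    then show ?thesis
      unfolding comb_def using that by (simp add: finsum_addf Wc Pi_def)
  qed
  have comb_scal: "comb (c \<odot>\<^bsub>W\<^esub> w) t = c \<odot>\<^bsub>Y\<^esub> comb w t" if "w \<in> carrier W" for c w t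
    unfolding comb_def Wscal using that Bfin
    by (subst finsum_scal) (auto simp: Wc scal_scal mult.commute intro!: finsum_cong')
  have qadd: "q (v \<oplus>\<^bsub>W\<^esub> w) \<le> q v + q w" if "v \<in> carrier W" "w \<in> carrier W" for v w
  proof -
    have "q (v \<oplus>\<^bsub>W\<^esub> w) \<le> (LINT t|sphere_measure. vnorm Y (comb v t) + vnorm Y (comb w t))"
      unfolding q_def using that
      by (intro integral_mono comb_int Bochner_Integration.integrable_add)
        (auto simp: comb_add intro!: vnorm_triangle comb_cl)
    then show ?thesis using comb_int that by (simp add: q_def)
  qed
  have qscal: "q (c \<odot>\<^bsub>W\<^esub> w) = cmod c * q w" if "w \<in> carrier W" for c w
    using that by (simp add: q_def comb_scal vnorm_smult comb_cl)
  define M where "M = {w :: (real^'n \<Rightarrow> complex) \<Rightarrow> 'u. \<forall>b. w b \<in> I ` ?F}"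
  have ME: "\<exists>g. (\<forall>b. g b \<in> ?F) \<and> w = (\<lambda>b. I (g b))" if "w \<in> M" for w
    using that unfolding M_def by (intro exI[of _ "\<lambda>b. J (w b)"]) (auto simp: J_def inv_into_into f_inv_into_f)
  have MI: "(\<lambda>b. I (g b)) \<in> M" if "\<And>b. g b \<in> ?F" for g using that unfolding M_def by auto
  \<comment> \<open>On tuples of embedded functions this is the trace-like pairing
    \<open>\<Sum>b\<in>B. ip (g b) b\<close>.\<close>
  define \<phi> where "\<phi> = (\<lambda>w. LINT t|sphere_measure. (\<Sum>b\<in>B. cnj (b t) * J (w b) t))"
  have \<phi>I: "\<phi> (\<lambda>b. I (g b)) = (\<Sum>b\<in>B. ip (g b) b)" if "\<And>b. g b \<in> ?F" for g
  proof -
    have "\<phi> (\<lambda>b. I (g b)) = (LINT t|sphere_measure. (\<Sum>b\<in>B. g b t * cnj (b t)))"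
      using that by (simp add: \<phi>_def JI mult.commute)
    also have "\<dots> = (\<Sum>b\<in>B. ip (g b) b)"
      unfolding ip_def by (rule Bochner_Integration.integral_sum) (intro integrable_ip Fc Bc that)
    finally show ?thesis .
  qed
  obtain \<psi> :: "((real^'n \<Rightarrow> complex) \<Rightarrow> 'u) \<Rightarrow> complex" where
    \<psi>add: "\<And>v w. v \<in> carrier W \<Longrightarrow> w \<in> carrier W \<Longrightarrow> \<psi> (v \<oplus>\<^bsub>W\<^esub> w) = \<psi> v + \<psi> w" and
    \<psi>scal: "\<And>w c. w \<in> carrier W \<Longrightarrow> \<psi> (c \<odot>\<^bsub>W\<^esub> w) = c * \<psi> w" and
    \<psi>q: "\<And>w. w \<in> carrier W \<Longrightarrow> cmod (\<psi> w) \<le> q w" and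
    \<psi>\<phi>: "\<And>w. w \<in> M \<Longrightarrow> \<psi> w = \<phi> w"
  proof (rule W.hahn_banach_complex[of q M \<phi>, OF qadd qscal])
    show "M \<subseteq> carrier W"
    proof
      fix w assume "w \<in> M"
      then obtain g where "\<forall>b. g b \<in> ?F" "w = (\<lambda>b. I (g b))" using ME by blast
      then show "w \<in> carrier W" using Icl by (simp add: Wc)
    qed
    show "\<zero>\<^bsub>W\<^esub> \<in> M" using MI[of "\<lambda>_. 0", OF cfun.span_zero] by (simp add: Wzero I0)
    show "v \<oplus>\<^bsub>W\<^esub> w \<in> M" "\<phi> (v \<oplus>\<^bsub>W\<^esub> w) = \<phi> v + \<phi> w" if vw: "v \<in> M" "w \<in> M" for v w
    proof -
      obtain g h where g: "\<And>b. g b \<in> ?F" "v = (\<lambda>b. I (g b))" and h: "\<And>b. h b \<in> ?F" "w = (\<lambda>b. I (h b))"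
        using ME[OF vw(1)] ME[OF vw(2)] by metis
      have vw_eq: "v \<oplus>\<^bsub>W\<^esub> w = (\<lambda>b. I (g b + h b))" using g h by (simp add: Wadd Iadd)
      have gh: "g b + h b \<in> ?F" for b by (rule cfun.span_add[OF g(1) h(1)])
      show "v \<oplus>\<^bsub>W\<^esub> w \<in> M" unfolding vw_eq by (rule MI[OF gh])
      show "\<phi> (v \<oplus>\<^bsub>W\<^esub> w) = \<phi> v + \<phi> w"
        unfolding vw_eq \<phi>I[OF gh] unfolding g(2) h(2) \<phi>I[OF g(1)] \<phi>I[OF h(1)] sum.distrib[symmetric]
        by (intro sum.cong refl ip_add_left Fc g h Bc)
    qed
    show "c \<odot>\<^bsub>W\<^esub> w \<in> M" "\<phi> (c \<odot>\<^bsub>W\<^esub> w) = c * \<phi> w" if w: "w \<in> M" for w c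
    proof -
      obtain g where g: "\<And>b. g b \<in> ?F" "w = (\<lambda>b. I (g b))" using ME[OF w] by metis
      have w_eq: "c \<odot>\<^bsub>W\<^esub> w = (\<lambda>b. I (\<lambda>x. c * g b x))" using g by (simp add: Wscal Iscal)
      have cg: "(\<lambda>x. c * g b x) \<in> ?F" for b by (rule cfun.span_scale[OF g(1)])
      show "c \<odot>\<^bsub>W\<^esub> w \<in> M" unfolding w_eq by (rule MI[OF cg])
      show "\<phi> (c \<odot>\<^bsub>W\<^esub> w) = c * \<phi> w"
        unfolding w_eq \<phi>I[OF cg] unfolding g(2) \<phi>I[OF g(1)] sum_distrib_left
        by (intro sum.cong refl ip_scale_left)
    qed
    show "cmod (\<phi> w) \<le> q w" if w: "w \<in> M" for w
    proof -
      obtain g where g: "\<And>b. g b \<in> ?F" "w = (\<lambda>b. I (g b))" using ME[OF w] by metis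
      have wc: "w \<in> carrier W" using g Icl by (simp add: Wc)
      have "cmod (\<phi> w) \<le> (LINT t|sphere_measure. cmod (\<Sum>b\<in>B. cnj (b t) * J (w b) t))"
        unfolding \<phi>_def by (rule integral_norm_bound)
      also have "\<dots> \<le> q w"
        unfolding q_def
      proof (rule integral_mono[OF _ comb_int[OF wc]])
        show "integrable sphere_measure (\<lambda>t. cmod (\<Sum>b\<in>B. cnj (b t) * J (w b) t))"
          unfolding g(2) JI[OF g(1)]
          by (intro integrable_sphere_measure continuous_intros csphere_continuous Bc Fc g)
        fix t :: "real^'n" assume "t \<in> space sphere_measure"
        then have t: "norm t = 1" by (simp add: space_sphere_measure)
        \<comment> \<open>Freezing \<open>t\<close> in the conjugated factors gives a function of
          the span whose image under \<open>I\<close> is \<open>comb w t\<close>. The integrand is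
          its value at the same \<open>t\<close>, hence at most its sup norm, which is the norm in
          \<open>Y\<close>.\<close>
        let ?h = "\<lambda>x. \<Sum>b\<in>B. cnj (b t) * g b x"
        have hF: "?h \<in> ?F" "comb w t = I ?h"
          unfolding comb_def g(2) using Isum[OF Bfin, of g "\<lambda>b. cnj (b t)"] g(1) by simp_all
        have "cmod (\<Sum>b\<in>B. cnj (b t) * J (w b) t) = cmod (?h t)"
          unfolding g(2) JI[OF g(1)] ..
        also have "\<dots> \<le> vnorm Y (comb w t)"
          unfolding hF(2) Inorm[OF hF(1)] by (rule sup_norm_upper[OF Fc[OF hF(1)] t])
        finally show "cmod (\<Sum>b\<in>B. cnj (b t) * J (w b) t) \<le> vnorm Y (comb w t)" .
      qed
      finally show ?thesis .
    qed
  next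
    fix g :: "((real^'n \<Rightarrow> complex) \<Rightarrow> 'u) \<Rightarrow> complex"
    assume "\<And>x y. x \<in> carrier W \<Longrightarrow> y \<in> carrier W \<Longrightarrow> g (x \<oplus>\<^bsub>W\<^esub> y) = g x + g y"
      "\<And>x c. x \<in> carrier W \<Longrightarrow> g (c \<odot>\<^bsub>W\<^esub> x) = c * g x"
      "\<And>x. x \<in> carrier W \<Longrightarrow> cmod (g x) \<le> q x" "\<And>x. x \<in> M \<Longrightarrow> g x = \<phi> x"
    then show thesis by (rule that)
  qed
  \<comment> \<open>A tuple with a single entry extracts one coordinate:
    \<open>\<psi> (single b y)\<close> extends the Fourier coefficient \<open>ip f b\<close> from
    the embedded copy to all of \<open>Y\<close>.\<close>
  define single where "single = (\<lambda>(b :: real^'n \<Rightarrow> complex) y b'. if b' = b then y else \<zero>\<^bsub>Y\<^esub>)"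
  have single_cl: "single b y \<in> carrier W" if "y \<in> carrier Y" for b y
    using that by (simp add: single_def Wc)
  define p where "p = (\<lambda>y x. \<Sum>b\<in>B. \<psi> (single b y) * b x)"
  have pF: "p y \<in> ?F" for y unfolding p_def by (rule cspan_sum_mem)
  have padd: "p (y \<oplus>\<^bsub>Y\<^esub> z) = p y + p z" if "y \<in> carrier Y" "z \<in> carrier Y" for y z
  proof -
    have s: "single b (y \<oplus>\<^bsub>Y\<^esub> z) = single b y \<oplus>\<^bsub>W\<^esub> single b z" for b
      by (simp add: single_def Wadd fun_eq_iff)
    show ?thesis
      by (rule ext) (use that in \<open>simp add: p_def s \<psi>add single_cl distrib_right sum.distrib\<close>)
  qed
  have pscal: "p (c \<odot>\<^bsub>Y\<^esub> y) = (\<lambda>x. c * p y x)" if "y \<in> carrier Y" for c y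
  proof -
    have s: "single b (c \<odot>\<^bsub>Y\<^esub> y) = c \<odot>\<^bsub>W\<^esub> single b y" for b
      by (simp add: single_def Wscal fun_eq_iff)
    show ?thesis
      by (rule ext) (use that in \<open>simp add: p_def s \<psi>scal single_cl sum_distrib_left mult.assoc\<close>)
  qed
  have pI: "p (I f) = f" if f: "f \<in> ?F" for f
  proof
    fix x
    have "\<psi> (single b (I f)) = ip f b" if b: "b \<in> B" for b
    proof -
      let ?g = "\<lambda>b'. if b' = b then f else 0"
      have g: "?g b' \<in> ?F" for b' using f cfun.span_zero[of B] by simp
      have s: "single b (I f) = (\<lambda>b'. I (?g b'))" by (auto simp: single_def I0)
      have "\<psi> (single b (I f)) = (\<Sum>b'\<in>B. ip (?g b') b')"
        unfolding s using \<psi>\<phi>[OF MI[OF g]] \<phi>I[OF g] by simp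
      also have "\<dots> = (\<Sum>b'\<in>B. if b' = b then ip f b else 0)"
        by (intro sum.cong) (auto simp: ip_def)
      finally show ?thesis using b Bfin by simp
    qed
    then show "p (I f) x = f x"
      using orthonormal_expansion[OF B f, of x] by (simp add: p_def)
  qed
  have p_bound: "cmod (p y x) \<le> \<Lambda> * vnorm Y y" if y: "y \<in> carrier Y" and x: "norm x = 1" for y x
  proof -
    have sums: "\<psi> (\<lambda>b. if b \<in> A then k b \<odot>\<^bsub>Y\<^esub> y else \<zero>\<^bsub>Y\<^esub>) = (\<Sum>b\<in>A. k b * \<psi> (single b y))"
      if "finite A" for A k
      using that
    proof (induction A rule: finite_induct)
      case empty
      show ?case
        using \<psi>scal[OF W.zero_closed, of 0] by (simp add: Wzero[symmetric])
    next
      case (insert a A)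
      have eq: "(\<lambda>b. if b \<in> insert a A then k b \<odot>\<^bsub>Y\<^esub> y else \<zero>\<^bsub>Y\<^esub>) =
          k a \<odot>\<^bsub>W\<^esub> single a y \<oplus>\<^bsub>W\<^esub> (\<lambda>b. if b \<in> A then k b \<odot>\<^bsub>Y\<^esub> y else \<zero>\<^bsub>Y\<^esub>)"
        by (rule ext) (use insert.hyps y in \<open>auto simp: single_def Wscal Wadd\<close>)
      have cl: "(\<lambda>b. if b \<in> A then k b \<odot>\<^bsub>Y\<^esub> y else \<zero>\<^bsub>Y\<^esub>) \<in> carrier W" using y by (simp add: Wc)
      show ?case
        unfolding eq \<psi>add[OF W.scal_closed[OF single_cl[OF y]] cl] \<psi>scal[OF single_cl[OF y]] insert.IH
        using insert.hyps by simp
    qed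
    \<comment> \<open>\<open>p y x\<close> is the value of \<open>\<psi>\<close> at the tuple with
      entries \<open>b x\<close> times \<open>y\<close>. Its combination at \<open>t\<close> is the
      scalar \<open>rep_kernel B x t\<close> times \<open>y\<close>, so the seminorm is the
      \<open>L^1\<close> norm of a kernel section times the norm of \<open>y\<close>.\<close>
    let ?w = "\<lambda>b. if b \<in> B then b x \<odot>\<^bsub>Y\<^esub> y else \<zero>\<^bsub>Y\<^esub>"
    have wc: "?w \<in> carrier W" using y by (simp add: Wc)
    have comb_w: "comb ?w t = rep_kernel B x t \<odot>\<^bsub>Y\<^esub> y" for t
    proof -
      have "comb ?w t = (\<Oplus>\<^bsub>Y\<^esub>b\<in>B. (b x * cnj (b t)) \<odot>\<^bsub>Y\<^esub> y)"
        unfolding comb_def by (intro finsum_cong') (use y in \<open>auto simp: scal_scal mult.commute\<close>)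
      then show ?thesis using finsum_scal_right[OF Bfin y] by (simp add: rep_kernel_def)
    qed
    have "p y x = \<psi> ?w" using sums[OF Bfin, of "\<lambda>b. b x"] by (simp add: p_def mult.commute)
    then have "cmod (p y x) \<le> q ?w" using \<psi>q[OF wc] by simp
    also have "q ?w = (LINT t|sphere_measure. cmod (rep_kernel B x t)) * vnorm Y y"
      using y by (simp add: q_def comb_w vnorm_smult)
    also have "\<dots> \<le> \<Lambda> * vnorm Y y"
      by (intro mult_right_mono \<Lambda>[OF x] vnorm_nonneg[OF y])
    finally show ?thesis .
  qed
  define P where "P = (\<lambda>y. I (p y))"
  have carr: "carrier (sup_normed ?F) = ?F" by (simp add: sup_normed_def)
  have \<Lambda>0: "\<Lambda> \<ge> 0"
    using order_trans[OF _ \<Lambda>[OF axis_sphere]] by simp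
  have "linear_op Y Y P"
    unfolding linear_op_def P_def using Icl[OF pF] by (auto simp: padd pscal Iadd[OF pF pF] Iscal[OF pF])
  moreover have norm_le: "op_norm Y Y P \<le> ereal \<Lambda>"
    unfolding op_norm_def
  proof (rule SUP_least)
    fix y assume "y \<in> {y \<in> carrier Y. vnorm Y y \<le> 1}"
    then have y: "y \<in> carrier Y" "vnorm Y y \<le> 1" by auto
    have "vnorm Y (P y) \<le> \<Lambda> * vnorm Y y"
      unfolding P_def Inorm[OF pF] by (rule sup_norm_least[OF p_bound[OF y(1)]])
    also have "\<dots> \<le> \<Lambda>" using y(2) \<Lambda>0 by (simp add: mult_left_le)
    finally show "ereal (vnorm Y (P y)) \<le> ereal \<Lambda>" by simp
  qed
  moreover have "P ` carrier Y \<subseteq> I ` ?F" unfolding P_def using pF by auto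
  moreover have "\<forall>x\<in>I ` ?F. P x = x" unfolding P_def using pI by auto
  ultimately have "rel_projection_const (I ` ?F) Y \<le> op_norm Y Y P"
    unfolding rel_projection_const_def
    by (intro Inf_lower CollectI exI[of _ P] conjI refl) (auto intro: le_less_trans)
  then show ?thesis unfolding carr using norm_le by (rule order_trans)
qed

section \<open>Decomposition into spherical harmonics\<close>

definition zonal_kernel :: "'n::finite itself \<Rightarrow> nat set \<Rightarrow> real \<Rightarrow> real" where
  "zonal_kernel U J s = (\<Sum>j\<in>J. real (N_dim U j) * legendre CARD('n) j s)"

text \<open>One family for the three spaces of the theorem, with degree sets \<open>{d}\<close>, the
  numbers \<open>d - 2 * j\<close>, and \<open>{..d}\<close>.\<close>

definition harm_span :: "nat set \<Rightarrow> (real^'n::finite \<Rightarrow> complex) set" where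
  "harm_span J = cfun.span (\<Union>j\<in>J. Hd_sphere j)"

lemma continuous_on_legendre [continuous_intros]:
  "continuous_on A f \<Longrightarrow> continuous_on A (\<lambda>x. legendre n k (f x))"
  unfolding legendre_def by (intro continuous_intros)

lemma continuous_on_zonal_kernel [continuous_intros]:
  "continuous_on A f \<Longrightarrow> continuous_on A (\<lambda>x. zonal_kernel U J (f x))"
  unfolding zonal_kernel_def by (intro continuous_intros)

lemma orthonormal_harm_basis_Union:
  assumes n: "CARD('n::finite) \<ge> 2" and J: "finite J"
  shows "orthonormal (\<Union>j\<in>J. harm_basis j :: (real^'n \<Rightarrow> complex) set)"
  unfolding orthonormal_def
proof (intro conjI ballI)
  show "finite (\<Union>j\<in>J. harm_basis j :: (real^'n \<Rightarrow> complex) set)"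
    using J orthonormalD(1)[OF harm_basis(1)] by blast
  show "(\<Union>j\<in>J. harm_basis j :: (real^'n \<Rightarrow> complex) set) \<subseteq> csphere"
    using harm_basis_csphere by blast
  fix f g :: "real^'n \<Rightarrow> complex"
  assume "f \<in> (\<Union>j\<in>J. harm_basis j)" "g \<in> (\<Union>j\<in>J. harm_basis j)"
  then obtain j k where jk: "f \<in> harm_basis j" "g \<in> harm_basis k" by blast
  have mem: "f \<in> Hd_sphere j" "g \<in> Hd_sphere k"
    using jk cfun.span_base unfolding harm_basis(2)[symmetric] by blast+
  show "ip f g = (if f = g then 1 else 0)"
  proof (cases "j = k")
    case True
    then show ?thesis using orthonormalD(5)[OF harm_basis(1)] jk by blast
  next
    case False
    then have 0: "ip f g = 0" by (rule Hd_sphere_orthogonal[OF n _ mem])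
    moreover have "ip f f = 1" using orthonormalD(5)[OF harm_basis(1) jk(1) jk(1)] by simp
    ultimately show ?thesis by auto
  qed
qed

lemma harm_span_eq:
  "harm_span J = cfun.span (\<Union>j\<in>J. harm_basis j :: (real^'n::finite \<Rightarrow> complex) set)"
proof
  have "Hd_sphere j \<subseteq> cfun.span (\<Union>j\<in>J. harm_basis j :: (real^'n \<Rightarrow> complex) set)" if "j \<in> J" for j
    unfolding harm_basis(2)[symmetric] by (rule cfun.span_mono) (use that in blast)
  then show "harm_span J \<subseteq> cfun.span (\<Union>j\<in>J. harm_basis j :: (real^'n \<Rightarrow> complex) set)"
    unfolding harm_span_def by (intro cfun.span_minimal) auto
  have "harm_basis j \<subseteq> (Hd_sphere j :: (real^'n \<Rightarrow> complex) set)" for j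
    using cfun.span_superset unfolding harm_basis(2)[symmetric] by blast
  then show "cfun.span (\<Union>j\<in>J. harm_basis j :: (real^'n \<Rightarrow> complex) set) \<subseteq> harm_span J"
    unfolding harm_span_def by (intro cfun.span_mono) blast
qed

text \<open>A common element would be a unit vector orthogonal to itself. Disjointness lets sums
  over the union of the bases split by degree.\<close>

lemma harm_basis_disjoint:
  fixes f :: "real^'n::finite \<Rightarrow> complex"
  assumes n: "CARD('n) \<ge> 2" and "f \<in> harm_basis j" "f \<in> harm_basis k"
  shows "j = k"
proof (rule ccontr)
  assume "j \<noteq> k"
  moreover have "f \<in> Hd_sphere j" "f \<in> Hd_sphere k"
    using assms(2,3) cfun.span_base unfolding harm_basis(2)[symmetric] by blast+
  ultimately have "ip f f = 0" by (rule Hd_sphere_orthogonal[OF n])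
  then show False using orthonormalD(5)[OF harm_basis(1) assms(2) assms(2)] by simp
qed

lemma rep_kernel_harm_basis_Union:
  fixes x t :: "real^'n::finite"
  assumes n: "CARD('n) \<ge> 2" and J: "finite J" and x: "norm x = 1" and t: "norm t = 1"
  shows "rep_kernel (\<Union>j\<in>J. harm_basis j) x t = of_real (zonal_kernel TYPE('n) J (x \<bullet> t))"
proof -
  have "rep_kernel (\<Union>j\<in>J. harm_basis j) x t = (\<Sum>j\<in>J. rep_kernel (harm_basis j) x t)"
    unfolding rep_kernel_def using harm_basis_disjoint[OF n]
    by (intro sum.UNION_disjoint J) (auto intro: orthonormalD(1)[OF harm_basis(1)])
  then show ?thesis by (simp add: rep_kernel_harm_basis[OF n x t] zonal_kernel_def)
qed

text \<open>The reflection that moves \<open>x\<close> to the axis turns the inner product into a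
  coordinate. All kernel sections therefore have the same \<open>L^1\<close> norm.\<close>

lemma integral_sphere_inner:
  fixes g :: "real \<Rightarrow> real" and x :: "real^'n::finite"
  assumes g: "continuous_on UNIV g" and x: "norm x = 1"
  shows "(LINT t|sphere_measure. g (x \<bullet> t)) = (LINT t|(sphere_measure :: (real^'n) measure). g (t $ i))"
proof -
  let ?T = "householder (x - axis i 1)"
  have T: "orthogonal_transformation ?T" by (rule orthogonal_transformation_householder)
  have "?T x = axis i 1" by (rule householder_swap) (use x in simp)
  then have "x \<bullet> t = ?T t $ i" for t
    using T unfolding orthogonal_transformation_def by (metis inner_axis' real_inner_1_left)
  then have "(LINT t|sphere_measure. g (x \<bullet> t)) = (LINT t|sphere_measure. g (?T t $ i))" by simp
  also have "\<dots> = (LINT t|(sphere_measure :: (real^'n) measure). g (t $ i))"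
    by (rule integral_sphere_orthogonal_transformation[OF T, of "\<lambda>t. g (t $ i)"])
      (intro continuous_on_compose2[OF g] continuous_intros, auto)
  finally show ?thesis .
qed

text \<open>It is a section of the reproducing kernel, divided by the dimension.\<close>

lemma legendre_inner_Hd_sphere:
  fixes y :: "real^'n::finite"
  assumes n: "CARD('n) \<ge> 2" and y: "norm y = 1"
  shows "sphere_restr (\<lambda>x. of_real (legendre CARD('n) k (y \<bullet> x))) \<in> Hd_sphere k"
proof -
  let ?f = "\<lambda>x. inverse (of_nat (N_dim TYPE('n) k)) * rep_kernel (harm_basis k) x y"
  have f: "?f \<in> Hd_sphere k"
    using cfun.span_scale[OF rep_kernel_span[of "harm_basis k" y]] unfolding harm_basis(2) .
  have "sphere_restr (\<lambda>x. of_real (legendre CARD('n) k (y \<bullet> x))) = ?f"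
  proof (rule csphere_eqI[OF sphere_restr_csphere Hd_sphere_csphere[OF f]])
    show "continuous_on (sphere 0 1) (\<lambda>x. complex_of_real (legendre CARD('n) k (y \<bullet> x)))"
      by (intro continuous_intros)
    fix x :: "real^'n" assume "x \<in> sphere 0 1"
    then have x: "norm x = 1" by simp
    show "sphere_restr (\<lambda>x. of_real (legendre CARD('n) k (y \<bullet> x))) x = ?f x"
      using N_dim_pos[OF n, of k]
      by (simp add: sphere_restr_apply[OF x] rep_kernel_harm_basis[OF n x y] inner_commute[of x y])
  qed
  then show ?thesis using f by simp
qed

text \<open>Powers of linear forms span, and for a unit direction the expansion of
  \<open>t ^ d\<close> in Legendre polynomials of the same parity writes such a power as a sum of
  harmonics of degrees \<open>d - 2 * i\<close>.\<close>

lemma Pd_sphere_subset_harm_span: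
  assumes n: "CARD('n::finite) \<ge> 2"
  shows "(Pd_sphere d :: (real^'n \<Rightarrow> complex) set) \<subseteq> harm_span ((\<lambda>j. d - 2 * j) ` {..d div 2})"
    (is "_ \<subseteq> ?V")
proof -
  have V: "cfun.subspace ?V" unfolding harm_span_def by (rule cfun.subspace_span)
  have "sphere_restr (\<lambda>x. of_real (y \<bullet> x) ^ d) \<in> ?V" for y :: "real^'n"
  proof -
    \<comment> \<open>Every linear form is a multiple of one with unit direction; for
      \<open>y = 0\<close> an arbitrary direction with \<open>r = 0\<close> serves.\<close>
    obtain v r where v: "norm v = 1" "y = r *\<^sub>R v"
    proof (cases "y = 0")
      case True
      then show thesis using that[of "axis undefined 1" 0] by simp
    next
      case False
      then show thesis using that[of "sgn y" "norm y"] by (simp add: norm_sgn sgn_div_norm)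
    qed
    obtain a where a: "\<And>t. t ^ d = (\<Sum>i\<le>d div 2. a i * legendre CARD('n) (d - 2 * i) t)"
      using power_legendre[OF n] by blast
    have "sphere_restr (\<lambda>x. of_real (y \<bullet> x) ^ d) =
        (\<Sum>i\<le>d div 2. (\<lambda>x. of_real (r ^ d * a i) * sphere_restr (\<lambda>x. of_real (legendre CARD('n) (d - 2 * i) (v \<bullet> x))) x))"
    proof
      fix x :: "real^'n"
      have "(y \<bullet> x) ^ d = (\<Sum>i\<le>d div 2. r ^ d * a i * legendre CARD('n) (d - 2 * i) (v \<bullet> x))"
        using a[of "v \<bullet> x"] by (simp add: v power_mult_distrib sum_distrib_left mult.assoc)
      then show "sphere_restr (\<lambda>x. of_real (y \<bullet> x) ^ d) x =
        (\<Sum>i\<le>d div 2. (\<lambda>x. of_real (r ^ d * a i) * sphere_restr (\<lambda>x. of_real (legendre CARD('n) (d - 2 * i) (v \<bullet> x))) x)) x"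
        unfolding sum_fun_apply sphere_restr_def
        by (cases "x \<in> sphere 0 1") (simp_all only: if_True if_False mult_zero_right sum.neutral_const
            of_real_power[symmetric] of_real_mult[symmetric] of_real_sum[symmetric])
    qed
    also have "\<dots> \<in> ?V"
      by (intro cfun.subspace_sum[OF V] cfun.subspace_scale[OF V])
        (auto simp: harm_span_def intro!: cfun.span_base legendre_inner_Hd_sphere[OF n v(1)])
    finally show ?thesis .
  qed
  then have "cfun.span (range (\<lambda>y x. of_real (y \<bullet> x) ^ d)) \<subseteq> {f :: real^'n \<Rightarrow> complex. sphere_restr f \<in> ?V}"
    by (intro cfun.span_minimal subspace_sphere_restr_vimage[OF V]) auto
  then show ?thesis
    unfolding Pd_sphere_def hom_polys_eq_span_powers by auto
qed

lemma Hd_sphere_subset_Pd_sphere_add: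
  "(Hd_sphere k :: (real^'n::finite \<Rightarrow> complex) set) \<subseteq> Pd_sphere (k + 2 * j)"
proof
  fix f :: "real^'n \<Rightarrow> complex" assume "f \<in> Hd_sphere k"
  then obtain p where p: "p \<in> hom_polys k" "f = sphere_restr p"
    unfolding Hd_sphere_def harmonic_hom_polys_def by auto
  have "f = sphere_restr (\<lambda>x. of_real (norm x) ^ (2 * j) * p x)"
    unfolding p by (auto simp: sphere_restr_def)
  then show "f \<in> Pd_sphere (k + 2 * j)"
    unfolding Pd_sphere_def using hom_polys_mult_norm_power[OF p(1), of j] by blast
qed

lemma Pd_sphere_eq_harm_span:
  assumes n: "CARD('n::finite) \<ge> 2"
  shows "(Pd_sphere d :: (real^'n \<Rightarrow> complex) set) = harm_span ((\<lambda>j. d - 2 * j) ` {..d div 2})"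
proof
  have "(Hd_sphere (d - 2 * j) :: (real^'n \<Rightarrow> complex) set) \<subseteq> Pd_sphere d" if "j \<le> d div 2" for j
  proof -
    have "d - 2 * j + 2 * j = d" using that by linarith
    then show ?thesis using Hd_sphere_subset_Pd_sphere_add[of "d - 2 * j" j] by simp
  qed
  then show "harm_span ((\<lambda>j. d - 2 * j) ` {..d div 2}) \<subseteq> (Pd_sphere d :: (real^'n \<Rightarrow> complex) set)"
    unfolding harm_span_def by (intro cfun.span_minimal subspace_Pd_sphere) auto
qed (rule Pd_sphere_subset_harm_span[OF n])

text \<open>Degree by degree: a monomial of degree \<open>k \<le> d\<close> has only harmonic
  components of degrees \<open>k - 2 * i\<close>.\<close>

lemma Ple_sphere_eq_harm_span:
  assumes n: "CARD('n::finite) \<ge> 2"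
  shows "(Ple_sphere d :: (real^'n \<Rightarrow> complex) set) = harm_span {..d}"
proof
  have V: "cfun.subspace (harm_span {..d} :: (real^'n \<Rightarrow> complex) set)"
    unfolding harm_span_def by (rule cfun.subspace_span)
  have "sphere_restr (monomial_fun \<alpha>) \<in> harm_span {..d}" if "sum \<alpha> UNIV \<le> d" for \<alpha> :: "'n \<Rightarrow> nat"
  proof -
    let ?k = "sum \<alpha> UNIV"
    have "sphere_restr (monomial_fun \<alpha>) \<in> Pd_sphere ?k"
      unfolding Pd_sphere_def using monomial_in_hom_polys by blast
    then have "sphere_restr (monomial_fun \<alpha>) \<in> harm_span ((\<lambda>j. ?k - 2 * j) ` {..?k div 2})"
      unfolding Pd_sphere_eq_harm_span[OF n] .
    also have "\<dots> \<subseteq> harm_span {..d}"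
      unfolding harm_span_def by (intro cfun.span_mono) (use that in fastforce)
    finally show ?thesis .
  qed
  then have "polys_le d \<subseteq> {f :: real^'n \<Rightarrow> complex. sphere_restr f \<in> harm_span {..d}}"
    unfolding polys_le_eq_span
    by (intro cfun.span_minimal subspace_sphere_restr_vimage[OF V]) auto
  then show "(Ple_sphere d :: (real^'n \<Rightarrow> complex) set) \<subseteq> harm_span {..d}"
    unfolding Ple_sphere_def by auto
  have "(Hd_sphere j :: (real^'n \<Rightarrow> complex) set) \<subseteq> Ple_sphere d" if "j \<le> d" for j
  proof -
    have "hom_polys j \<subseteq> (polys_le d :: (real^'n \<Rightarrow> complex) set)"
      unfolding hom_polys_eq_span polys_le_eq_span by (rule cfun.span_mono) (use that in auto)
    then show ?thesis
      unfolding Hd_sphere_def harmonic_hom_polys_def Ple_sphere_def by auto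
  qed
  then show "harm_span {..d} \<subseteq> (Ple_sphere d :: (real^'n \<Rightarrow> complex) set)"
    unfolding harm_span_def by (intro cfun.span_minimal subspace_Ple_sphere) auto
qed

lemma Hd_sphere_eq_harm_span: "Hd_sphere d = harm_span {d}"
  by (simp add: harm_span_def cfun.span_eq_iff[THEN iffD2, OF subspace_Hd_sphere])

text \<open>The kernel sections at a pole are \<open>N\<close> times Legendre polynomials. Their
  inner product vanishes for different degrees; for equal degrees the reproducing property gives the
  diagonal value \<open>N\<close>, so \<open>N^2\<close> times the integral is
  \<open>N\<close>.\<close>

lemma integral_legendre_mult:
  assumes n: "CARD('n::finite) \<ge> 2"
  shows "(LINT t|(sphere_measure :: (real^'n) measure). legendre CARD('n) j (t $ i) * legendre CARD('n) k (t $ i)) =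
    (if j = k then 1 / real (N_dim TYPE('n) k) else 0)"
proof -
  define e where "e = (axis i 1 :: real^'n)"
  have e: "norm e = 1" by (simp add: e_def)
  define I where "I = (LINT t|(sphere_measure :: (real^'n) measure). legendre CARD('n) j (t $ i) * legendre CARD('n) k (t $ i))"
  let ?Z = "\<lambda>k t. rep_kernel (harm_basis k) t e"
  have mem: "?Z k \<in> Hd_sphere k" for k
    using rep_kernel_span[of "harm_basis k" e] unfolding harm_basis(2) .
  have Z: "?Z k t = of_real (real (N_dim TYPE('n) k) * legendre CARD('n) k (t $ i))" if "norm t = 1" for k t
    using rep_kernel_harm_basis[OF n that e, of k] by (simp add: e_def inner_axis)
  have "ip (?Z j) (?Z k) = (LINT t|(sphere_measure :: (real^'n) measure).
      of_real (real (N_dim TYPE('n) j) * real (N_dim TYPE('n) k) * (legendre CARD('n) j (t $ i) * legendre CARD('n) k (t $ i))))"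
    unfolding ip_def by (rule Bochner_Integration.integral_cong) (simp_all add: space_sphere_measure Z)
  also have "\<dots> = of_real (real (N_dim TYPE('n) j) * real (N_dim TYPE('n) k) * I)"
    unfolding integral_complex_of_real I_def by simp
  finally have eq: "ip (?Z j) (?Z k) = of_real (real (N_dim TYPE('n) j) * real (N_dim TYPE('n) k) * I)" .
  have pos: "real (N_dim TYPE('n) j) > 0" "real (N_dim TYPE('n) k) > 0"
    using N_dim_pos[OF n] by simp_all
  show ?thesis
  proof (cases "j = k")
    case True
    have "?Z k \<in> cfun.span (harm_basis k)" by (rule rep_kernel_span)
    then have "ip (?Z k) (?Z k) = ?Z k e" by (rule ip_rep_kernel[OF harm_basis(1)])
    also have "\<dots> = of_real (real (N_dim TYPE('n) k))"
      using Z[OF e, of k] legendre_1[OF n] by (simp add: e_def axis_def)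
    finally have "real (N_dim TYPE('n) k) * real (N_dim TYPE('n) k) * I = real (N_dim TYPE('n) k)"
      using eq True by (metis of_real_eq_iff)
    then show ?thesis using pos True unfolding I_def[symmetric] by (simp add: field_simps)
  next
    case False
    have "ip (?Z j) (?Z k) = 0" by (rule Hd_sphere_orthogonal[OF n False mem mem])
    then have "real (N_dim TYPE('n) j) * real (N_dim TYPE('n) k) * I = 0"
      using eq by (metis of_real_eq_0_iff)
    then show ?thesis using pos False unfolding I_def[symmetric] by simp
  qed
qed

section \<open>Lower bound\<close>

text \<open>A continuous function on the sphere is coded by the rational cuts of its values at a
  countable dense set.\<close>

lemma csphere_inj_real: "\<exists>g :: (real^'n::finite \<Rightarrow> complex) \<Rightarrow> real. inj_on g csphere"
proof -
  obtain T :: "(real^'n) set" where T: "countable T" "T \<subseteq> sphere 0 1" "sphere 0 1 \<subseteq> closure T"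
    using separable[of "sphere 0 1 :: (real^'n) set"] by blast
  have "(axis undefined 1 :: real^'n) \<in> sphere 0 1" by simp
  then have "T \<noteq> {}" using T(3) by auto
  define t where "t = from_nat_into T"
  define cut where "cut = (\<lambda>f :: real^'n \<Rightarrow> complex.
    {m :: nat \<times> bool \<times> rat. case m of (k, b, q) \<Rightarrow> of_rat q < (if b then Re else Im) (f (t k))})"
  have "inj_on cut csphere"
  proof (rule inj_onI)
    fix f g :: "real^'n \<Rightarrow> complex" assume f: "f \<in> csphere" and g: "g \<in> csphere" and eq: "cut f = cut g"
    have real_eq: "a = b" if "\<And>q. real_of_rat q < a \<longleftrightarrow> real_of_rat q < b" for a b :: real
      using of_rat_dense[of a b] of_rat_dense[of b a] that by (metis linorder_less_linear order_less_irrefl order_less_asym)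
    have "(k, b, q) \<in> cut f \<longleftrightarrow> (k, b, q) \<in> cut g" for k b q using eq by simp
    then have iff: "real_of_rat q < (if b then Re else Im) (f (t k)) \<longleftrightarrow>
        real_of_rat q < (if b then Re else Im) (g (t k))" for k b q
      unfolding cut_def by simp
    have "f (t k) = g (t k)" for k
      by (rule complex_eqI; rule real_eq) (use iff[of _ True k] iff[of _ False k] in simp_all)
    moreover have "\<exists>k. x = t k" if "x \<in> T" for x
      unfolding t_def using from_nat_into_surj[OF T(1) that] by metis
    ultimately have onT: "f x = g x" if "x \<in> T" for x using that by metis
    show "f = g"
    proof (rule csphere_eqI[OF f g])
      fix x :: "real^'n" assume x: "x \<in> sphere 0 1"
      then have "x \<in> closure T" using T(3) by blast
      then obtain s where s: "\<And>k. s k \<in> T" "s \<longlonglongrightarrow> x"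
        unfolding closure_sequential by metis
      have lim: "(\<lambda>k. h (s k)) \<longlonglongrightarrow> h x" if "h \<in> csphere" for h
        using csphere_continuous[OF that] s x T(2) unfolding continuous_on_sequentially comp_def by blast
      have "(\<lambda>k. f (s k)) = (\<lambda>k. g (s k))" using onT s(1) by auto
      then show "f x = g x"
        using LIMSEQ_unique[OF lim[OF f]] lim[OF g] by simp
    qed
  qed
  moreover have "inj_on (\<lambda>A :: (nat \<times> bool \<times> rat) set. to_nat ` A) UNIV"
    by (rule inj_onI) (simp add: inj_image_eq_iff)
  moreover obtain h :: "nat set \<Rightarrow> real" where "inj_on h UNIV"
    using nat_sets_lepoll_reals01 unfolding lepoll_def by blast
  ultimately have "inj_on (h \<circ> (\<lambda>A. to_nat ` A) \<circ> cut) csphere"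
    by (intro comp_inj_on) (auto intro: inj_on_subset)
  then show ?thesis by blast
qed

text \<open>The Banach space \<open>C(S)\<close>, transported along an injection \<open>j\<close> of \<open>csphere\<close>. The inverse of
  \<open>j\<close> is set to 0 outside of the carrier, because the locale \<open>Metric_space\<close> demands symmetry of the
  distance on the whole type.\<close>

definition decode :: "((real^'n::finite \<Rightarrow> complex) \<Rightarrow> 'u) \<Rightarrow> 'u \<Rightarrow> real^'n \<Rightarrow> complex" where
  "decode j a = (if a \<in> j ` csphere then inv_into csphere j a else 0)"

definition csphere_space :: "((real^'n::finite \<Rightarrow> complex) \<Rightarrow> 'u) \<Rightarrow> 'u nspace" where
  "csphere_space j = \<lparr>carrier = j ` csphere, mult = undefined, one = undefined, zero = j 0,
     add = (\<lambda>a b. j (decode j a + decode j b)), smult = (\<lambda>c a. j (\<lambda>x. c * decode j a x)),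
     vnorm = (\<lambda>a. sup_norm (decode j a))\<rparr>"

lemma decode_csphere: "decode j a \<in> csphere"
  unfolding decode_def using cfun.subspace_0[OF subspace_csphere] by (auto intro: inv_into_into)

lemma decode_encode: "inj_on j csphere \<Longrightarrow> f \<in> csphere \<Longrightarrow> decode j (j f) = f"
  unfolding decode_def by simp

lemma encode_decode: "a \<in> j ` csphere \<Longrightarrow> j (decode j a) = a"
  unfolding decode_def by (simp add: f_inv_into_f)

text \<open>The uniform limit is controlled on the sphere only; \<open>sphere_restr\<close>
  normalizes its values elsewhere.\<close>

lemma csphere_complete:
  fixes f :: "nat \<Rightarrow> real^'n::finite \<Rightarrow> complex"
  assumes f: "\<And>k. f k \<in> csphere"
    and cauchy: "\<And>e. e > 0 \<Longrightarrow> \<exists>N. \<forall>m\<ge>N. \<forall>n\<ge>N. sup_norm (f m - f n) < e"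
  shows "\<exists>g\<in>csphere. \<forall>e>0. \<exists>N. \<forall>n\<ge>N. sup_norm (f n - g) < e"
proof -
  have diff: "f m - f n \<in> csphere" for m n by (rule cfun.subspace_diff[OF subspace_csphere f f])
  have "uniformly_Cauchy_on (sphere 0 1) f"
    unfolding uniformly_Cauchy_on_def
  proof (intro allI impI)
    fix e :: real assume "e > 0"
    then obtain N where N: "\<forall>m\<ge>N. \<forall>n\<ge>N. sup_norm (f m - f n) < e" using cauchy by blast
    have "dist (f m x) (f n x) < e" if "x \<in> sphere 0 1" "m \<ge> N" "n \<ge> N" for x m n
    proof -
      have "dist (f m x) (f n x) \<le> sup_norm (f m - f n)"
        using sup_norm_upper[OF diff, of x m n] that(1) by (simp add: dist_norm)
      also have "\<dots> < e" using N that by blast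
      finally show ?thesis .
    qed
    then show "\<exists>M. \<forall>x\<in>sphere 0 1. \<forall>m\<ge>M. \<forall>n\<ge>M. dist (f m x) (f n x) < e" by blast
  qed
  then obtain h where h: "uniform_limit (sphere 0 1) f h sequentially"
    using Cauchy_uniformly_convergent unfolding uniformly_convergent_on_def by blast
  have "continuous_on (sphere 0 1) h"
    by (rule uniform_limit_theorem[OF always_eventually h]) (use csphere_continuous[OF f] in auto)
  then have g: "sphere_restr h \<in> csphere" by (rule sphere_restr_csphere)
  have "\<exists>N. \<forall>n\<ge>N. sup_norm (f n - sphere_restr h) < e" if e: "e > 0" for e
  proof -
    obtain N where N: "\<forall>n\<ge>N. \<forall>x\<in>sphere 0 1. dist (f n x) (h x) < e / 2"
      using uniform_limitD[OF h, of "e / 2"] e unfolding eventually_sequentially by auto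
    have "sup_norm (f n - sphere_restr h) \<le> e / 2" if n: "n \<ge> N" for n
      by (rule sup_norm_least) (use N n in \<open>force simp: sphere_restr_apply dist_norm intro: less_imp_le\<close>)
    then show ?thesis using e by (intro exI[of _ N]) force
  qed
  then show ?thesis using g by blast
qed

lemma cring_complex_ring: "cring complex_ring"
proof (rule cringI)
  show "abelian_group complex_ring"
  proof (rule abelian_groupI)
    fix z assume "z \<in> carrier complex_ring"
    show "\<exists>w\<in>carrier complex_ring. w \<oplus>\<^bsub>complex_ring\<^esub> z = \<zero>\<^bsub>complex_ring\<^esub>"
      by (rule bexI[of _ "- z"]) (simp_all add: complex_ring_def)
  qed (simp_all add: complex_ring_def)
  show "comm_monoid complex_ring"
    by (rule comm_monoidI) (simp_all add: complex_ring_def)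
qed (simp add: complex_ring_def distrib_right)

lemma complex_banach_csphere_space:
  fixes j :: "(real^'n::finite \<Rightarrow> complex) \<Rightarrow> 'u"
  assumes j: "inj_on j csphere"
  shows "complex_banach (csphere_space j)"
proof -
  let ?Y = "csphere_space j" and ?d = "decode j"
  note sub = cfun.subspace_0[OF subspace_csphere] cfun.subspace_add[OF subspace_csphere]
    cfun.subspace_scale[OF subspace_csphere] cfun.subspace_diff[OF subspace_csphere]
    cfun.subspace_neg[OF subspace_csphere]
  note dj = decode_encode[OF j]
  have Y: "carrier ?Y = j ` csphere" "\<zero>\<^bsub>?Y\<^esub> = j 0" "a \<oplus>\<^bsub>?Y\<^esub> b = j (?d a + ?d b)"
    "c \<odot>\<^bsub>?Y\<^esub> a = j (\<lambda>x. c * ?d a x)" "vnorm ?Y a = sup_norm (?d a)" for a b c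
    by (simp_all add: csphere_space_def)
  have dsub: "?d a + ?d b \<in> csphere" "(\<lambda>x. k * ?d a x) \<in> csphere" for a b k
    by (rule sub(2)[OF decode_csphere decode_csphere], rule sub(3)[OF decode_csphere])
  have "Module.module complex_ring ?Y"
  proof (rule moduleI[OF cring_complex_ring])
    show "abelian_group ?Y"
    proof (rule abelian_groupI)
      fix a b c assume a: "a \<in> carrier ?Y"
      show "a \<oplus>\<^bsub>?Y\<^esub> b \<in> carrier ?Y"
        unfolding Y by (rule imageI[OF dsub(1)])
      show "(a \<oplus>\<^bsub>?Y\<^esub> b) \<oplus>\<^bsub>?Y\<^esub> c = a \<oplus>\<^bsub>?Y\<^esub> (b \<oplus>\<^bsub>?Y\<^esub> c)"
        unfolding Y dj[OF dsub(1)] by (simp only: add.assoc)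
      show "a \<oplus>\<^bsub>?Y\<^esub> b = b \<oplus>\<^bsub>?Y\<^esub> a"
        unfolding Y by (simp only: add.commute)
      show "\<zero>\<^bsub>?Y\<^esub> \<oplus>\<^bsub>?Y\<^esub> a = a"
        using encode_decode[of a j] a unfolding Y dj[OF sub(1)] by simp
      have "j (- ?d a) \<oplus>\<^bsub>?Y\<^esub> a = \<zero>\<^bsub>?Y\<^esub>" "j (- ?d a) \<in> carrier ?Y"
        unfolding Y dj[OF sub(5)[OF decode_csphere]] by (simp, rule imageI[OF sub(5)[OF decode_csphere]])
      then show "\<exists>b\<in>carrier ?Y. b \<oplus>\<^bsub>?Y\<^esub> a = \<zero>\<^bsub>?Y\<^esub>" by blast
    next
      show "\<zero>\<^bsub>?Y\<^esub> \<in> carrier ?Y"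
        unfolding Y by (rule imageI[OF sub(1)])
    qed
  next
    have eqs: "(\<lambda>x. (k + l) * f x) = (\<lambda>x. k * f x) + (\<lambda>x. l * f x)"
      "(\<lambda>x. k * (f + g) x) = (\<lambda>x. k * f x) + (\<lambda>x. k * g x)"
      "(\<lambda>x. k * (l * f x)) = (\<lambda>x. k * l * f x)" "(\<lambda>x. 1 * f x) = f"
      for k l and f g :: "real^'n \<Rightarrow> complex"
      by (rule ext, simp add: distrib_right distrib_left mult.assoc)+
    fix a b and k l :: complex
    assume a: "a \<in> carrier ?Y"
    show "k \<odot>\<^bsub>?Y\<^esub> a \<in> carrier ?Y"
      unfolding Y by (rule imageI[OF dsub(2)])
    show "(k \<oplus>\<^bsub>complex_ring\<^esub> l) \<odot>\<^bsub>?Y\<^esub> a = k \<odot>\<^bsub>?Y\<^esub> a \<oplus>\<^bsub>?Y\<^esub> l \<odot>\<^bsub>?Y\<^esub> a"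
      unfolding Y dj[OF dsub(2)] eqs(1)[symmetric] by (simp add: complex_ring_def)
    show "k \<odot>\<^bsub>?Y\<^esub> (a \<oplus>\<^bsub>?Y\<^esub> b) = k \<odot>\<^bsub>?Y\<^esub> a \<oplus>\<^bsub>?Y\<^esub> k \<odot>\<^bsub>?Y\<^esub> b"
      unfolding Y dj[OF dsub(2)] dj[OF dsub(1)] eqs(2) ..
    show "(k \<otimes>\<^bsub>complex_ring\<^esub> l) \<odot>\<^bsub>?Y\<^esub> a = k \<odot>\<^bsub>?Y\<^esub> (l \<odot>\<^bsub>?Y\<^esub> a)"
      unfolding Y dj[OF dsub(2)] eqs(3) by (simp add: complex_ring_def)
    show "\<one>\<^bsub>complex_ring\<^esub> \<odot>\<^bsub>?Y\<^esub> a = a"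
      using a encode_decode[of a j] unfolding Y by (simp add: complex_ring_def eqs(4))
  qed
  then interpret complex_module ?Y by (rule complex_module.intro)
  \<comment> \<open>The additive inverse is a definite description in the additive monoid. The
    formula holds for every \<open>b\<close> of the type, since \<open>decode\<close> always lands
    in \<open>csphere\<close>, and so the distance is the sup norm of a difference on the whole
    type.\<close>
  have minus: "\<ominus>\<^bsub>?Y\<^esub> b = j (- ?d b)" for b
  proof -
    have "u = j (- ?d b)" if u: "u \<in> j ` csphere" "j (?d b + ?d u) = j 0" for u
    proof -
      have "?d b + ?d u = 0"
        using u(2) inj_on_eq_iff[OF j dsub(1) sub(1)] by simp
      then have "?d u = - ?d b" by (simp only: eq_neg_iff_add_eq_0 add.commute)
      then show ?thesis using encode_decode[OF u(1)] by simp
    qed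
    moreover have "j (- ?d b) \<in> j ` csphere \<and> j (?d b + ?d (j (- ?d b))) = j 0 \<and>
        j (?d (j (- ?d b)) + ?d b) = j 0"
      unfolding dj[OF sub(5)[OF decode_csphere]] by (simp, rule imageI[OF sub(5)[OF decode_csphere]])
    moreover have "\<ominus>\<^bsub>?Y\<^esub> b = (THE u. u \<in> j ` csphere \<and> j (?d b + ?d u) = j 0 \<and> j (?d u + ?d b) = j 0)"
      by (simp add: a_inv_def m_inv_def csphere_space_def)
    ultimately show ?thesis by (smt (verit) the_equality)
  qed
  have dist: "vnorm ?Y (a \<ominus>\<^bsub>?Y\<^esub> b) = sup_norm (?d a - ?d b)" for a b
    by (simp add: a_minus_def minus Y dj sub decode_csphere)
  have metric: "Metric_space (carrier ?Y) (\<lambda>a b. vnorm ?Y (a \<ominus>\<^bsub>?Y\<^esub> b))"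
    unfolding dist
  proof
    fix a b c
    show "0 \<le> sup_norm (?d a - ?d b)" by (rule sup_norm_nonneg[OF sub(4)[OF decode_csphere decode_csphere]])
    show "sup_norm (?d a - ?d b) = sup_norm (?d b - ?d a)" by (simp add: norm_minus_commute)
    show "sup_norm (?d a - ?d b) = 0 \<longleftrightarrow> a = b" if "a \<in> carrier ?Y" "b \<in> carrier ?Y"
    proof -
      have "sup_norm (?d a - ?d b) = 0 \<longleftrightarrow> ?d a = ?d b"
        using sup_norm_eq_0_iff[OF sub(4)[OF decode_csphere decode_csphere]] by simp
      then show ?thesis using that encode_decode[of _ j] unfolding Y by metis
    qed
    show "sup_norm (?d a - ?d c) \<le> sup_norm (?d a - ?d b) + sup_norm (?d b - ?d c)"
      using sup_norm_triangle[OF sub(4)[OF decode_csphere decode_csphere] sub(4)[OF decode_csphere decode_csphere],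
          of j a j b j b j c] by simp
  qed
  show ?thesis
  proof
    fix a b and c :: complex assume a: "a \<in> carrier ?Y"
    show "vnorm ?Y a = 0 \<longleftrightarrow> a = \<zero>\<^bsub>?Y\<^esub>"
    proof -
      have "a = j 0 \<longleftrightarrow> ?d a = 0"
        using a encode_decode[of a j] dj[OF sub(1)] unfolding Y by metis
      then show ?thesis using sup_norm_eq_0_iff[OF decode_csphere] by (simp add: Y)
    qed
    show "vnorm ?Y (c \<odot>\<^bsub>?Y\<^esub> a) = cmod c * vnorm ?Y a"
      by (simp add: Y dj sub decode_csphere sup_norm_scale)
    show "vnorm ?Y (a \<oplus>\<^bsub>?Y\<^esub> b) \<le> vnorm ?Y a + vnorm ?Y b"
      by (simp only: Y dj[OF sub(2)[OF decode_csphere decode_csphere]] sup_norm_triangle[OF decode_csphere decode_csphere])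
  next
    interpret Metric_space "carrier ?Y" "\<lambda>a b. vnorm ?Y (a \<ominus>\<^bsub>?Y\<^esub> b)" by (rule metric)
    show mcomplete
      unfolding mcomplete_def
    proof (intro allI impI)
      fix \<sigma> assume \<sigma>: "MCauchy \<sigma>"
      have "\<exists>N. \<forall>m\<ge>N. \<forall>n\<ge>N. sup_norm (?d (\<sigma> m) - ?d (\<sigma> n)) < e" if "e > 0" for e
        using \<sigma>[unfolded MCauchy_def, unfolded dist, THEN conjunct2, THEN spec, THEN mp, OF that]
        by (elim exE) (rule exI, simp)
      then obtain g where g: "g \<in> csphere" "\<forall>e>0. \<exists>N. \<forall>n\<ge>N. sup_norm (?d (\<sigma> n) - g) < e"
        using csphere_complete[of "\<lambda>n. ?d (\<sigma> n)", OF decode_csphere] by blast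
      have "\<sigma> n \<in> carrier ?Y" for n using \<sigma>[unfolded MCauchy_def, THEN conjunct1] by blast
      then have "limitin mtopology \<sigma> (j g) sequentially"
        unfolding limit_metric_sequentially unfolding dist dj[OF g(1)] using g by (auto simp: Y(1))
      then show "\<exists>x. limitin mtopology \<sigma> x sequentially" ..
    qed
  qed
qed

section \<open>The trace of a projection against zonal polynomials\<close>

lemma harm_span_orthogonal:
  fixes f g :: "real^'n::finite \<Rightarrow> complex"
  assumes n: "CARD('n) \<ge> 2" and g: "g \<in> harm_span J" and f: "f \<in> Hd_sphere l" "l \<notin> J"
  shows "ip g f = 0"
proof -
  have "harm_span J \<subseteq> {g \<in> csphere. ip g f = 0}"
    unfolding harm_span_def
  proof (rule cfun.span_minimal)
    have "ip 0 f = 0" by (simp add: ip_def)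
    then show "cfun.subspace {g \<in> csphere. ip g f = 0}"
      by (intro cfun.subspaceI)
        (auto simp: ip_add_left ip_scale_left Hd_sphere_csphere[OF f(1)]
          cfun.subspace_0[OF subspace_csphere] cfun.subspace_add[OF subspace_csphere]
          cfun.subspace_scale[OF subspace_csphere])
    show "(\<Union>j\<in>J. Hd_sphere j) \<subseteq> {g \<in> csphere. ip g f = 0}"
      using f(2) by (auto intro: Hd_sphere_orthogonal[OF n _ _ f(1)] Hd_sphere_csphere)
  qed
  then show ?thesis using g by blast
qed

lemma linear_sum_scaled:
  fixes Q :: "(real^'n::finite \<Rightarrow> complex) \<Rightarrow> real^'n \<Rightarrow> complex"
  assumes add: "\<And>f g. f \<in> csphere \<Longrightarrow> g \<in> csphere \<Longrightarrow> Q (f + g) = Q f + Q g"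
    and scale: "\<And>c f. f \<in> csphere \<Longrightarrow> Q (\<lambda>x. c * f x) = (\<lambda>x. c * Q f x)"
    and A: "finite A" "\<And>a. a \<in> A \<Longrightarrow> h a \<in> csphere"
  shows "Q (\<lambda>x. \<Sum>a\<in>A. k a * h a x) = (\<lambda>x. \<Sum>a\<in>A. k a * Q (h a) x)"
    and "(\<lambda>x. \<Sum>a\<in>A. k a * h a x) \<in> csphere"
proof -
  have 0: "(0 :: real^'n \<Rightarrow> complex) \<in> csphere" by (rule cfun.subspace_0[OF subspace_csphere])
  have "Q (\<lambda>x. \<Sum>a\<in>A. k a * h a x) = (\<lambda>x. \<Sum>a\<in>A. k a * Q (h a) x) \<and> (\<lambda>x. \<Sum>a\<in>A. k a * h a x) \<in> csphere"
    using A
  proof (induction A rule: finite_induct)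
    case empty
    show ?case using scale[OF 0, of 0] 0 by (simp add: zero_fun_def)
  next
    case (insert a A)
    have eq: "(\<lambda>x. \<Sum>a\<in>insert a A. k a * h a x) = (\<lambda>x. k a * h a x) + (\<lambda>x. \<Sum>a\<in>A. k a * h a x)"
      using insert.hyps by (simp add: fun_eq_iff)
    have h: "h a \<in> csphere" using insert.prems by simp
    then have kh: "(\<lambda>x. k a * h a x) \<in> csphere" by (rule cfun.subspace_scale[OF subspace_csphere])
    have IH: "Q (\<lambda>x. \<Sum>a\<in>A. k a * h a x) = (\<lambda>x. \<Sum>a\<in>A. k a * Q (h a) x)"
        "(\<lambda>x. \<Sum>a\<in>A. k a * h a x) \<in> csphere"
      using insert by auto
    show ?case
      unfolding eq add[OF kh IH(2)] scale[OF h] IH(1)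
      using cfun.subspace_add[OF subspace_csphere kh IH(2)] insert.hyps by (simp add: fun_eq_iff)
  qed
  then show "Q (\<lambda>x. \<Sum>a\<in>A. k a * h a x) = (\<lambda>x. \<Sum>a\<in>A. k a * Q (h a) x)"
    "(\<lambda>x. \<Sum>a\<in>A. k a * h a x) \<in> csphere" by auto
qed

text \<open>Testing a projection \<open>Q\<close> on the zonal polynomials \<open>h\<^sub>x = p(\<langle>x, \<cdot>\<rangle>)\<close>: the average of
  \<open>(Q h\<^sub>x)(x)\<close> over \<open>x\<close> depends on \<open>Q\<close> only through its trace on the \<open>\<H>\<^sub>l\<close>, and replaces the
  averaging of \<open>Q\<close> over the rotation group.\<close>

lemma projection_norm_ge_integral:
  fixes Q :: "(real^'n::finite \<Rightarrow> complex) \<Rightarrow> real^'n \<Rightarrow> complex" and p :: "real poly"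
  assumes n: "CARD('n) \<ge> 2" and J: "finite J"
    and add: "\<And>f g. f \<in> csphere \<Longrightarrow> g \<in> csphere \<Longrightarrow> Q (f + g) = Q f + Q g"
    and scale: "\<And>c f. f \<in> csphere \<Longrightarrow> Q (\<lambda>x. c * f x) = (\<lambda>x. c * Q f x)"
    and range: "\<And>f. f \<in> csphere \<Longrightarrow> Q f \<in> harm_span J"
    and proj: "\<And>f. f \<in> harm_span J \<Longrightarrow> Q f = f"
    and bound: "\<And>f. f \<in> csphere \<Longrightarrow> sup_norm f \<le> 1 \<Longrightarrow> sup_norm (Q f) \<le> c"
    and p: "\<And>s. \<bar>s\<bar> \<le> 1 \<Longrightarrow> \<bar>poly p s\<bar> \<le> 1"
  shows "(LINT t|(sphere_measure :: (real^'n) measure). poly p (t $ i) * zonal_kernel TYPE('n) J (t $ i)) \<le> c"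
proof -
  let ?\<sigma> = "sphere_measure :: (real^'n) measure"
  define N where "N = (\<lambda>k. real (N_dim TYPE('n) k))"
  have N: "N k > 0" for k using N_dim_pos[OF n] by (simp add: N_def)
  define D where "D = degree p"
  obtain a where a: "\<And>t. poly p t = (\<Sum>l\<le>D. a l * legendre CARD('n) l t)"
    using poly_legendre[OF n] unfolding D_def by blast
  \<comment> \<open>Basis functions are tagged with their degree, so that a sum over
    \<open>A\<close> is a double sum.\<close>
  define A where "A = Sigma {..D} (harm_basis :: nat \<Rightarrow> (real^'n \<Rightarrow> complex) set)"
  have A: "finite A" unfolding A_def using orthonormalD(1)[OF harm_basis(1)] by blast
  have Ac: "snd m \<in> csphere" if "m \<in> A" for m
    using that harm_basis_csphere unfolding A_def by auto
  \<comment> \<open>The kernel of degree \<open>l\<close> is \<open>N l\<close> times the Legendre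
    polynomial, hence the division by \<open>N l\<close>. On the sphere \<open>h x\<close> is then
    the zonal polynomial with pole \<open>x\<close>, in a form to which \<open>Q\<close> applies
    termwise.\<close>
  define k where "k = (\<lambda>(x::real^'n) m. complex_of_real (a (fst m) / N (fst m)) * cnj (snd m x))"
  define h where "h = (\<lambda>(x::real^'n) (t::real^'n). \<Sum>m\<in>A. k x m * snd m t)"
  have h_val: "h x t = of_real (poly p (x \<bullet> t))" if x: "norm x = 1" and t: "norm t = 1" for x t
  proof -
    have "h x t = (\<Sum>l\<le>D. \<Sum>f\<in>harm_basis l. complex_of_real (a l / N l) * (f t * cnj (f x)))"
      unfolding h_def A_def k_def
      by (subst sum.Sigma) (auto simp: orthonormalD(1)[OF harm_basis(1)] mult_ac split_beta)
    also have "\<dots> = (\<Sum>l\<le>D. complex_of_real (a l / N l) * rep_kernel (harm_basis l) t x)"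
      by (simp add: rep_kernel_def sum_distrib_left)
    also have "\<dots> = (\<Sum>l\<le>D. complex_of_real (a l * legendre CARD('n) l (x \<bullet> t)))"
    proof (intro sum.cong refl)
      fix l
      have "rep_kernel (harm_basis l) t x = of_real (N l * legendre CARD('n) l (x \<bullet> t))"
        unfolding rep_kernel_harm_basis[OF n t x] N_def by (simp add: inner_commute)
      then show "complex_of_real (a l / N l) * rep_kernel (harm_basis l) t x =
          complex_of_real (a l * legendre CARD('n) l (x \<bullet> t))"
        using N[of l] by simp
    qed
    finally show ?thesis by (simp add: a)
  qed
  have Qh: "Q (h x) = (\<lambda>t. \<Sum>m\<in>A. k x m * Q (snd m) t)" "h x \<in> csphere" for x
    unfolding h_def by (rule linear_sum_scaled[of Q, OF add scale A Ac]; assumption)+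
  have Qc: "Q f \<in> csphere" if "f \<in> csphere" for f
  proof -
    have "harm_span J \<subseteq> (csphere :: (real^'n \<Rightarrow> complex) set)"
      unfolding harm_span_eq by (rule orthonormalD(4)[OF orthonormal_harm_basis_Union[OF n J]])
    then show ?thesis using range[OF that] by blast
  qed
  \<comment> \<open>The place where \<open>Q\<close> drops out: on degrees in \<open>J\<close> it is
    the identity, and for the other degrees its values are orthogonal to the argument.\<close>
  have ip_Q: "ip (Q f) f = (if l \<in> J then 1 else 0)" if f: "f \<in> harm_basis l" for l f
  proof -
    have f': "f \<in> Hd_sphere l" unfolding harm_basis(2)[symmetric] using f by (rule cfun.span_base)
    show ?thesis
    proof (cases "l \<in> J")
      case True
      then have "f \<in> harm_span J" unfolding harm_span_def using f' by (intro cfun.span_base) blast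
      then show ?thesis using True proj orthonormalD(5)[OF harm_basis(1) f f] by simp
    next
      case False
      then show ?thesis
        using harm_span_orthogonal[OF n range[OF harm_basis_csphere[OF f]] f'] by simp
    qed
  qed
  let ?J = "{l. l \<le> D \<and> l \<in> J}"
  have "(LINT x|?\<sigma>. Q (h x) x) = (LINT x|?\<sigma>. (\<Sum>m\<in>A. of_real (a (fst m) / N (fst m)) * (Q (snd m) x * cnj (snd m x))))"
    by (simp add: Qh(1) k_def mult_ac)
  also have "\<dots> = (\<Sum>m\<in>A. of_real (a (fst m) / N (fst m)) * ip (Q (snd m)) (snd m))"
    unfolding ip_def integral_mult_right_zero[symmetric]
    by (rule Bochner_Integration.integral_sum) (intro integrable_mult_right integrable_ip Qc Ac)
  also have "\<dots> = (\<Sum>l\<le>D. \<Sum>f\<in>(harm_basis l :: (real^'n \<Rightarrow> complex) set). of_real (a l / N l) * ip (Q f) f)"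
    unfolding A_def by (subst sum.Sigma) (auto simp: orthonormalD(1)[OF harm_basis(1)] split_beta)
  also have "\<dots> = (\<Sum>l\<le>D. of_real (if l \<in> J then a l else 0))"
  proof (intro sum.cong refl)
    fix l
    have "(\<Sum>f\<in>(harm_basis l :: (real^'n \<Rightarrow> complex) set). complex_of_real (a l / N l) * ip (Q f) f) =
        (\<Sum>f\<in>(harm_basis l :: (real^'n \<Rightarrow> complex) set). of_real (if l \<in> J then a l / N l else 0))"
      by (intro sum.cong refl) (simp add: ip_Q)
    \<comment> \<open>The basis of degree \<open>l\<close> has \<open>N l\<close> elements with
      equal contributions, which cancels the division by \<open>N l\<close>.\<close>
    also have "\<dots> = of_real (N l * (if l \<in> J then a l / N l else 0))"
      by (simp add: card_harm_basis N_def)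
    also have "\<dots> = of_real (if l \<in> J then a l else 0)" using N[of l] by simp
    finally show "(\<Sum>f\<in>(harm_basis l :: (real^'n \<Rightarrow> complex) set). complex_of_real (a l / N l) * ip (Q f) f) =
        of_real (if l \<in> J then a l else 0)" .
  qed
  finally have trace: "(LINT x|?\<sigma>. Q (h x) x) = of_real (\<Sum>l\<le>D. if l \<in> J then a l else 0)" by simp
  \<comment> \<open>A second evaluation of the same number: orthogonality of the Legendre
    polynomials leaves the coefficients \<open>a l\<close> with \<open>l\<close> in
    \<open>J\<close>.\<close>
  have "(LINT t|?\<sigma>. poly p (t $ i) * zonal_kernel TYPE('n) J (t $ i)) =
      (LINT t|?\<sigma>. (\<Sum>l\<le>D. \<Sum>j\<in>J. a l * N j * (legendre CARD('n) l (t $ i) * legendre CARD('n) j (t $ i))))"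
    unfolding a zonal_kernel_def sum_product N_def by (simp add: mult_ac)
  also have "\<dots> = (\<Sum>l\<le>D. (LINT t|?\<sigma>. (\<Sum>j\<in>J. a l * N j * (legendre CARD('n) l (t $ i) * legendre CARD('n) j (t $ i)))))"
    by (rule Bochner_Integration.integral_sum) (intro integrable_sphere_measure continuous_intros)
  also have "\<dots> = (\<Sum>l\<le>D. \<Sum>j\<in>J. (LINT t|?\<sigma>. a l * N j * (legendre CARD('n) l (t $ i) * legendre CARD('n) j (t $ i))))"
    by (intro sum.cong refl Bochner_Integration.integral_sum integrable_sphere_measure continuous_intros)
  also have "\<dots> = (\<Sum>l\<le>D. \<Sum>j\<in>J. if j = l then a l else 0)"
  proof (intro sum.cong refl)
    fix l j
    have "(LINT t|?\<sigma>. a l * N j * (legendre CARD('n) l (t $ i) * legendre CARD('n) j (t $ i))) =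
        a l * N j * (if l = j then 1 / N j else 0)"
      unfolding integral_mult_right_zero integral_legendre_mult[OF n] N_def ..
    also have "\<dots> = (if j = l then a l else 0)" using N[of l] by simp
    finally show "(LINT t|?\<sigma>. a l * N j * (legendre CARD('n) l (t $ i) * legendre CARD('n) j (t $ i))) =
        (if j = l then a l else 0)" .
  qed
  also have "\<dots> = (\<Sum>l\<le>D. if l \<in> J then a l else 0)"
    using J by (intro sum.cong refl) simp
  finally have "(LINT t|?\<sigma>. poly p (t $ i) * zonal_kernel TYPE('n) J (t $ i)) = Re (LINT x|?\<sigma>. Q (h x) x)"
    using trace by simp
  also have "\<dots> \<le> cmod (LINT x|?\<sigma>. Q (h x) x)" by (rule complex_Re_le_cmod)
  also have "\<dots> \<le> (LINT x|?\<sigma>. cmod (Q (h x) x))" by (rule integral_norm_bound)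
  also have "\<dots> \<le> (LINT x|?\<sigma>. c)"
  proof (rule integral_mono)
    show "integrable ?\<sigma> (\<lambda>x. cmod (Q (h x) x))"
      unfolding Qh(1) k_def
      by (intro integrable_sphere_measure continuous_intros csphere_continuous Qc Ac)
    show "integrable ?\<sigma> (\<lambda>x. c)" by (intro integrable_sphere_measure continuous_intros)
    fix x assume "x \<in> space ?\<sigma>"
    then have x: "norm x = 1" by (simp add: space_sphere_measure)
    have "sup_norm (h x) \<le> 1"
    proof (rule sup_norm_least)
      fix t :: "real^'n" assume t: "norm t = 1"
      have "\<bar>x \<bullet> t\<bar> \<le> 1" using Cauchy_Schwarz_ineq2[of x t] x t by simp
      then show "cmod (h x t) \<le> 1" unfolding h_val[OF x t] using p by simp
    qed
    then show "cmod (Q (h x) x) \<le> c"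
      using bound[OF Qh(2)] sup_norm_upper[OF Qc[OF Qh(2)] x] order_trans by blast
  qed
  also have "\<dots> = c" by (rule integral_sphere_const)
  finally show ?thesis .
qed

text \<open>The discontinuous sign of \<open>\<kappa>\<close> is replaced by
  \<open>\<kappa> / (\<bar>\<kappa>\<bar> + e)\<close>, of modulus at most 1, and this by a
  polynomial within \<open>e\<close>. After multiplication by \<open>\<kappa>\<close> the first
  replacement loses at most \<open>e\<close> and the second at most
  \<open>e * \<bar>\<kappa>\<bar>\<close>.\<close>

lemma polynomial_sign_approx:
  fixes \<kappa> :: "real \<Rightarrow> real"
  assumes \<kappa>: "continuous_on UNIV \<kappa>" and e: "0 < e"
  shows "\<exists>p. (\<forall>s. \<bar>s\<bar> \<le> 1 \<longrightarrow> \<bar>poly p s\<bar> \<le> 1 \<and> (1 - e) * \<bar>\<kappa> s\<bar> - e \<le> (1 + e) * (poly p s * \<kappa> s))"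
proof -
  define g where "g = (\<lambda>s. \<kappa> s / (\<bar>\<kappa> s\<bar> + e))"
  have pos: "\<bar>\<kappa> s\<bar> + e > 0" for s using e by (simp add: add_nonneg_pos)
  have "continuous_on {-1..1} g"
    unfolding g_def using pos by (intro continuous_intros continuous_on_subset[OF \<kappa>]) (auto simp: less_imp_neq[symmetric])
  then obtain q where q: "real_polynomial_function q" "\<And>s. s \<in> {-1..1} \<Longrightarrow> \<bar>g s - q s\<bar> < e"
    using Stone_Weierstrass_real_polynomial_function[of "{-1..1}" g e] e by auto
  obtain b m where "q = (\<lambda>s. \<Sum>i\<le>m. b i * s ^ i)"
    using q(1) unfolding real_polynomial_function_iff_sum by blast
  then have qp: "poly (\<Sum>i\<le>m. monom (b i) i) s = q s" for s
    by (simp add: poly_sum poly_monom)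
  \<comment> \<open>The approximating polynomial may reach \<open>1 + e\<close>; dividing by this
    number restores the bound 1 and causes the factor \<open>1 + e\<close> in the claim.\<close>
  let ?p = "Polynomial.smult (1 / (1 + e)) (\<Sum>i\<le>m. monom (b i) i)"
  have "\<bar>poly ?p s\<bar> \<le> 1 \<and> (1 - e) * \<bar>\<kappa> s\<bar> - e \<le> (1 + e) * (poly ?p s * \<kappa> s)" if s: "\<bar>s\<bar> \<le> 1" for s
  proof
    have close: "\<bar>g s - q s\<bar> < e" using q(2)[of s] s by (simp add: abs_le_iff)
    have g1: "\<bar>g s\<bar> \<le> 1" unfolding g_def using pos[of s] e by simp
    have ps: "poly ?p s = q s / (1 + e)" by (simp add: qp)
    show "\<bar>poly ?p s\<bar> \<le> 1"
    proof -
      have "\<bar>q s\<bar> \<le> 1 + e" using close g1 by linarith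
      then show ?thesis unfolding ps using e by simp
    qed
    have "\<bar>\<kappa> s\<bar> - e \<le> g s * \<kappa> s"
    proof -
      \<comment> \<open>The left side is \<open>\<kappa>^2 - e^2\<close>.\<close>
      have "(\<bar>\<kappa> s\<bar> - e) * (\<bar>\<kappa> s\<bar> + e) \<le> \<kappa> s * \<kappa> s"
        by (simp add: algebra_simps flip: abs_mult)
      then show ?thesis unfolding g_def using pos[of s] by (simp add: pos_le_divide_eq)
    qed
    moreover have "g s * \<kappa> s - q s * \<kappa> s \<le> e * \<bar>\<kappa> s\<bar>"
    proof -
      have "g s * \<kappa> s - q s * \<kappa> s \<le> \<bar>g s - q s\<bar> * \<bar>\<kappa> s\<bar>"
        by (simp flip: left_diff_distrib abs_mult)
      also have "\<dots> \<le> e * \<bar>\<kappa> s\<bar>" using close by (intro mult_right_mono) auto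
      finally show ?thesis .
    qed
    moreover have "(1 + e) * (poly ?p s * \<kappa> s) = q s * \<kappa> s" unfolding ps using e by simp
    ultimately show "(1 - e) * \<bar>\<kappa> s\<bar> - e \<le> (1 + e) * (poly ?p s * \<kappa> s)"
      by (simp add: algebra_simps)
  qed
  then show ?thesis by blast
qed

text \<open>Duality between \<open>L^1\<close> and the sup norm: polynomials in one coordinate,
  bounded by 1, come close enough to the sign of the kernel.\<close>

lemma integral_zonal_kernel_le:
  fixes i :: "'n::finite"
  assumes "\<And>p. (\<And>s. \<bar>s\<bar> \<le> 1 \<Longrightarrow> \<bar>poly p s\<bar> \<le> 1) \<Longrightarrow>
      (LINT t|(sphere_measure :: (real^'n) measure). poly p (t $ i) * zonal_kernel TYPE('n) J (t $ i)) \<le> c"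
  shows "(LINT t|(sphere_measure :: (real^'n) measure). \<bar>zonal_kernel TYPE('n) J (t $ i)\<bar>) \<le> c"
proof -
  let ?\<sigma> = "sphere_measure :: (real^'n) measure"
  let ?\<kappa> = "zonal_kernel TYPE('n) J"
  define \<Lambda> where "\<Lambda> = (LINT t|?\<sigma>. \<bar>?\<kappa> (t $ i)\<bar>)"
  have \<Lambda>: "\<Lambda> \<ge> 0" unfolding \<Lambda>_def by simp
  \<comment> \<open>The zero polynomial is an admissible test function.\<close>
  have c: "c \<ge> 0" using assms[of 0] by simp
  have step: "(1 - e) * \<Lambda> - e \<le> (1 + e) * c" if e: "e > 0" for e
  proof -
    obtain p where p: "\<And>s. \<bar>s\<bar> \<le> 1 \<Longrightarrow> \<bar>poly p s\<bar> \<le> 1"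
        "\<And>s. \<bar>s\<bar> \<le> 1 \<Longrightarrow> (1 - e) * \<bar>?\<kappa> s\<bar> - e \<le> (1 + e) * (poly p s * ?\<kappa> s)"
      using polynomial_sign_approx[OF _ e, of ?\<kappa>] continuous_on_zonal_kernel[OF continuous_on_id]
      unfolding id_def by blast
    have "(1 - e) * \<Lambda> - e = (LINT t|?\<sigma>. (1 - e) * \<bar>?\<kappa> (t $ i)\<bar> - e)"
    proof -
      have "integrable ?\<sigma> (\<lambda>t. (1 - e) * \<bar>?\<kappa> (t $ i)\<bar>)" "integrable ?\<sigma> (\<lambda>t. e)"
        by (intro integrable_sphere_measure continuous_intros)+
      then have "(LINT t|?\<sigma>. (1 - e) * \<bar>?\<kappa> (t $ i)\<bar> - e) = (LINT t|?\<sigma>. (1 - e) * \<bar>?\<kappa> (t $ i)\<bar>) - (LINT t|?\<sigma>. e)"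
        by (rule Bochner_Integration.integral_diff)
      then show ?thesis unfolding integral_sphere_const \<Lambda>_def by simp
    qed
    also have "\<dots> \<le> (LINT t|?\<sigma>. (1 + e) * (poly p (t $ i) * ?\<kappa> (t $ i)))"
    proof (rule integral_mono)
      show "integrable ?\<sigma> (\<lambda>t. (1 - e) * \<bar>?\<kappa> (t $ i)\<bar> - e)"
        "integrable ?\<sigma> (\<lambda>t. (1 + e) * (poly p (t $ i) * ?\<kappa> (t $ i)))"
        by (intro integrable_sphere_measure continuous_intros)+
      fix t assume "t \<in> space ?\<sigma>"
      then have "\<bar>t $ i\<bar> \<le> 1"
        using component_le_norm_cart[of t i] by (simp add: space_sphere_measure)
      then show "(1 - e) * \<bar>?\<kappa> (t $ i)\<bar> - e \<le> (1 + e) * (poly p (t $ i) * ?\<kappa> (t $ i))" by (rule p(2))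
    qed
    also have "\<dots> = (1 + e) * (LINT t|?\<sigma>. poly p (t $ i) * ?\<kappa> (t $ i))" by simp
    also have "\<dots> \<le> (1 + e) * c" using e assms[OF p(1)] by (intro mult_left_mono) auto
    finally show ?thesis .
  qed
  have "\<Lambda> \<le> c"
  proof (rule field_le_epsilon)
    fix \<epsilon> :: real assume \<epsilon>: "\<epsilon> > 0"
    have s: "\<Lambda> + 1 + c > 0" using \<Lambda> c by simp
    \<comment> \<open>\<open>step\<close> rearranges to
      \<open>\<Lambda> \<le> c + e * (\<Lambda> + 1 + c)\<close>.\<close>
    define e where "e = \<epsilon> / (\<Lambda> + 1 + c)"
    have "e > 0" "e * (\<Lambda> + 1 + c) = \<epsilon>" using \<epsilon> s by (simp_all add: e_def)
    then show "\<Lambda> \<le> c + \<epsilon>" using step[of e] by (simp add: algebra_simps)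
  qed
  then show ?thesis by (simp add: \<Lambda>_def)
qed

text \<open>The upper bound holds for each target space separately and so bounds the supremum. For
  the lower bound one target suffices: the copy of \<open>C(S)\<close> inside \<open>'u\<close>,
  where the transport map \<open>j\<close> is at the same time the isometric embedding.\<close>

theorem projection_const_harm_span:
  fixes i :: "'n::finite"
  assumes n: "CARD('n) \<ge> 2" and J: "finite J" and u: "\<exists>f :: real \<Rightarrow> 'u. inj f"
  shows "projection_const TYPE('u) (sup_normed (harm_span J :: (real^'n \<Rightarrow> complex) set)) =
    ereal (LINT \<eta>|(sphere_measure :: (real^'n) measure). \<bar>zonal_kernel TYPE('n) J (\<eta> $ i)\<bar>)"
    (is "_ = ereal ?\<Lambda>")
proof (rule antisym)
  let ?F = "harm_span J :: (real^'n \<Rightarrow> complex) set"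
  let ?B = "\<Union>j\<in>J. harm_basis j :: (real^'n \<Rightarrow> complex) set"
  note B = orthonormal_harm_basis_Union[OF n J]
  have carr: "carrier (sup_normed ?F) = ?F" by (simp add: sup_normed_def)
  have Fc: "?F \<subseteq> csphere" unfolding harm_span_eq by (rule orthonormalD(4)[OF B])
  have rep_kernel: "(LINT t|sphere_measure. cmod (rep_kernel ?B x t)) = ?\<Lambda>" if x: "norm x = 1" for x
  proof -
    have "(LINT t|sphere_measure. cmod (rep_kernel ?B x t)) =
        (LINT t|(sphere_measure :: (real^'n) measure). \<bar>zonal_kernel TYPE('n) J (x \<bullet> t)\<bar>)"
      by (rule Bochner_Integration.integral_cong)
        (simp_all add: space_sphere_measure rep_kernel_harm_basis_Union[OF n J x])
    also have "\<dots> = ?\<Lambda>"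
      by (rule integral_sphere_inner[OF _ x, of "\<lambda>s. \<bar>zonal_kernel TYPE('n) J s\<bar>"])
        (intro continuous_intros)
    finally show ?thesis .
  qed
  show "projection_const TYPE('u) (sup_normed ?F) \<le> ereal ?\<Lambda>"
    unfolding projection_const_def
  proof (rule Sup_least)
    fix r assume "r \<in> {rel_projection_const (I ` carrier (sup_normed ?F)) Y | (Y :: 'u nspace) I.
        complex_banach Y \<and> linear_isometry (sup_normed ?F) Y I}"
    then obtain Y :: "'u nspace" and I where r: "r = rel_projection_const (I ` carrier (sup_normed ?F)) Y"
      and YI: "complex_banach Y" "linear_isometry (sup_normed ?F) Y I"
      by auto
    show "r \<le> ereal ?\<Lambda>"
      unfolding r harm_span_eq
      by (rule rel_projection_const_le[OF B YI(1) YI(2)[unfolded harm_span_eq]]) (simp add: rep_kernel)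
  qed
  obtain j :: "(real^'n \<Rightarrow> complex) \<Rightarrow> 'u" where j: "inj_on j csphere"
  proof -
    obtain g :: "(real^'n \<Rightarrow> complex) \<Rightarrow> real" where g: "inj_on g csphere"
      using csphere_inj_real by blast
    obtain f :: "real \<Rightarrow> 'u" where "inj f" using u by blast
    then have "inj_on (f \<circ> g) csphere" using g by (intro comp_inj_on) (auto intro: inj_on_subset)
    then show thesis by (rule that)
  qed
  let ?Y = "csphere_space j" and ?d = "decode j"
  note dj = decode_encode[OF j]
  have Fc': "f \<in> csphere" if "f \<in> ?F" for f using Fc that by blast
  have isom: "linear_isometry (sup_normed ?F) ?Y j"
    unfolding linear_isometry_def linear_op_def sup_normed_def csphere_space_def
    by (auto simp: dj Fc')
  have "ereal ?\<Lambda> \<le> rel_projection_const (j ` carrier (sup_normed ?F)) ?Y"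
    unfolding rel_projection_const_def
  proof (rule Inf_greatest)
    fix r assume "r \<in> {op_norm ?Y ?Y P | P. linear_op ?Y ?Y P \<and> op_norm ?Y ?Y P < \<infinity> \<and>
       P ` carrier ?Y \<subseteq> j ` carrier (sup_normed ?F) \<and> (\<forall>x\<in>j ` carrier (sup_normed ?F). P x = x)}"
    then obtain P where r: "r = op_norm ?Y ?Y P" and P: "linear_op ?Y ?Y P"
      and fin: "op_norm ?Y ?Y P < \<infinity>"
      and PF: "\<And>a. a \<in> carrier ?Y \<Longrightarrow> P a \<in> j ` ?F" and PI: "\<And>f. f \<in> ?F \<Longrightarrow> P (j f) = j f"
      unfolding carr by blast
    have Ycarr: "j f \<in> carrier ?Y" if "f \<in> csphere" for f
      using that by (simp add: csphere_space_def)
    have norm: "ereal (vnorm ?Y (P (j f))) \<le> op_norm ?Y ?Y P" if f: "f \<in> csphere" "sup_norm f \<le> 1" for f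
      unfolding op_norm_def
      by (rule SUP_upper) (use f Ycarr in \<open>simp add: csphere_space_def dj\<close>)
    have z: "(0 :: real^'n \<Rightarrow> complex) \<in> csphere" by (rule cfun.subspace_0[OF subspace_csphere])
    \<comment> \<open>The zero function is a vector of the unit ball, so the supremum in
      \<open>op_norm\<close> is not over the empty set and the norm of \<open>P\<close> is a real
      number \<open>c\<close>.\<close>
    have "sup_norm (0 :: real^'n \<Rightarrow> complex) \<le> 1" using sup_norm_eq_0_iff[OF z] by simp
    then have "op_norm ?Y ?Y P \<noteq> - \<infinity>" using norm[OF z] by auto
    then obtain c where c: "op_norm ?Y ?Y P = ereal c" using fin by (cases "op_norm ?Y ?Y P") auto
    define Q where "Q = (\<lambda>f. ?d (P (j f)))"
    have QF: "Q f \<in> ?F" if f: "f \<in> csphere" for f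
    proof -
      obtain g where g: "g \<in> ?F" "P (j f) = j g" using PF[OF Ycarr[OF f]] by blast
      then have "Q f = g" unfolding Q_def using dj[of g] Fc by auto
      then show ?thesis using g by simp
    qed
    have Padd: "P (j f \<oplus>\<^bsub>?Y\<^esub> j g) = P (j f) \<oplus>\<^bsub>?Y\<^esub> P (j g)" if "f \<in> csphere" "g \<in> csphere" for f g
      using P Ycarr that unfolding linear_op_def by blast
    have Pscal: "P (k \<odot>\<^bsub>?Y\<^esub> j f) = k \<odot>\<^bsub>?Y\<^esub> P (j f)" if "f \<in> csphere" for k f
      using P Ycarr that unfolding linear_op_def by blast
    have "?\<Lambda> \<le> c"
    proof (rule integral_zonal_kernel_le, rule projection_norm_ge_integral[OF n J, of Q])
      fix f g :: "real^'n \<Rightarrow> complex" and k assume f: "f \<in> csphere"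
      have dd: "?d a + ?d b \<in> csphere" "(\<lambda>x. k * ?d a x) \<in> csphere" for a b k
        by (rule cfun.subspace_add[OF subspace_csphere decode_csphere decode_csphere],
            rule cfun.subspace_scale[OF subspace_csphere decode_csphere])
      show "Q f \<in> ?F" by (rule QF[OF f])
      show "Q (\<lambda>x. k * f x) = (\<lambda>x. k * Q f x)"
        using Pscal[OF f, of k] f by (simp add: Q_def csphere_space_def dj dd)
      show "sup_norm (Q f) \<le> c" if "sup_norm f \<le> 1"
        using norm[OF f that] unfolding c by (simp add: csphere_space_def Q_def)
      assume g: "g \<in> csphere"
      show "Q (f + g) = Q f + Q g"
        using Padd[OF f g] f g by (simp add: Q_def csphere_space_def dj dd)
    next
      fix f assume "f \<in> ?F"
      then show "Q f = f" unfolding Q_def using PI dj Fc by auto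
    qed
    then show "ereal ?\<Lambda> \<le> r" unfolding r c by simp
  qed
  also have "\<dots> \<le> projection_const TYPE('u) (sup_normed ?F)"
    unfolding projection_const_def
    by (rule Sup_upper) (use complex_banach_csphere_space[OF j] isom in blast)
  finally show "ereal ?\<Lambda> \<le> projection_const TYPE('u) (sup_normed ?F)" .
qed

theorem theorem3p7:
  fixes d :: nat and i :: "'n::finite"
  assumes "CARD('n) \<ge> 2" and "d \<ge> 1"
    and "\<exists>f :: real \<Rightarrow> 'u. inj f"
  shows
    "projection_const TYPE('u) (sup_normed (Hd_sphere d :: (real^'n \<Rightarrow> complex) set)) =
       ereal (real (N_dim TYPE('n) d) *
         (LINT \<eta>|(sphere_measure :: (real^'n) measure). \<bar>legendre CARD('n) d (\<eta> $ i)\<bar>)) \<and>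
     projection_const TYPE('u) (sup_normed (Pd_sphere d :: (real^'n \<Rightarrow> complex) set)) =
       ereal (LINT \<eta>|(sphere_measure :: (real^'n) measure).
         \<bar>\<Sum>j\<le>d div 2. real (N_dim TYPE('n) (d - 2 * j)) *
            legendre CARD('n) (d - 2 * j) (\<eta> $ i)\<bar>) \<and>
     projection_const TYPE('u) (sup_normed (Ple_sphere d :: (real^'n \<Rightarrow> complex) set)) =
       ereal (LINT \<eta>|(sphere_measure :: (real^'n) measure).
         \<bar>\<Sum>j\<le>d. real (N_dim TYPE('n) j) * legendre CARD('n) j (\<eta> $ i)\<bar>)"
proof (intro conjI)
  note main = projection_const_harm_span[where i = i, OF assms(1) _ assms(3)]
  show "projection_const TYPE('u) (sup_normed (Hd_sphere d :: (real^'n \<Rightarrow> complex) set)) =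
       ereal (real (N_dim TYPE('n) d) *
         (LINT \<eta>|(sphere_measure :: (real^'n) measure). \<bar>legendre CARD('n) d (\<eta> $ i)\<bar>))"
    unfolding Hd_sphere_eq_harm_span using main[of "{d}"] by (simp add: zonal_kernel_def abs_mult)
  \<comment> \<open>Distinct \<open>j\<close> give distinct degrees because
    \<open>2 * j \<le> d\<close>, so the sum over the set of degrees is the sum over
    \<open>j\<close>.\<close>
  have "inj_on (\<lambda>j. d - 2 * j) {..d div 2}"
    by (rule inj_onI) auto
  then show "projection_const TYPE('u) (sup_normed (Pd_sphere d :: (real^'n \<Rightarrow> complex) set)) =
       ereal (LINT \<eta>|(sphere_measure :: (real^'n) measure).
         \<bar>\<Sum>j\<le>d div 2. real (N_dim TYPE('n) (d - 2 * j)) *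
            legendre CARD('n) (d - 2 * j) (\<eta> $ i)\<bar>)"
    unfolding Pd_sphere_eq_harm_span[OF assms(1)]
    using main[of "(\<lambda>j. d - 2 * j) ` {..d div 2}"] by (simp add: zonal_kernel_def sum.reindex)
  show "projection_const TYPE('u) (sup_normed (Ple_sphere d :: (real^'n \<Rightarrow> complex) set)) =
       ereal (LINT \<eta>|(sphere_measure :: (real^'n) measure).
         \<bar>\<Sum>j\<le>d. real (N_dim TYPE('n) j) * legendre CARD('n) j (\<eta> $ i)\<bar>)"
    unfolding Ple_sphere_eq_harm_span[OF assms(1)]
    using main[of "{..d}"] by (simp add: zonal_kernel_def)
qed

end
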